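(* Let $\alpha\in(1,2)$, $\beta\in\mathbb{R}$, $\sigma\in\mathbb{R}\setminus\{0\}$, and let $(L^\alpha_t)_{t\in\mathbb{R}}$ be the truncated $\alpha$-stable process on $\mathbb{R}$. Then the Lyapunov exponent $\lambda_\beta^\infty$ associated with the unique invariant measure $\mu$, $\mu_\omega=\delta_{a_\beta(\omega)}$, of the random dynamical system generated by $$\mathrm{d}X_t=(\beta X_t-X_t^3)\,\mathrm{d}t+\sigma\,\mathrm{d}L^\alpha_t,\qquad X_0\in\mathbb{R},$$ is negative: $\lambda_\beta^\infty<0$.
   Context: Noise. For $\alpha\in(0,2)$ let $\nu_\alpha(\mathrm{d}z)=c_\alpha|z|^{-1-\alpha}\,\mathrm{d}z$ on $\mathbb{R}\setminus\{0\}$, $c_\alpha=\frac{\alpha}{2^{1-\alpha}\pi^{1/2}}\frac{\Gamma((1+\alpha)/2)}{\Gamma(1-\alpha/2)}$. The truncated process is the two-sided Lévy process with Lévy measure $\nu=\nu_\alpha|_{\{|z|<1\}}$ and Lévy–Itô decomposition $L_t=\int_{|z|<1}z\,\widetilde N(t,\mathrm{d}z)$, where $N$ is the Poisson random measure of jumps and $\widetilde N(t,\mathrm{d}z)=N(t,\mathrm{d}z)-t\nu(\mathrm{d}z)$. Random dynamical system. $(\Omega,\mathcal F,\mathbb P)$ is the canonical space of two-sided càdlàg paths with $L_t(\omega)=\omega(t)$, $\omega(0)=0$, and $\theta_t\omega(\cdot)=\omega(t+\cdot)-\omega(t)$. The equation generates a random dynamical system (cocycle) $\varphi=\varphi_\beta$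 over $\theta$: $\varphi(t,\omega,x)$ is the solution at time $t\ge0$ started at $x$ at time $0$. An invariant measure for $\varphi$ is a probability measure $\mu$ on $\Omega\times\mathbb{R}$ with $\Omega$-marginal $\mathbb P$ that is invariant under the skew product $\Theta(t)(\omega,x)=(\theta_t\omega,\varphi(t,\omega,x))$; $\mu_\omega$ denotes its disintegration with respect to $\mathbb P$. The system has a random attractor consisting of a single point $\{a_\beta(\omega)\}$, with $\varphi(t,\omega,a_\beta(\omega))=a_\beta(\theta_t\omega)$, and $\mu_\omega=\delta_{a_\beta(\omega)}$ defines its unique invariant measure. Lyapunov exponent. With $\Phi_\beta(t,\omega)=\frac{\partial\varphi_\beta}{\partial x}(t,\omega,a_\beta(\omega))=\exp\Big(\int_0^t(\beta-3a_\beta(\theta_s\omega)^2)\,\mathrm{d}s\Big)$, the Lyapunov exponent is the ($\mathbb P$-a.s. constant) limit $\lambda_\beta^\infty=\lim_{T\to\infty}\frac1T\ln|\Phi_\beta(T,\omega)|$. *)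

theory Defs
  imports "HOL-Probability.Probability"
begin

definition cadlag :: "(real \<Rightarrow> real) \<Rightarrow> bool" where
  "cadlag \<omega> \<longleftrightarrow> (\<forall>t. (\<omega> \<longlongrightarrow> \<omega> t) (at_right t) \<and> (\<exists>l. (\<omega> \<longlongrightarrow> l) (at_left t)))"

definition cadlag_paths :: "(real \<Rightarrow> real) set" where
  "cadlag_paths = {\<omega>. cadlag \<omega> \<and> \<omega> 0 = 0}"

definition path_space :: "(real \<Rightarrow> real) measure" where
  "path_space = restrict_space (\<Pi>\<^sub>M t\<in>UNIV. borel) cadlag_paths"

definition wiener_shift :: "real \<Rightarrow> (real \<Rightarrow> real) \<Rightarrow> (real \<Rightarrow> real)" where
  "wiener_shift t \<omega> = (\<lambda>s. \<omega> (t + s) - \<omega> t)"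

definition two_sided_levy_process :: "'a measure \<Rightarrow> (real \<Rightarrow> 'a \<Rightarrow> real) \<Rightarrow> bool" where
  "two_sided_levy_process M L \<longleftrightarrow>
     prob_space M \<and>
     (\<forall>t. L t \<in> borel_measurable M) \<and>
     (\<forall>\<omega>\<in>space M. L 0 \<omega> = 0 \<and> cadlag (\<lambda>t. L t \<omega>)) \<and>
     (\<forall>(\<tau>::nat \<Rightarrow> real) n. mono \<tau> \<longrightarrow>
        prob_space.indep_vars M (\<lambda>_. borel) (\<lambda>i \<omega>. L (\<tau> (Suc i)) \<omega> - L (\<tau> i) \<omega>) {..<n}) \<and>
     (\<forall>s t. s \<le> t \<longrightarrow>
        distr M borel (\<lambda>\<omega>. L t \<omega> - L s \<omega>) = distr M borel (L (t - s)))"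

definition jump :: "(real \<Rightarrow> real) \<Rightarrow> real \<Rightarrow> real" where
  "jump \<omega> t = \<omega> t - Lim (at_left t) \<omega>"

text \<open>
  The image of a counting measure: a set \<open>S\<close> of pairs (time, jump size) gets the number of
  discontinuities \<open>t\<close> with \<open>(t, jump \<omega> t) \<in> S\<close>. This is the random measure \<open>N\<close>.
\<close>

definition jump_measure :: "(real \<Rightarrow> real) \<Rightarrow> (real \<times> real) measure" where
  "jump_measure \<omega> =
     distr (count_space {t. jump \<omega> t \<noteq> 0}) (borel \<Otimes>\<^sub>M borel) (\<lambda>t. (t, jump \<omega> t))"

definition poisson_random_measure :: "'a measure \<Rightarrow> ('a \<Rightarrow> 'b measure) \<Rightarrow> 'b measure \<Rightarrow> bool" where
  "poisson_random_measure M N m \<longleftrightarrow>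
     prob_space M \<and>
     (\<forall>\<omega>\<in>space M. sets (N \<omega>) = sets m) \<and>
     (\<forall>A\<in>sets m. (\<lambda>\<omega>. emeasure (N \<omega>) A) \<in> borel_measurable M) \<and>
     (\<forall>A\<in>sets m. emeasure m A < \<infinity> \<longrightarrow>
        (\<forall>k::nat. measure M {\<omega>\<in>space M. emeasure (N \<omega>) A = of_nat k} =
           exp (- measure m A) * measure m A ^ k / fact k)) \<and>
     (\<forall>A\<in>sets m. emeasure m A = \<infinity> \<longrightarrow> (AE \<omega> in M. emeasure (N \<omega>) A = \<infinity>)) \<and>
     (\<forall>(A::nat \<Rightarrow> 'b set) n. range A \<subseteq> sets m \<and> disjoint_family A \<longrightarrow>
        prob_space.indep_vars M (\<lambda>_. borel) (\<lambda>i \<omega>. emeasure (N \<omega>) (A i)) {..<n})"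

text \<open>
  The integral of \<open>z\<close> over \<open>\<epsilon> \<le> \<bar>z\<bar> < 1\<close> against the compensated measure
  \<open>N((s,t], dz) - (t - s) \<nu>(dz)\<close>. The integral over all of \<open>\<bar>z\<bar> < 1\<close> is its limit
  in mean square as \<open>\<epsilon>\<close> tends to \<open>0\<close>.
\<close>

definition compensated_jumps ::
  "real measure \<Rightarrow> real \<Rightarrow> real \<Rightarrow> real \<Rightarrow> (real \<Rightarrow> real) \<Rightarrow> real" where
  "compensated_jumps \<nu> \<epsilon> s t \<omega> =
     (LINT p:({s<..t} \<times> {z. \<epsilon> \<le> \<bar>z\<bar> \<and> \<bar>z\<bar> < 1})|jump_measure \<omega>. snd p)
     - (t - s) * (LINT z:{z. \<epsilon> \<le> \<bar>z\<bar> \<and> \<bar>z\<bar> < 1}|\<nu>. z)"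

text \<open>
  Stating the decomposition for the increments over all \<open>s \<le> t\<close> covers negative times
  as well; \<open>s = 0\<close> is the usual formula for \<open>L\<^sub>t\<close>.
\<close>

definition levy_ito_compensated :: "'a measure \<Rightarrow> (real \<Rightarrow> 'a \<Rightarrow> real) \<Rightarrow> real measure \<Rightarrow> bool" where
  "levy_ito_compensated M L \<nu> \<longleftrightarrow>
     (\<forall>s t. s \<le> t \<longrightarrow>
        ((\<lambda>\<epsilon>. \<integral>\<^sup>+ \<omega>. ennreal ((L t \<omega> - L s \<omega> - compensated_jumps \<nu> \<epsilon> s t (\<lambda>u. L u \<omega>))\<^sup>2) \<partial>M)
           \<longlongrightarrow> 0) (at_right 0))"

definition stable_constant :: "real \<Rightarrow> real" where
  "stable_constant \<alpha> =
     \<alpha> / (2 powr (1 - \<alpha>) * pi powr (1/2)) * (Gamma ((1 + \<alpha>) / 2) / Gamma (1 - \<alpha> / 2))"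

text \<open>
  Levy measures live on the nonzero reals; here they are measures on the whole line which
  do not charge \<open>0\<close>.
\<close>

definition stable_levy_measure :: "real \<Rightarrow> real measure" where
  "stable_levy_measure \<alpha> =
     density lborel (\<lambda>z. ennreal (stable_constant \<alpha> * \<bar>z\<bar> powr (- 1 - \<alpha>)) * indicator (- {0}) z)"

definition truncated_stable_levy_measure :: "real \<Rightarrow> real measure" where
  "truncated_stable_levy_measure \<alpha> =
     density (stable_levy_measure \<alpha>) (indicator {z. \<bar>z\<bar> < 1})"

definition truncated_stable_process :: "real \<Rightarrow> 'a measure \<Rightarrow> (real \<Rightarrow> 'a \<Rightarrow> real) \<Rightarrow> bool" where
  "truncated_stable_process \<alpha> M L \<longleftrightarrow>
     two_sided_levy_process M L \<and>
     poisson_random_measure M (\<lambda>\<omega>. jump_measure (\<lambda>t. L t \<omega>))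
       (lborel \<Otimes>\<^sub>M truncated_stable_levy_measure \<alpha>) \<and>
     levy_ito_compensated M L (truncated_stable_levy_measure \<alpha>)"

definition truncated_stable_law :: "real \<Rightarrow> (real \<Rightarrow> real) measure \<Rightarrow> bool" where
  "truncated_stable_law \<alpha> P \<longleftrightarrow>
     space P = cadlag_paths \<and> sets P = sets path_space \<and>
     truncated_stable_process \<alpha> P (\<lambda>t \<omega>. \<omega> t)"

type_synonym 'w cocycle = "real \<Rightarrow> 'w \<Rightarrow> real \<Rightarrow> real"

definition metric_dynamical_system :: "'w measure \<Rightarrow> (real \<Rightarrow> 'w \<Rightarrow> 'w) \<Rightarrow> bool" where
  "metric_dynamical_system P \<theta> \<longleftrightarrow>
     prob_space P \<and>
     (\<lambda>(t, \<omega>). \<theta> t \<omega>) \<in> borel \<Otimes>\<^sub>M P \<rightarrow>\<^sub>M P \<and>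
     (\<forall>\<omega>\<in>space P. \<theta> 0 \<omega> = \<omega>) \<and>
     (\<forall>s t. \<forall>\<omega>\<in>space P. \<theta> (s + t) \<omega> = \<theta> s (\<theta> t \<omega>)) \<and>
     (\<forall>t. distr P P (\<theta> t) = P)"

definition random_dynamical_system ::
  "'w measure \<Rightarrow> (real \<Rightarrow> 'w \<Rightarrow> 'w) \<Rightarrow> 'w cocycle \<Rightarrow> bool" where
  "random_dynamical_system P \<theta> \<phi> \<longleftrightarrow>
     metric_dynamical_system P \<theta> \<and>
     (\<lambda>(t, \<omega>, x). \<phi> t \<omega> x)
       \<in> borel_measurable (restrict_space borel {0..} \<Otimes>\<^sub>M P \<Otimes>\<^sub>M borel) \<and>
     (\<forall>\<omega>\<in>space P. \<forall>x. \<phi> 0 \<omega> x = x) \<and>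
     (\<forall>s\<ge>0. \<forall>t\<ge>0. \<forall>\<omega>\<in>space P. \<forall>x. \<phi> (t + s) \<omega> x = \<phi> t (\<theta> s \<omega>) (\<phi> s \<omega> x))"

text \<open>
  Since the noise is additive, the equation is solved path by path, for every path of
  the driving process.
\<close>

definition solves_sde ::
  "real \<Rightarrow> real \<Rightarrow> (real \<Rightarrow> real) \<Rightarrow> real \<Rightarrow> (real \<Rightarrow> real) \<Rightarrow> bool" where
  "solves_sde \<beta> \<sigma> \<omega> x X \<longleftrightarrow>
     (\<forall>t\<ge>0. set_integrable lborel {0..t} (\<lambda>s. \<beta> * X s - X s ^ 3) \<and>
        X t = x + (LBINT s:{0..t}. \<beta> * X s - X s ^ 3) + \<sigma> * \<omega> t)"

definition rds_generated_by_sde ::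
  "(real \<Rightarrow> real) measure \<Rightarrow> real \<Rightarrow> real \<Rightarrow> (real \<Rightarrow> real) cocycle \<Rightarrow> bool" where
  "rds_generated_by_sde P \<beta> \<sigma> \<phi> \<longleftrightarrow>
     random_dynamical_system P wiener_shift \<phi> \<and>
     (\<forall>\<omega>\<in>space P. \<forall>x. solves_sde \<beta> \<sigma> \<omega> x (\<lambda>t. \<phi> t \<omega> x))"

text \<open>
  Compact, strictly invariant random sets attracting all bounded deterministic sets in the
  pullback sense.
\<close>

definition random_attractor ::
  "'w measure \<Rightarrow> (real \<Rightarrow> 'w \<Rightarrow> 'w) \<Rightarrow> 'w cocycle \<Rightarrow> ('w \<Rightarrow> real set) \<Rightarrow> bool" where
  "random_attractor P \<theta> \<phi> A \<longleftrightarrow>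
     (\<forall>\<omega>\<in>space P. compact (A \<omega>) \<and> A \<omega> \<noteq> {}) \<and>
     (\<forall>x. (\<lambda>\<omega>. infdist x (A \<omega>)) \<in> borel_measurable P) \<and>
     (\<forall>t\<ge>0. AE \<omega> in P. \<phi> t \<omega> ` A \<omega> = A (\<theta> t \<omega>)) \<and>
     (\<forall>B. bounded B \<longrightarrow>
        (AE \<omega> in P. uniform_limit B
           (\<lambda>t x. infdist (\<phi> t (\<theta> (- t) \<omega>) x) (A \<omega>)) (\<lambda>_. 0) at_top))"

definition skew_product ::
  "(real \<Rightarrow> 'w \<Rightarrow> 'w) \<Rightarrow> 'w cocycle \<Rightarrow> real \<Rightarrow> 'w \<times> real \<Rightarrow> 'w \<times> real" where
  "skew_product \<theta> \<phi> t = (\<lambda>(\<omega>, x). (\<theta> t \<omega>, \<phi> t \<omega> x))"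

definition invariant_measure ::
  "'w measure \<Rightarrow> (real \<Rightarrow> 'w \<Rightarrow> 'w) \<Rightarrow> 'w cocycle \<Rightarrow> ('w \<times> real) measure \<Rightarrow> bool" where
  "invariant_measure P \<theta> \<phi> \<mu> \<longleftrightarrow>
     prob_space \<mu> \<and> sets \<mu> = sets (P \<Otimes>\<^sub>M borel) \<and>
     distr \<mu> P fst = P \<and>
     (\<forall>t\<ge>0. distr \<mu> \<mu> (skew_product \<theta> \<phi> t) = \<mu>)"

definition disintegration ::
  "'w measure \<Rightarrow> ('w \<times> real) measure \<Rightarrow> ('w \<Rightarrow> real measure) \<Rightarrow> bool" where
  "disintegration P \<mu> \<kappa> \<longleftrightarrow>
     \<kappa> \<in> P \<rightarrow>\<^sub>M prob_algebra borel \<and>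
     (\<forall>C\<in>sets (P \<Otimes>\<^sub>M borel). emeasure \<mu> C = (\<integral>\<^sup>+ \<omega>. emeasure (\<kappa> \<omega>) (Pair \<omega> -` C) \<partial>P))"

definition linearization :: "'w cocycle \<Rightarrow> ('w \<Rightarrow> real) \<Rightarrow> real \<Rightarrow> 'w \<Rightarrow> real" where
  "linearization \<phi> a t \<omega> = deriv (\<phi> t \<omega>) (a \<omega>)"

text \<open>
  The limit is a number independent of the path, so the exponent is a relation between the
  system and a real.
\<close>

definition is_lyapunov_exponent ::
  "'w measure \<Rightarrow> 'w cocycle \<Rightarrow> ('w \<Rightarrow> real) \<Rightarrow> real \<Rightarrow> bool" where
  "is_lyapunov_exponent P \<phi> a \<Lambda> \<longleftrightarrow>
     (AE \<omega> in P. ((\<lambda>T. 1 / T * ln \<bar>linearization \<phi> a T \<omega>\<bar>) \<longlongrightarrow> \<Lambda>) at_top)"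

end

theory Submission
  imports Defs
begin

text \<open>
  Let \<open>\<rho>\<close> be the law of the attracting point \<open>a\<close> and \<open>m\<close> its second moment. Stationarity of
  \<open>a\<close> along the flow gives \<open>\<Lambda> \<le> \<beta> - 3 m\<close>, so the task is to show \<open>\<beta> < 3 m\<close>. Two solutions \<open>X\<close>,
  \<open>Y\<close> with the same noise satisfy \<open>X\<^sub>t - Y\<^sub>t = (X\<^sub>0 - Y\<^sub>0) exp (\<integral> (\<beta> - X\<^sup>2 - X Y - Y\<^sup>2))\<close>. Start them from
  independent points with law \<open>\<rho>\<close>, independent of the noise. The logarithmic energy
  \<open>- \<integral>\<integral> ln \<bar>x - y\<bar> \<rho>(dx) \<rho>(dy)\<close> is convex in \<open>\<rho>\<close>, and \<open>\<rho>\<close> is the average of its images under the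
  random flow, so \<open>E ln \<bar>X\<^sub>t - Y\<^sub>t\<bar> \<le> E ln \<bar>X\<^sub>0 - Y\<^sub>0\<bar>\<close>, that is \<open>E \<integral> (\<beta> - X\<^sup>2 - X Y - Y\<^sup>2) \<le> 0\<close>.
  Both marginals stay equal to \<open>\<rho>\<close> and \<open>X\<^sup>2 + X Y + Y\<^sup>2 = 3/2 (X\<^sup>2 + Y\<^sup>2) - 1/2 (X - Y)\<^sup>2\<close>, so
  \<open>\<beta> - 3 m < 0\<close> as soon as \<open>X\<^sub>0 \<noteq> Y\<^sub>0\<close> almost surely. This holds because \<open>\<rho>\<close> has no atoms: otherwise
  the finitely many atoms of maximal mass would be permuted by the increasing flow, hence fixed, and
  a constant solution forces the driving path to be continuous.
\<close>

section \<open>Calculus of indefinite integrals\<close>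

text \<open>Two obstacles shape the argument. The point \<open>a\<close> is not known to be
  independent of the future noise, so stationarity along the attractor does not give invariance of
  \<rho> for an independent start. That invariance is drawn from pullback attraction: since the
  shift preserves \<open>P\<close>, forward solutions started at 0 converge in law to \<rho>, and
  the Markov property, a consequence of independent increments, passes to the limit. The second
  obstacle is that the logarithm is singular at 0 and the logarithmic energy of \<rho> may be
  infinite, so energies cannot be subtracted directly. The kernel becomes ln (d^2 + \<delta>^2) / 2
  - ln \<delta>, which is still a mixture of 1 - cos (s d), now with weight exp (- u s) over s \<ge>
  0 and u \<ge> \<delta>, and whose mean is finite as soon as \<rho> has a second moment. Its
  increment along a pair of solutions is bounded by a time integral free of \<delta>, so \<delta>
  goes to 0 by dominated convergence. The second moment is finite because the exponent exists as a
  real limit; truncation yields this without an ergodic theorem.\<close>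

lemma const_if_quadratic_increments:
  fixes F v :: "real \<Rightarrow> real"
  assumes ab: "a \<le> b" and cont: "continuous_on {a..b} v" and v: "v a \<le> v b"
    and quad: "\<And>x y. x \<in> {a..b} \<Longrightarrow> y \<in> {a..b} \<Longrightarrow> \<bar>F y - F x\<bar> \<le> C * (v y - v x)\<^sup>2"
  shows "F b = F a"
proof -
  define M where "M = v b - v a"
  have M: "M \<ge> 0" using v by (simp add: M_def)
  \<comment> \<open>Cut the range of \<open>v\<close>, not its domain, into \<open>n\<close> equal
    pieces: each of the \<open>n\<close> increments of \<open>F\<close> then costs at most C
    (M/n)^2.\<close>
  have bound: "\<bar>F b - F a\<bar> \<le> C * M\<^sup>2 / real n" if n: "n > 0" for n :: nat
  proof -
    have "\<exists>p\<in>{a..b}. v p = v a + real k / real n * M" if "k \<le> n" for k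
    proof -
      have "real k / real n * M \<le> 1 * M"
        by (rule mult_right_mono) (use that n M in auto)
      hence "v a + real k / real n * M \<le> v b" by (simp add: M_def)
      moreover have "v a \<le> v a + real k / real n * M" using M by simp
      ultimately show ?thesis using IVT'[of v a "v a + real k / real n * M" b] ab cont by auto
    qed
    then obtain p where p: "\<And>k. k \<le> n \<Longrightarrow> p k \<in> {a..b}"
        "\<And>k. k \<le> n \<Longrightarrow> v (p k) = v a + real k / real n * M"
      by metis
    \<comment> \<open>The points \<open>p 0\<close> and \<open>p n\<close> need not be the end
      points, but \<open>v\<close> takes the same values there, so the quadratic bound forces
      \<open>F\<close> to agree as well.\<close>
    have 0: "F (p 0) = F a" using quad[of a "p 0"] p[of 0] ab by auto
    have 1: "F (p n) = F b" using quad[of b "p n"] p[of n] ab n by (auto simp: M_def)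
    have "F b - F a = (\<Sum>k<n. F (p (Suc k)) - F (p k))"
      using 0 1 sum_lessThan_telescope[of "\<lambda>k. F (p k)" n] by simp
    also have "\<bar>\<dots>\<bar> \<le> (\<Sum>k<n. \<bar>F (p (Suc k)) - F (p k)\<bar>)" by (rule sum_abs)
    also have "\<dots> \<le> (\<Sum>k<n. C * (M / real n)\<^sup>2)"
    proof (rule sum_mono)
      fix k assume k: "k \<in> {..<n}"
      have "v (p (Suc k)) - v (p k) = M / real n"
        using p[of k] p[of "Suc k"] k by (auto simp: field_simps)
      thus "\<bar>F (p (Suc k)) - F (p k)\<bar> \<le> C * (M / real n)\<^sup>2"
        using quad[of "p k" "p (Suc k)"] p[of k] p[of "Suc k"] k by auto
    qed
    also have "\<dots> = C * M\<^sup>2 / real n" using n by (simp add: power2_eq_square field_simps)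
    finally show ?thesis .
  qed
  have "(\<lambda>n. C * M\<^sup>2 / real n) \<longlonglongrightarrow> 0" by (rule lim_const_over_n)
  hence "\<bar>F b - F a\<bar> \<le> 0"
    by (rule LIMSEQ_le_const) (use bound in \<open>auto intro!: exI[of _ 1]\<close>)
  thus ?thesis by simp
qed

lemma set_integral_mono_set:
  fixes f :: "'a \<Rightarrow> real"
  assumes "set_integrable M B f" "A \<in> sets M" "A \<subseteq> B" "\<And>x. x \<in> B \<Longrightarrow> 0 \<le> f x"
  shows "(LINT x:A|M. f x) \<le> (LINT x:B|M. f x)"
  unfolding set_lebesgue_integral_def
proof (rule integral_mono)
  show "integrable M (\<lambda>x. indicator A x *\<^sub>R f x)" "integrable M (\<lambda>x. indicator B x *\<^sub>R f x)"
    using set_integrable_subset[OF assms(1-3)] assms(1) by (auto simp: set_integrable_def)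
qed (use assms(3,4) in \<open>auto simp: indicator_def split: if_splits\<close>)

lemma set_integral_Icc_diff:
  fixes g :: "real \<Rightarrow> real"
  assumes "set_integrable lborel {0..t} g" "0 \<le> a" "a \<le> b" "b \<le> t"
  shows "(LBINT s:{0..b}. g s) - (LBINT s:{0..a}. g s) = (LBINT s:{a<..b}. g s)"
proof -
  have i: "set_integrable lborel {0..a} g" "set_integrable lborel {a<..b} g"
    by (rule set_integrable_subset[OF assms(1)]; use assms in auto)+
  have "{0..b} = {0..a} \<union> {a<..b}" "{0..a} \<inter> {a<..b} = {}" using assms by auto
  thus ?thesis using set_integral_Un[OF _ i] by simp
qed

lemma continuous_on_set_integral_Icc:
  fixes g :: "real \<Rightarrow> real"
  assumes "set_integrable lborel {0..t} g"
  shows "continuous_on {0..t} (\<lambda>s. LBINT r:{0..s}. g r)"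
proof -
  have "continuous_on {0..t} (\<lambda>s. integral {0..s} g)"
    using set_borel_integral_eq_integral(1)[OF assms] by (rule indefinite_integral_continuous_1)
  moreover have "integral {0..s} g = (LBINT r:{0..s}. g r)" if "s \<in> {0..t}" for s
    using set_borel_integral_eq_integral(2)[OF set_integrable_subset[OF assms], of "{0..s}"] that by auto
  ultimately show ?thesis by (rule continuous_on_eq)
qed

text \<open>
  The primitive of an integrable function need not be differentiable anywhere in particular, so
  the usual chain rule does not apply; the increments of the difference of both sides are
  quadratic in those of the primitive of \<open>\<bar>g\<bar>\<close>.
\<close>

lemma chain_rule_set_integral:
  fixes D g G G' :: "real \<Rightarrow> real"
  assumes t: "0 \<le> t" and gm[measurable]: "g \<in> borel_measurable borel"
    and Dm[measurable]: "D \<in> borel_measurable borel"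
    and g: "set_integrable lborel {0..t} g"
    and D: "\<And>s. s \<in> {0..t} \<Longrightarrow> D s = D 0 + (LBINT r:{0..s}. g r)"
    and G: "\<And>x. (G has_real_derivative G' x) (at x)"
    and bd: "\<And>x. \<bar>G' x\<bar> \<le> B"
    and lip: "\<And>x y. \<bar>G' x - G' y\<bar> \<le> C * \<bar>x - y\<bar>"
  shows "set_integrable lborel {0..t} (\<lambda>s. G' (D s) * g s)"
    and "G (D t) - G (D 0) = (LBINT s:{0..t}. G' (D s) * g s)"
proof -
  have C: "C \<ge> 0" using order_trans[OF abs_ge_zero lip[of 0 1]] by simp
  have "C-lipschitz_on UNIV G'"
    using lip C by (auto simp: lipschitz_on_def dist_real_def)
  hence "continuous_on UNIV G'" by (rule lipschitz_on_continuous_on)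
  hence G'm[measurable]: "G' \<in> borel_measurable borel" by (rule borel_measurable_continuous_onI)
  show int: "set_integrable lborel {0..t} (\<lambda>s. G' (D s) * g s)"
  proof (rule set_integrable_bound)
    show "set_integrable lborel {0..t} (\<lambda>s. B * g s)" using g by simp
    show "set_borel_measurable lborel {0..t} (\<lambda>s. G' (D s) * g s)"
      unfolding set_borel_measurable_def by measurable
    show "AE s in lborel. s \<in> {0..t} \<longrightarrow> norm (G' (D s) * g s) \<le> norm (B * g s)"
      by (auto simp: abs_mult intro!: mult_right_mono order_trans[OF bd])
  qed
  define F where "F s = G (D s) - (LBINT r:{0..s}. G' (D r) * g r)" for s
  define v where "v s = (LBINT r:{0..s}. \<bar>g r\<bar>)" for s
  have ag: "set_integrable lborel {0..t} (\<lambda>s. \<bar>g s\<bar>)" using g by (rule set_integrable_abs)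
  \<comment> \<open>One \<open>C\<close> pays for the Taylor remainder of \<open>G\<close>, the
    other for freezing \<open>G'\<close> at \<open>D x\<close> under the integral.\<close>
  have quad: "\<bar>F y - F x\<bar> \<le> (2 * C) * (v y - v x)\<^sup>2" if xy: "0 \<le> x" "x \<le> y" "y \<le> t" for x y
  proof -
    have sub: "set_integrable lborel {x<..y} f" if "set_integrable lborel {0..t} f" for f :: "real \<Rightarrow> real"
      by (rule set_integrable_subset[OF that]) (use xy in auto)
    have vv: "v y - v x = (LBINT r:{x<..y}. \<bar>g r\<bar>)"
      unfolding v_def by (rule set_integral_Icc_diff[OF ag xy])
    have Dd: "\<bar>D s - D x\<bar> \<le> v y - v x" if s: "x \<le> s" "s \<le> y" for s
    proof -
      have "D s - D x = (LBINT r:{x<..s}. g r)"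
        using D[of s] D[of x] set_integral_Icc_diff[OF g, of x s] s xy by auto
      also have "\<bar>\<dots>\<bar> \<le> (LBINT r:{x<..s}. \<bar>g r\<bar>)"
        by (rule set_integral_norm_bound[where f=g, simplified real_norm_def])
           (rule set_integrable_subset[OF g], use s xy in auto)
      also have "\<dots> \<le> (LBINT r:{x<..y}. \<bar>g r\<bar>)"
        by (rule set_integral_mono_set) (use sub[OF ag] s in auto)
      finally show ?thesis by (simp add: vv)
    qed
    have vn: "v y - v x \<ge> 0" using Dd[of x] xy by auto
    \<comment> \<open>The mean value theorem and the Lipschitz bound on \<open>G'\<close> replace a
      second derivative, which \<open>G\<close> may lack.\<close>
    have Gx: "\<bar>G (D y) - G (D x) - G' (D x) * (D y - D x)\<bar> \<le> C * (D y - D x)\<^sup>2"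
    proof (cases "D x = D y")
      case False
      have "\<exists>z. \<bar>z - D x\<bar> \<le> \<bar>D y - D x\<bar> \<and> G (D y) - G (D x) = (D y - D x) * G' z"
      proof (cases "D x < D y")
        case True
        from MVT2[OF True, of G G'] G obtain z where "D x < z" "z < D y" "G (D y) - G (D x) = (D y - D x) * G' z" by blast
        thus ?thesis by (intro exI[of _ z]) auto
      next
        case F2: False
        hence "D y < D x" using False by simp
        from MVT2[OF this, of G G'] G obtain z where "D y < z" "z < D x" "G (D x) - G (D y) = (D x - D y) * G' z" by blast
        thus ?thesis by (intro exI[of _ z]) (auto simp: algebra_simps)
      qed
      then obtain z where z: "\<bar>z - D x\<bar> \<le> \<bar>D y - D x\<bar>" "G (D y) - G (D x) = (D y - D x) * G' z" by blast
      have "\<bar>G (D y) - G (D x) - G' (D x) * (D y - D x)\<bar> = \<bar>G' z - G' (D x)\<bar> * \<bar>D y - D x\<bar>"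
        unfolding z(2) abs_mult[symmetric] by (simp add: algebra_simps)
      also have "\<dots> \<le> (C * \<bar>D y - D x\<bar>) * \<bar>D y - D x\<bar>"
        by (intro mult_right_mono order_trans[OF lip] mult_left_mono z C) auto
      finally show ?thesis by (simp add: power2_eq_square mult.assoc)
    qed simp
    have Gx': "\<bar>G (D y) - G (D x) - G' (D x) * (D y - D x)\<bar> \<le> C * (v y - v x)\<^sup>2"
      by (rule order_trans[OF Gx]) (use Dd[of y] xy vn C in \<open>auto intro!: mult_left_mono simp: abs_le_square_iff[symmetric]\<close>)
    have DI: "D y - D x = (LBINT r:{x<..y}. g r)"
      using D[of y] D[of x] set_integral_Icc_diff[OF g, of x y] xy by auto
    \<comment> \<open>The same linear term on the integral side: with \<open>G'\<close> frozen at
      \<open>D x\<close> the integral is \<open>G' (D x) * (D y - D x)\<close>, and the error is an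
      integral of \<open>G' (D r) - G' (D x)\<close> against \<open>g\<close>.\<close>
    have "(LBINT r:{0..y}. G' (D r) * g r) - (LBINT r:{0..x}. G' (D r) * g r) - G' (D x) * (D y - D x)
        = (LBINT r:{x<..y}. G' (D r) * g r) - (LBINT r:{x<..y}. G' (D x) * g r)"
      using set_integral_Icc_diff[OF int xy] by (simp add: DI)
    also have "\<dots> = (LBINT r:{x<..y}. G' (D r) * g r - G' (D x) * g r)"
      by (rule set_integral_diff(2)[symmetric]) (use sub[OF int] sub[OF g] in auto)
    also have "\<bar>\<dots>\<bar> \<le> (LBINT r:{x<..y}. \<bar>G' (D r) * g r - G' (D x) * g r\<bar>)"
      using set_integral_norm_bound[of lborel "{x<..y}" "\<lambda>r. G' (D r) * g r - G' (D x) * g r"]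
        set_integral_diff(1)[OF sub[OF int], of "\<lambda>r. G' (D x) * g r"] sub[OF g] by auto
    also have "\<dots> \<le> (LBINT r:{x<..y}. C * (v y - v x) * \<bar>g r\<bar>)"
    proof (rule set_integral_mono)
      show "set_integrable lborel {x<..y} (\<lambda>r. \<bar>G' (D r) * g r - G' (D x) * g r\<bar>)"
        by (intro set_integrable_abs set_integral_diff(1) sub int set_integrable_mult_right) (use g in auto)
      show "set_integrable lborel {x<..y} (\<lambda>r. C * (v y - v x) * \<bar>g r\<bar>)"
        using sub[OF ag] by (intro set_integrable_mult_right) auto
      fix r assume r: "r \<in> {x<..y}"
      have "\<bar>G' (D r) * g r - G' (D x) * g r\<bar> = \<bar>G' (D r) - G' (D x)\<bar> * \<bar>g r\<bar>"
        unfolding abs_mult[symmetric] by (simp add: algebra_simps)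
      also have "\<dots> \<le> C * (v y - v x) * \<bar>g r\<bar>"
        by (intro mult_right_mono order_trans[OF lip] mult_left_mono Dd C) (use r in auto)
      finally show "\<bar>G' (D r) * g r - G' (D x) * g r\<bar> \<le> C * (v y - v x) * \<bar>g r\<bar>" .
    qed
    also have "\<dots> = C * (v y - v x)\<^sup>2" by (simp add: vv power2_eq_square)
    finally show ?thesis using Gx' unfolding F_def by linarith
  qed
  have "F t = F 0"
  proof (rule const_if_quadratic_increments[OF t])
    show "continuous_on {0..t} v" unfolding v_def by (rule continuous_on_set_integral_Icc[OF ag])
    show "v 0 \<le> v t" unfolding v_def
      by (rule set_integral_mono_set) (use ag t in auto)
    fix x y :: real assume "x \<in> {0..t}" "y \<in> {0..t}"
    thus "\<bar>F y - F x\<bar> \<le> (2 * C) * (v y - v x)\<^sup>2"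
      using quad[of x y] quad[of y x] by (cases "x \<le> y") (auto simp: power2_commute)
  qed
  moreover have "(LBINT r:{0..0}. G' (D r) * g r) = 0"
    using set_integral_at_point[of lborel 0 "\<lambda>r. G' (D r) * g r"] by simp
  ultimately show "G (D t) - G (D 0) = (LBINT s:{0..t}. G' (D s) * g s)" unfolding F_def by simp
qed

section \<open>Differences of two solutions\<close>

text \<open>A solution comes with an integrable drift; this bound upgrades that to a
  square-integrable path. Beyond 1 + \<bar>b\<bar> the cubic term exceeds the linear one by at least
  x^2, and below that threshold the constant suffices.\<close>

lemma square_le_abs_cubic: "(x::real)\<^sup>2 \<le> (1 + \<bar>b\<bar>)\<^sup>2 + \<bar>b * x - x ^ 3\<bar>"
proof (cases "\<bar>x\<bar> \<ge> 1 + \<bar>b\<bar>")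
  case True
  have "(1 + \<bar>b\<bar>) * \<bar>b\<bar> \<le> \<bar>x\<bar> * (\<bar>x\<bar> - 1)" by (rule mult_mono) (use True in auto)
  hence "0 \<le> \<bar>x\<bar> * (\<bar>x\<bar> - 1) - \<bar>b\<bar>" by (simp add: algebra_simps) (use zero_le_square[of b] in linarith)
  hence "0 \<le> \<bar>x\<bar> * (\<bar>x\<bar> * (\<bar>x\<bar> - 1) - \<bar>b\<bar>)" by simp
  also have "\<dots> = \<bar>x\<bar> ^ 3 - \<bar>b\<bar> * \<bar>x\<bar> - \<bar>x\<bar>\<^sup>2" by (simp add: power2_eq_square power3_eq_cube algebra_simps)
  finally have "x\<^sup>2 \<le> \<bar>x ^ 3\<bar> - \<bar>b * x\<bar>" by (simp add: power_abs abs_mult)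
  also have "\<dots> \<le> \<bar>b * x - x ^ 3\<bar>" by linarith
  finally show ?thesis by (smt (verit) zero_le_power2)
next
  case False
  hence "\<bar>x\<bar>\<^sup>2 \<le> (1 + \<bar>b\<bar>)\<^sup>2" by (intro power_mono) auto
  thus ?thesis by simp
qed

lemma set_integrable_const_Icc: "set_integrable lborel {a..b::real} (\<lambda>_. c::real)"
  by (rule borel_integrable_atLeastAtMost') (rule continuous_on_const)

lemma set_integrable_square_of_cubic:
  fixes X :: "real \<Rightarrow> real"
  assumes [measurable]: "X \<in> borel_measurable borel"
    and "set_integrable lborel {0..t} (\<lambda>s. b * X s - X s ^ 3)"
  shows "set_integrable lborel {0..t} (\<lambda>s. (X s)\<^sup>2)"
proof (rule set_integrable_bound)
  show "set_integrable lborel {0..t} (\<lambda>s. (1 + \<bar>b\<bar>)\<^sup>2 + \<bar>b * X s - X s ^ 3\<bar>)"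
    by (intro set_integral_add(1) set_integrable_abs assms(2) set_integrable_const_Icc)
  show "set_borel_measurable lborel {0..t} (\<lambda>s. (X s)\<^sup>2)"
    unfolding set_borel_measurable_def by measurable
qed (auto intro!: order_trans[OF square_le_abs_cubic[of _ b]])

lemma abs_mult_le_half_squares: "\<bar>x * y\<bar> \<le> ((x::real)\<^sup>2 + y\<^sup>2) / 2"
  using zero_le_power2[of "\<bar>x\<bar> - \<bar>y\<bar>"] by (simp add: power2_diff abs_mult)

text \<open>Only the difference of the two equations is recorded, after the noise has cancelled. The
  two solutions may thus be driven by different paths, provided these agree up to time
  \<open>t\<close>.\<close>

locale cubic_pair =
  fixes t \<beta> :: real and X Y :: "real \<Rightarrow> real"
  assumes t: "0 \<le> t"
    and X_meas[measurable]: "X \<in> borel_measurable borel"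
    and Y_meas[measurable]: "Y \<in> borel_measurable borel"
    and X_int: "set_integrable lborel {0..t} (\<lambda>s. \<beta> * X s - X s ^ 3)"
    and Y_int: "set_integrable lborel {0..t} (\<lambda>s. \<beta> * Y s - Y s ^ 3)"
    and diff: "\<And>s. s \<in> {0..t} \<Longrightarrow>
      X s - Y s = X 0 - Y 0 + (LBINT r:{0..s}. (\<beta> * X r - X r ^ 3) - (\<beta> * Y r - Y r ^ 3))"
begin

text \<open>The quotient of the drift difference by X - Y, from x^3 - y^3 = (x - y) (x^2 + x y +
  y^2). Hence \<open>D\<close> solves the linear equation D' = q D, with a rate that itself depends
  on the pair.\<close>

definition q :: "real \<Rightarrow> real" where "q s = \<beta> - ((X s)\<^sup>2 + X s * Y s + (Y s)\<^sup>2)"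
definition D :: "real \<Rightarrow> real" where "D s = X s - Y s"

lemma q_meas[measurable]: "q \<in> borel_measurable borel" unfolding q_def by measurable
lemma D_meas[measurable]: "D \<in> borel_measurable borel" unfolding D_def by measurable

lemma q_le: "q s \<le> \<beta>"
proof -
  have "(X s)\<^sup>2 + X s * Y s + (Y s)\<^sup>2 = ((X s)\<^sup>2 + (Y s)\<^sup>2) / 2 + (X s + Y s)\<^sup>2 / 2"
    by (simp add: power2_sum field_simps)
  also have "\<dots> \<ge> 0" by simp
  finally show ?thesis by (simp add: q_def)
qed

lemma q_bound: "\<bar>q s\<bar> \<le> \<bar>\<beta>\<bar> + 3 / 2 * ((X s)\<^sup>2 + (Y s)\<^sup>2)"
proof -
  have "\<bar>b - (x + z + y)\<bar> \<le> \<bar>b\<bar> + 3 / 2 * (x + y)" if "\<bar>z\<bar> \<le> (x + y) / 2" for b x y z :: real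
  proof -
    have z: "z * 2 \<le> x + y" "- z * 2 \<le> x + y" using that by auto
    have "b - (x + z + y) \<le> \<bar>b\<bar> + 3 / 2 * (x + y)" using z abs_ge_self[of b] by argo
    moreover have "- (b - (x + z + y)) \<le> \<bar>b\<bar> + 3 / 2 * (x + y)" using z abs_ge_minus_self[of b] by argo
    ultimately show ?thesis by (rule abs_leI)
  qed
  from this[OF abs_mult_le_half_squares[of "X s" "Y s"]] show ?thesis unfolding q_def .
qed

lemma q_int: "set_integrable lborel {0..t} q"
proof (rule set_integrable_bound)
  show "set_integrable lborel {0..t} (\<lambda>s. \<bar>\<beta>\<bar> + 3 / 2 * ((X s)\<^sup>2 + (Y s)\<^sup>2))"
    by (intro set_integral_add(1) set_integrable_mult_right set_integrable_square_of_cubic[OF _ X_int]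
        set_integrable_square_of_cubic[OF _ Y_int] set_integrable_const_Icc) auto
  show "set_borel_measurable lborel {0..t} q"
    unfolding set_borel_measurable_def by measurable
  show "AE s in lborel. s \<in> {0..t} \<longrightarrow> norm (q s) \<le> norm (\<bar>\<beta>\<bar> + 3 / 2 * ((X s)\<^sup>2 + (Y s)\<^sup>2))"
    using q_bound by (intro AE_I2 impI) (auto intro: order_trans)
qed

lemma drift_diff: "(\<beta> * X r - X r ^ 3) - (\<beta> * Y r - Y r ^ 3) = D r * q r"
  by (simp add: D_def q_def power2_eq_square power3_eq_cube algebra_simps)

lemma Dq_int: "set_integrable lborel {0..t} (\<lambda>s. D s * q s)"
  using set_integral_diff(1)[OF X_int Y_int] unfolding drift_diff .

lemma D_eq: "s \<in> {0..t} \<Longrightarrow> D s = D 0 + (LBINT r:{0..s}. D r * q r)"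
  using diff[of s] unfolding drift_diff unfolding D_def by simp

lemma D_cont: "continuous_on {0..t} D"
proof (rule continuous_on_eq)
  show "continuous_on {0..t} (\<lambda>s. D 0 + (LBINT r:{0..s}. D r * q r))"
    by (intro continuous_intros continuous_on_set_integral_Icc Dq_int)
qed (rule D_eq[symmetric])

text \<open>The logarithm of \<bar>D\<bar> would need \<open>D\<close> to stay away from 0, which is
  not yet known. Smoothing by \<epsilon> gives the derivative x / (x^2 + \<epsilon>), bounded and
  Lipschitz as the chain rule requires.\<close>

lemma log_formula:
  assumes e: "\<epsilon> > 0"
  shows "ln ((D t)\<^sup>2 + \<epsilon>) / 2 - ln ((D 0)\<^sup>2 + \<epsilon>) / 2 = (LBINT s:{0..t}. (D s)\<^sup>2 / ((D s)\<^sup>2 + \<epsilon>) * q s)"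
proof -
  define G' where "G' x = x / (x\<^sup>2 + \<epsilon>)" for x :: real
  have pos: "x\<^sup>2 + \<epsilon> > 0" for x :: real using e by (simp add: add_nonneg_pos)
  have G: "((\<lambda>x. ln (x\<^sup>2 + \<epsilon>) / 2) has_real_derivative G' x) (at x)" for x
  proof -
    have "((\<lambda>x. ln (x\<^sup>2 + \<epsilon>)) has_real_derivative 1 / (x\<^sup>2 + \<epsilon>) * (2 * x)) (at x)"
      by (rule DERIV_chain2[where f=ln and g="\<lambda>x. x\<^sup>2 + \<epsilon>", OF DERIV_ln_divide[OF pos]]) (auto intro!: derivative_eq_intros)
    moreover have "(1 / p * (2 * x)) / 2 = x / p" for p by simp
    ultimately show ?thesis using DERIV_cdivide[of _ _ _ _ 2] unfolding G'_def by metis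
  qed
  have bd: "\<bar>G' x\<bar> \<le> 1 + 1 / \<epsilon>" for x
  proof -
    have "\<bar>x\<bar> \<le> x\<^sup>2 + 1" using abs_mult_le_half_squares[of x 1] zero_le_power2[of x] by simp
    also have "\<dots> \<le> (1 + 1 / \<epsilon>) * (x\<^sup>2 + \<epsilon>)"
    proof -
      have "(1 + 1 / \<epsilon>) * (x\<^sup>2 + \<epsilon>) = x\<^sup>2 + 1 + \<epsilon> + x\<^sup>2 / \<epsilon>" using e by (simp add: algebra_simps)
      thus ?thesis using e by simp
    qed
    finally show ?thesis unfolding G'_def abs_divide abs_of_pos[OF pos] pos_divide_le_eq[OF pos] .
  qed
  have lip: "\<bar>G' x - G' y\<bar> \<le> 1 / \<epsilon> * \<bar>x - y\<bar>" for x y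
  proof -
    \<comment> \<open>The factor x - y splits off exactly. The remaining quotient is at most 1 /
      \<epsilon>, because \<bar>x y\<bar> is at most the mean of the squares and the product of the
      denominators already contains \<epsilon> (\<epsilon> + (x^2 + y^2) / 2).\<close>
    have eq: "G' x - G' y = (\<epsilon> - x * y) / ((x\<^sup>2 + \<epsilon>) * (y\<^sup>2 + \<epsilon>)) * (x - y)"
      unfolding G'_def using pos[of x] pos[of y] by (simp add: field_simps power2_eq_square)
    have "\<bar>\<epsilon> - x * y\<bar> * \<epsilon> \<le> (\<epsilon> + (x\<^sup>2 + y\<^sup>2) / 2) * \<epsilon>"
      using order_trans[OF abs_triangle_ineq4[of \<epsilon> "x * y"] add_left_mono[OF abs_mult_le_half_squares[of x y]]] e
      by (intro mult_right_mono) auto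
    also have "\<dots> \<le> (x\<^sup>2 + \<epsilon>) * (y\<^sup>2 + \<epsilon>)"
    proof -
      have "(x\<^sup>2 + \<epsilon>) * (y\<^sup>2 + \<epsilon>) - (\<epsilon> + (x\<^sup>2 + y\<^sup>2) / 2) * \<epsilon> = x\<^sup>2 * y\<^sup>2 + \<epsilon> * (x\<^sup>2 + y\<^sup>2) / 2"
        by (simp add: field_simps)
      also have "\<dots> \<ge> 0" using e by simp
      finally show ?thesis by simp
    qed
    finally have "\<bar>(\<epsilon> - x * y) / ((x\<^sup>2 + \<epsilon>) * (y\<^sup>2 + \<epsilon>))\<bar> \<le> 1 / \<epsilon>"
      unfolding abs_divide abs_of_pos[OF mult_pos_pos[OF pos pos]] pos_divide_le_eq[OF mult_pos_pos[OF pos pos]]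
      using e by (simp add: pos_le_divide_eq)
    thus ?thesis unfolding eq abs_mult by (rule mult_right_mono) simp
  qed
  have "ln ((D t)\<^sup>2 + \<epsilon>) / 2 - ln ((D 0)\<^sup>2 + \<epsilon>) / 2 = (LBINT s:{0..t}. G' (D s) * (D s * q s))"
    by (rule chain_rule_set_integral(2)[OF t _ _ Dq_int D_eq G bd lip]) simp_all
  also have "(\<lambda>s. G' (D s) * (D s * q s)) = (\<lambda>s. (D s)\<^sup>2 / ((D s)\<^sup>2 + \<epsilon>) * q s)"
    by (simp add: G'_def power2_eq_square mult.assoc)
  finally show ?thesis .
qed

lemma ratio_le_1: "\<epsilon> > 0 \<Longrightarrow> \<bar>x\<^sup>2 / (x\<^sup>2 + \<epsilon>)\<bar> \<le> (1::real)"
  by (simp add: abs_divide add_nonneg_pos divide_le_eq_1)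

text \<open>The right-hand side is free of \<epsilon>. This uniformity first excludes zeros of
  \<open>D\<close> and later supplies the dominating function for the smoothed energies.\<close>

lemma log_bound:
  assumes e: "\<epsilon> > 0"
  shows "\<bar>ln ((D t)\<^sup>2 + \<epsilon>) / 2 - ln ((D 0)\<^sup>2 + \<epsilon>) / 2\<bar> \<le> (LBINT s:{0..t}. \<bar>q s\<bar>)"
proof -
  have le: "\<bar>(D s)\<^sup>2 / ((D s)\<^sup>2 + \<epsilon>) * q s\<bar> \<le> \<bar>q s\<bar>" for s
    unfolding abs_mult using mult_right_mono[OF ratio_le_1[OF e], of "\<bar>q s\<bar>" "D s"] by simp
  have i: "set_integrable lborel {0..t} (\<lambda>s. (D s)\<^sup>2 / ((D s)\<^sup>2 + \<epsilon>) * q s)"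
  proof (rule set_integrable_bound[OF q_int])
    show "set_borel_measurable lborel {0..t} (\<lambda>s. (D s)\<^sup>2 / ((D s)\<^sup>2 + \<epsilon>) * q s)"
      unfolding set_borel_measurable_def by measurable
  qed (use le in auto)
  have "\<bar>LBINT s:{0..t}. (D s)\<^sup>2 / ((D s)\<^sup>2 + \<epsilon>) * q s\<bar> \<le> (LBINT s:{0..t}. \<bar>(D s)\<^sup>2 / ((D s)\<^sup>2 + \<epsilon>) * q s\<bar>)"
    using set_integral_norm_bound[OF i] by simp
  also have "\<dots> \<le> (LBINT s:{0..t}. \<bar>q s\<bar>)"
    by (rule set_integral_mono) (use set_integrable_abs[OF i] set_integrable_abs[OF q_int] le in auto)
  finally show ?thesis unfolding log_formula[OF e] .
qed

lemma restrict_time: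
  assumes "0 \<le> s" "s \<le> t"
  shows "cubic_pair s \<beta> X Y"
proof
  show "set_integrable lborel {0..s} (\<lambda>r. \<beta> * X r - X r ^ 3)" "set_integrable lborel {0..s} (\<lambda>r. \<beta> * Y r - Y r ^ 3)"
    using assms by (auto intro: set_integrable_subset[OF X_int] set_integrable_subset[OF Y_int])
  show "X r - Y r = X 0 - Y 0 + (LBINT r:{0..r}. (\<beta> * X r - X r ^ 3) - (\<beta> * Y r - Y r ^ 3))"
    if "r \<in> {0..s}" for r
    using that assms by (intro diff) auto
qed (use assms in auto)

lemma log_bound':
  assumes e: "\<epsilon> > 0" and s: "0 \<le> s" "s \<le> t"
  shows "\<bar>ln ((D s)\<^sup>2 + \<epsilon>) / 2 - ln ((D 0)\<^sup>2 + \<epsilon>) / 2\<bar> \<le> (LBINT s:{0..t}. \<bar>q s\<bar>)"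
proof -
  interpret S: cubic_pair s \<beta> X Y using s by (rule restrict_time)
  have "(LBINT s:{0..s}. \<bar>q s\<bar>) \<le> (LBINT s:{0..t}. \<bar>q s\<bar>)"
    by (rule set_integral_mono_set) (use set_integrable_abs[OF q_int] s in auto)
  thus ?thesis using S.log_bound[OF e] by linarith
qed

lemma D_nonzero:
  assumes "D 0 \<noteq> 0" and s: "0 \<le> s" "s \<le> t"
  shows "D s \<noteq> 0"
proof
  assume z: "D s = 0"
  define Q where "Q = (LBINT s:{0..t}. \<bar>q s\<bar>)"
  \<comment> \<open>Chosen so that \<epsilon> = c / 2 contradicts the uniform bound: at a zero of
    \<open>D\<close> the bound would give ln ((D 0)^2 + c / 2) \<le> ln (c / 2) + 2 Q = ln ((D 0)^2)
    - ln 2.\<close>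
  define c where "c = (D 0)\<^sup>2 * exp (- 2 * Q)"
  have c: "c > 0" using assms(1) by (simp add: c_def)
  have p: "(D 0)\<^sup>2 > 0" using assms(1) by simp
  have "ln ((D 0)\<^sup>2) < ln ((D 0)\<^sup>2 + c / 2)" by (rule ln_less_cancel_iff[THEN iffD2, OF p]) (use p c in \<open>simp_all add: add_pos_pos\<close>)
  moreover have "ln (c / 2) = ln ((D 0)\<^sup>2) - 2 * Q - ln 2"
    using assms(1) by (simp add: c_def ln_mult ln_div)
  moreover have "ln 2 > (0::real)" by simp
  moreover have "ln ((D 0)\<^sup>2 + c / 2) \<le> ln (c / 2) + 2 * Q"
    using abs_le_D2[OF log_bound'[of "c / 2" s]] s c z unfolding Q_def[symmetric] by simp
  ultimately show False by linarith
qed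

text \<open>Pathwise uniqueness. \<open>log_bound\<close> is symmetric in the two end points, so the
  argument of \<open>D_nonzero\<close> also runs backwards in time.\<close>

lemma D_zero:
  assumes "D 0 = 0" shows "D t = 0"
proof (rule ccontr)
  assume z: "D t \<noteq> 0"
  define Q where "Q = (LBINT s:{0..t}. \<bar>q s\<bar>)"
  define c where "c = (D t)\<^sup>2 * exp (- 2 * Q)"
  have c: "c > 0" using z by (simp add: c_def)
  have p: "(D t)\<^sup>2 > 0" using z by simp
  have "ln ((D t)\<^sup>2) < ln ((D t)\<^sup>2 + c / 2)" by (rule ln_less_cancel_iff[THEN iffD2, OF p]) (use p c in \<open>simp_all add: add_pos_pos\<close>)
  moreover have "ln (c / 2) = ln ((D t)\<^sup>2) - 2 * Q - ln 2"
    using z by (simp add: c_def ln_mult ln_div)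
  moreover have "ln 2 > (0::real)" by simp
  moreover have "ln ((D t)\<^sup>2 + c / 2) \<le> ln (c / 2) + 2 * Q"
    using abs_le_D1[OF log_bound[of "c / 2"]] c assms unfolding Q_def[symmetric] by simp
  ultimately show False by linarith
qed

lemma D_same_sign: "0 \<le> D t * D 0"
proof (rule ccontr)
  assume n: "\<not> 0 \<le> D t * D 0"
  hence "D 0 \<noteq> 0" by auto
  moreover have "\<exists>s. 0 \<le> s \<and> s \<le> t \<and> D s = 0"
  proof (cases "D 0 < 0")
    case True
    hence "D t > 0" using n by (auto simp: mult_less_0_iff not_le)
    thus ?thesis using IVT'[OF _ _ t D_cont, of 0] True by auto
  next
    case False
    hence "D 0 > 0" "D t < 0" using n by (auto simp: mult_less_0_iff not_le)
    thus ?thesis using IVT2'[OF _ _ t D_cont, of 0] by auto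
  qed
  ultimately show False using D_nonzero by blast
qed

text \<open>The limit \<epsilon> \<rightarrow> 0 in \<open>log_formula\<close>, dominated by
  \<bar>q\<bar>. The factor D^2 / (D^2 + \<epsilon>) tends to 1 only off the zeros of
  \<open>D\<close>, whence the need for \<open>D_nonzero\<close> on the whole interval;
  \<open>D_same_sign\<close> then removes the absolute values.\<close>

lemma exp_formula: "D t = D 0 * exp (LBINT s:{0..t}. q s)"
proof (cases "D 0 = 0")
  case False
  define e where "e n = 1 / real (Suc n)" for n
  have e0: "e \<longlonglongrightarrow> 0" unfolding e_def by (rule LIMSEQ_Suc[OF lim_const_over_n])
  have ep: "e n > 0" for n by (simp add: e_def)
  have nz: "D t \<noteq> 0" using D_nonzero[OF False, of t] t by simp
  have "(\<lambda>n. LBINT s:{0..t}. (D s)\<^sup>2 / ((D s)\<^sup>2 + e n) * q s) \<longlonglongrightarrow> (LBINT s:{0..t}. q s)"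
    unfolding set_lebesgue_integral_def
  proof (rule integral_dominated_convergence)
    show "integrable lborel (\<lambda>s. indicator {0..t} s *\<^sub>R \<bar>q s\<bar>)"
      using set_integrable_abs[OF q_int] by (simp add: set_integrable_def)
    show "AE s in lborel. (\<lambda>n. indicator {0..t} s *\<^sub>R ((D s)\<^sup>2 / ((D s)\<^sup>2 + e n) * q s))
            \<longlonglongrightarrow> indicator {0..t} s *\<^sub>R q s"
    proof (intro AE_I2)
      fix s
      show "(\<lambda>n. indicator {0..t} s *\<^sub>R ((D s)\<^sup>2 / ((D s)\<^sup>2 + e n) * q s)) \<longlonglongrightarrow> indicator {0..t} s *\<^sub>R q s"
      proof (cases "s \<in> {0..t}")
        case True
        hence "D s \<noteq> 0" using D_nonzero[OF False] by auto
        hence "(\<lambda>n. (D s)\<^sup>2 / ((D s)\<^sup>2 + e n) * q s) \<longlonglongrightarrow> (D s)\<^sup>2 / ((D s)\<^sup>2 + 0) * q s"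
          by (intro tendsto_intros e0) auto
        thus ?thesis using True \<open>D s \<noteq> 0\<close> by simp
      qed simp
    qed
    show "AE s in lborel. norm (indicator {0..t} s *\<^sub>R ((D s)\<^sup>2 / ((D s)\<^sup>2 + e n) * q s)) \<le> indicator {0..t} s *\<^sub>R \<bar>q s\<bar>" for n
    proof (intro AE_I2)
      fix s
      show "norm (indicator {0..t} s *\<^sub>R ((D s)\<^sup>2 / ((D s)\<^sup>2 + e n) * q s)) \<le> indicator {0..t} s *\<^sub>R \<bar>q s\<bar>"
        using mult_right_mono[OF ratio_le_1[OF ep[of n]], of "\<bar>q s\<bar>" "D s"]
        by (auto simp: indicator_def abs_mult)
    qed
  qed measurable
  moreover have "(\<lambda>n. ln ((D t)\<^sup>2 + e n) / 2 - ln ((D 0)\<^sup>2 + e n) / 2)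
     \<longlonglongrightarrow> ln ((D t)\<^sup>2 + 0) / 2 - ln ((D 0)\<^sup>2 + 0) / 2"
    by (intro tendsto_intros e0) (use nz False in auto)
  ultimately have "ln ((D t)\<^sup>2 + 0) / 2 - ln ((D 0)\<^sup>2 + 0) / 2 = (LBINT s:{0..t}. q s)"
    unfolding log_formula[OF ep] using LIMSEQ_unique by blast
  moreover have "ln (x\<^sup>2 + 0) / 2 = ln \<bar>x\<bar>" if "x \<noteq> 0" for x :: real
    using ln_realpow[of "\<bar>x\<bar>" 2] that by simp
  ultimately have "ln \<bar>D t\<bar> = ln \<bar>D 0\<bar> + (LBINT s:{0..t}. q s)" using nz False by simp
  hence "\<bar>D t\<bar> = \<bar>D 0\<bar> * exp (LBINT s:{0..t}. q s)"
    using nz False by (metis exp_add exp_ln zero_less_abs_iff)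
  thus ?thesis using D_same_sign nz False by (auto simp: abs_if zero_le_mult_iff split: if_splits)
qed (use D_zero in simp)

end

section \<open>The logarithmic energy under random maps\<close>

text \<open>The Laplace transform of 1 - cos. It is the inner of the two integrations that build the
  smoothed logarithm out of kernels whose mean is governed by a characteristic function.\<close>

lemma nn_integral_cos_kernel:
  fixes u d :: real
  assumes u: "u > 0"
  shows "(\<integral>\<^sup>+s. ennreal ((1 - cos (s * d)) * exp (- (u * s))) * indicator {0..} s \<partial>lborel) = ennreal (1 / u - u / (u\<^sup>2 + d\<^sup>2))"
proof -
  define n where "n = u\<^sup>2 + d\<^sup>2"
  have n: "n > 0" using u by (simp add: n_def add_pos_nonneg)
  \<comment> \<open>The primitive of the integrand that vanishes at infinity, so the value at 0
    alone remains.\<close>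
  define F where "F s = exp (- (u * s)) * (- 1 / u - (d * sin (s * d) - u * cos (s * d)) / n)" for s
  have "(\<integral>\<^sup>+s. ennreal ((1 - cos (s * d)) * exp (- (u * s))) * indicator {0..} s \<partial>lborel) = ennreal (0 - F 0)"
  proof (rule nn_integral_FTC_atLeast)
    show "(\<lambda>s. (1 - cos (s * d)) * exp (- (u * s))) \<in> borel_measurable borel" by measurable
    show "0 \<le> (1 - cos (s * d)) * exp (- (u * s))" for s by simp
    show "(F has_real_derivative (1 - cos (s * d)) * exp (- (u * s))) (at s)" for s
    proof -
      have "(F has_real_derivative exp (- (u * s)) * (- u) * (- 1 / u - (d * sin (s * d) - u * cos (s * d)) / n)
              + (- ((d * (cos (s * d) * d) - u * (- sin (s * d) * d)) / n)) * exp (- (u * s))) (at s)"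
        unfolding F_def using n u by (auto intro!: derivative_eq_intros)
      moreover have "exp (- (u * s)) * (- u) * (- 1 / u - (d * sin (s * d) - u * cos (s * d)) / n)
              + (- ((d * (cos (s * d) * d) - u * (- sin (s * d) * d)) / n)) * exp (- (u * s))
           = exp (- (u * s)) * (1 - cos (s * d) * ((u * u + d * d) / n))"
        using n u by (simp add: field_simps)
      moreover have "(u * u + d * d) / n = 1" using n u by (simp add: n_def power2_eq_square add_nonneg_eq_0_iff)
      ultimately show ?thesis by (simp add: mult.commute)
    qed
    show "(F \<longlongrightarrow> 0) at_top"
    proof (rule Lim_null_comparison)
      define C where "C = \<bar>1 / u\<bar> + (\<bar>d\<bar> + \<bar>u\<bar>) / n"
      have "\<bar>- 1 / u - (d * sin (s * d) - u * cos (s * d)) / n\<bar> \<le> C" for s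
      proof -
        have "\<bar>d * sin (s * d) - u * cos (s * d)\<bar> \<le> \<bar>d\<bar> * 1 + \<bar>u\<bar> * 1"
          by (rule order_trans[OF abs_triangle_ineq4], unfold abs_mult) (intro add_mono mult_left_mono; simp)
        hence "\<bar>(d * sin (s * d) - u * cos (s * d)) / n\<bar> \<le> (\<bar>d\<bar> + \<bar>u\<bar>) / n"
          using n by (simp add: divide_right_mono)
        thus ?thesis unfolding C_def by (intro order_trans[OF abs_triangle_ineq4] add_mono) auto
      qed
      thus "\<forall>\<^sub>F s in at_top. norm (F s) \<le> exp (- (u * s)) * C"
        unfolding F_def by (auto simp: abs_mult)
      have "filterlim (\<lambda>s. u * s) at_top at_top"
        using u by (intro filterlim_tendsto_pos_mult_at_top[OF tendsto_const _ filterlim_ident])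
      hence "((\<lambda>s. exp (- (u * s))) \<longlongrightarrow> 0) at_top"
        by (intro filterlim_compose[OF exp_at_bot] filterlim_compose[OF filterlim_uminus_at_bot_at_top])
      thus "((\<lambda>s. exp (- (u * s)) * C) \<longlongrightarrow> 0) at_top" by (rule tendsto_mult_left_zero)
    qed
  qed
  also have "0 - F 0 = 1 / u - u / (u\<^sup>2 + d\<^sup>2)" by (simp add: F_def n_def)
  finally show ?thesis .
qed

text \<open>The outer integration. The cutoff at \<delta> is what smooths the logarithm, and
  subtracting ln \<delta> normalises the kernel to vanish at d = 0, so it is nonnegative and
  nonnegative integrals apply throughout.\<close>

lemma nn_integral_log_kernel:
  fixes d \<delta> :: real
  assumes \<delta>: "\<delta> > 0"
  shows "(\<integral>\<^sup>+u. ennreal (1 / u - u / (u\<^sup>2 + d\<^sup>2)) * indicator {\<delta>..} u \<partial>lborel) = ennreal (ln (d\<^sup>2 + \<delta>\<^sup>2) / 2 - ln \<delta>)"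
proof -
  define F where "F u = ln u - ln (d\<^sup>2 + u\<^sup>2) / 2" for u
  have "(\<integral>\<^sup>+u. ennreal (1 / u - u / (u\<^sup>2 + d\<^sup>2)) * indicator {\<delta>..} u \<partial>lborel) = ennreal (0 - F \<delta>)"
  proof (rule nn_integral_FTC_atLeast)
    show "(\<lambda>u. 1 / u - u / (u\<^sup>2 + d\<^sup>2)) \<in> borel_measurable borel" by measurable
    fix u assume "\<delta> \<le> u"
    hence u: "u > 0" using \<delta> by simp
    have n: "d\<^sup>2 + u\<^sup>2 > 0" using u by (simp add: add_nonneg_pos)
    have "((\<lambda>x. ln (d\<^sup>2 + x\<^sup>2)) has_real_derivative 1 / (d\<^sup>2 + u\<^sup>2) * (2 * u)) (at u)"
      by (rule DERIV_chain2[where f=ln and g="\<lambda>x. d\<^sup>2 + x\<^sup>2", OF DERIV_ln_divide[OF n]]) (auto intro!: derivative_eq_intros)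
    from DERIV_diff[OF DERIV_ln_divide[OF u] DERIV_cdivide[OF this, of 2]]
    have "(F has_real_derivative 1 / u - 1 / (d\<^sup>2 + u\<^sup>2) * (2 * u) / 2) (at u)" unfolding F_def .
    moreover have "1 / (d\<^sup>2 + u\<^sup>2) * (2 * u) / 2 = u / p" if "p = d\<^sup>2 + u\<^sup>2" for p unfolding that[symmetric] by simp
    ultimately show "(F has_real_derivative 1 / u - u / (u\<^sup>2 + d\<^sup>2)) (at u)" by (simp add: add.commute)
    have "u / (u\<^sup>2 + d\<^sup>2) \<le> u / u\<^sup>2" using u by (intro divide_left_mono) (auto simp: add_pos_nonneg)
    thus "0 \<le> 1 / u - u / (u\<^sup>2 + d\<^sup>2)" using u by (simp add: power2_eq_square)
  next
    have "((\<lambda>u. d\<^sup>2 * inverse (u\<^sup>2)) \<longlongrightarrow> d\<^sup>2 * 0) at_top"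
      by (intro tendsto_mult tendsto_const tendsto_inverse_0_at_top filterlim_pow_at_top filterlim_ident) simp
    hence "((\<lambda>u. - (ln (d\<^sup>2 * inverse (u\<^sup>2) + 1) / 2)) \<longlongrightarrow> - (ln (d\<^sup>2 * 0 + 1) / 2)) at_top"
      by (rule tendsto_minus[OF tendsto_divide[OF tendsto_ln[OF tendsto_add[OF _ tendsto_const]] tendsto_const]]) simp_all
    hence "((\<lambda>u. - (ln (d\<^sup>2 * inverse (u\<^sup>2) + 1) / 2)) \<longlongrightarrow> 0) at_top" by simp
    moreover have "\<forall>\<^sub>F u in at_top. - (ln (d\<^sup>2 * inverse (u\<^sup>2) + 1) / 2) = F u"
    proof (rule eventually_mono[OF eventually_gt_at_top[of 0]])
      fix u :: real assume u: "0 < u"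
      have "d\<^sup>2 * inverse (u\<^sup>2) + 1 = (d\<^sup>2 + u\<^sup>2) / u\<^sup>2" using u by (simp add: field_simps)
      moreover have "ln ((d\<^sup>2 + u\<^sup>2) / u\<^sup>2) = ln (d\<^sup>2 + u\<^sup>2) - ln (u\<^sup>2)" using u by (intro ln_divide_pos) (auto simp: add_nonneg_pos)
      moreover have "ln (u\<^sup>2) = 2 * ln u" using u by (simp add: ln_realpow)
      ultimately show "- (ln (d\<^sup>2 * inverse (u\<^sup>2) + 1) / 2) = F u" by (simp add: F_def diff_divide_distrib)
    qed
    ultimately show "(F \<longlongrightarrow> 0) at_top" by (rule Lim_transform_eventually)
  qed
  also have "0 - F \<delta> = ln (d\<^sup>2 + \<delta>\<^sup>2) / 2 - ln \<delta>" by (simp add: F_def)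
  finally show ?thesis .
qed

text \<open>For independent copies the mean of exp (i (g X - g Y)) is the squared modulus of the
  mean of exp (i g X). The energy of this kernel is therefore one minus a squared modulus, written
  here in real and imaginary parts.\<close>

lemma nn_integral_cos_diff:
  assumes "prob_space \<rho>" and [measurable]: "g \<in> borel_measurable \<rho>"
  shows "(\<integral>\<^sup>+x. \<integral>\<^sup>+y. ennreal (1 - cos (g x - g y)) \<partial>\<rho> \<partial>\<rho>)
       = ennreal (1 - (\<integral>x. cos (g x) \<partial>\<rho>)\<^sup>2 - (\<integral>x. sin (g x) \<partial>\<rho>)\<^sup>2)"
proof -
  interpret prob_space \<rho> by fact
  have ic[simp]: "integrable \<rho> (\<lambda>x. cos (g x))" by (rule integrable_const_bound[where B=1]) auto
  have isn[simp]: "integrable \<rho> (\<lambda>x. sin (g x))" by (rule integrable_const_bound[where B=1]) auto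
  define C S where "C = (\<integral>x. cos (g x) \<partial>\<rho>)" and "S = (\<integral>x. sin (g x) \<partial>\<rho>)"
  have e: "1 - cos (g x - g y) = 1 - cos (g x) * cos (g y) - sin (g x) * sin (g y)" for x y
    by (simp add: cos_diff)
  have inner: "(\<integral>\<^sup>+y. ennreal (1 - cos (g x - g y)) \<partial>\<rho>) = ennreal (1 - cos (g x) * C - sin (g x) * S)" for x
  proof -
    have "(\<integral>\<^sup>+y. ennreal (1 - cos (g x - g y)) \<partial>\<rho>) = ennreal (\<integral>y. 1 - cos (g x - g y) \<partial>\<rho>)"
    proof (rule nn_integral_eq_integral)
      show "integrable \<rho> (\<lambda>y. 1 - cos (g x - g y))" unfolding e by simp
    qed simp
    also have "(\<integral>y. 1 - cos (g x - g y) \<partial>\<rho>) = 1 - cos (g x) * C - sin (g x) * S"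
      unfolding e C_def S_def by (simp add: prob_space)
    finally show ?thesis .
  qed
  have nonneg: "0 \<le> 1 - cos (g x) * C - sin (g x) * S" for x
  proof -
    have "0 \<le> (\<integral>y. 1 - cos (g x - g y) \<partial>\<rho>)" by (rule integral_nonneg_AE) auto
    also have "\<dots> = 1 - cos (g x) * C - sin (g x) * S"
      unfolding e C_def S_def by (simp add: prob_space)
    finally show ?thesis .
  qed
  have "(\<integral>\<^sup>+x. ennreal (1 - cos (g x) * C - sin (g x) * S) \<partial>\<rho>) = ennreal (\<integral>x. 1 - cos (g x) * C - sin (g x) * S \<partial>\<rho>)"
    by (rule nn_integral_eq_integral) (use nonneg in auto)
  also have "(\<integral>x. 1 - cos (g x) * C - sin (g x) * S \<partial>\<rho>) = 1 - C\<^sup>2 - S\<^sup>2"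
    by (simp add: prob_space power2_eq_square flip: C_def S_def)
  finally show ?thesis unfolding inner C_def S_def .
qed

lemma (in prob_space) square_integral_le:
  fixes X :: "'a \<Rightarrow> real"
  assumes "integrable M X" "integrable M (\<lambda>x. (X x)\<^sup>2)"
  shows "(expectation X)\<^sup>2 \<le> expectation (\<lambda>x. (X x)\<^sup>2)"
  using variance_eq[OF assms] variance_positive[of X] by simp


lemma nn_integral_triple:
  assumes "sigma_finite_measure \<rho>"
    and [measurable]: "(\<lambda>(\<omega>, x, y). g \<omega> x y) \<in> borel_measurable (M \<Otimes>\<^sub>M (\<rho> \<Otimes>\<^sub>M \<rho>))"
  shows "(\<integral>\<^sup>+\<omega>. \<integral>\<^sup>+x. \<integral>\<^sup>+y. g \<omega> x y \<partial>\<rho> \<partial>\<rho> \<partial>M) = (\<integral>\<^sup>+(\<omega>, x, y). g \<omega> x y \<partial>(M \<Otimes>\<^sub>M (\<rho> \<Otimes>\<^sub>M \<rho>)))"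
proof -
  interpret \<rho>: sigma_finite_measure \<rho> by fact
  interpret \<rho>\<rho>: sigma_finite_measure "\<rho> \<Otimes>\<^sub>M \<rho>"
    by (rule sigma_finite_pair_measure) (rule \<rho>.sigma_finite_measure_axioms)+
  have "(\<integral>\<^sup>+\<omega>. \<integral>\<^sup>+x. \<integral>\<^sup>+y. g \<omega> x y \<partial>\<rho> \<partial>\<rho> \<partial>M) = (\<integral>\<^sup>+\<omega>. (\<integral>\<^sup>+(x, y). g \<omega> x y \<partial>(\<rho> \<Otimes>\<^sub>M \<rho>)) \<partial>M)"
  proof (rule nn_integral_cong)
    fix \<omega> assume [measurable]: "\<omega> \<in> space M"
    have "(\<lambda>z. (\<lambda>(\<omega>, x, y). g \<omega> x y) (\<omega>, z)) \<in> borel_measurable (\<rho> \<Otimes>\<^sub>M \<rho>)" by measurable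
    thus "(\<integral>\<^sup>+x. \<integral>\<^sup>+y. g \<omega> x y \<partial>\<rho> \<partial>\<rho>) = (\<integral>\<^sup>+(x, y). g \<omega> x y \<partial>(\<rho> \<Otimes>\<^sub>M \<rho>))"
      by (subst \<rho>.nn_integral_fst[symmetric]) auto
  qed
  thus ?thesis by (subst \<rho>\<rho>.nn_integral_fst[symmetric]) auto
qed

text \<open>
  The kernel \<open>ln (d\<^sup>2 + \<delta>\<^sup>2)\<close> is a positive mixture of the kernels \<open>1 - cos (s d)\<close>, and
  \<open>\<bar>E exp (i s Z)\<bar>\<^sup>2\<close> is at most the average of the squared conditional characteristic functions.
\<close>

lemma log_energy_random_map:
  fixes f :: "'a \<times> real \<Rightarrow> real"
  assumes M: "prob_space M" and \<rho>: "prob_space \<rho>" and sets\<rho>[measurable_cong]: "sets \<rho> = sets borel"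
    and f[measurable]: "f \<in> borel_measurable (M \<Otimes>\<^sub>M \<rho>)"
    and inv: "distr (M \<Otimes>\<^sub>M \<rho>) borel f = \<rho>"
    and \<delta>: "\<delta> > 0"
  shows "(\<integral>\<^sup>+\<omega>. \<integral>\<^sup>+x. \<integral>\<^sup>+y. ennreal (ln ((f (\<omega>, x) - f (\<omega>, y))\<^sup>2 + \<delta>\<^sup>2) / 2 - ln \<delta>) \<partial>\<rho> \<partial>\<rho> \<partial>M)
      \<le> (\<integral>\<^sup>+x. \<integral>\<^sup>+y. ennreal (ln ((x - y)\<^sup>2 + \<delta>\<^sup>2) / 2 - ln \<delta>) \<partial>\<rho> \<partial>\<rho>)"
proof -
  interpret M: prob_space M by fact
  interpret \<rho>: prob_space \<rho> by fact
  interpret M\<rho>: pair_prob_space M \<rho> ..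
  define w :: "real \<times> real \<Rightarrow> ennreal"
    where "w = (\<lambda>(u, s). ennreal (exp (- (u * s))) * indicator {0..} s * indicator {\<delta>..} u)"
  have w[measurable]: "w \<in> borel_measurable (lborel \<Otimes>\<^sub>M lborel)" unfolding w_def by measurable
  define L :: "(real \<times> real) measure" where "L = lborel \<Otimes>\<^sub>M lborel"
  interpret L: sigma_finite_measure L unfolding L_def by (rule sigma_finite_pair_measure) (rule lborel.sigma_finite_measure_axioms)+
  have [measurable]: "w \<in> borel_measurable L" "snd \<in> borel_measurable L" unfolding L_def by measurable
  have J: "ennreal (ln (d\<^sup>2 + \<delta>\<^sup>2) / 2 - ln \<delta>) = (\<integral>\<^sup>+p. ennreal (1 - cos (snd p * d)) * w p \<partial>L)" for d
  proof -
    have "(\<integral>\<^sup>+p. ennreal (1 - cos (snd p * d)) * w p \<partial>L) = (\<integral>\<^sup>+u. \<integral>\<^sup>+s. ennreal (1 - cos (s * d)) * w (u, s) \<partial>lborel \<partial>lborel)"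
      unfolding L_def by (subst lborel.nn_integral_fst[symmetric]) simp_all
    also have "\<dots> = (\<integral>\<^sup>+u. (\<integral>\<^sup>+s. ennreal ((1 - cos (s * d)) * exp (- (u * s))) * indicator {0..} s \<partial>lborel) * indicator {\<delta>..} u \<partial>lborel)"
      by (intro nn_integral_cong) (simp add: w_def ennreal_mult' mult.assoc flip: nn_integral_multc)
    also have "\<dots> = (\<integral>\<^sup>+u. ennreal (1 / u - u / (u\<^sup>2 + d\<^sup>2)) * indicator {\<delta>..} u \<partial>lborel)"
      using \<delta> by (intro nn_integral_cong) (auto simp: nn_integral_cos_kernel split: split_indicator)
    finally show ?thesis using nn_integral_log_kernel[OF \<delta>, of d] by simp
  qed
  have fst_int: "(\<lambda>x. f (\<omega>, x)) \<in> borel_measurable \<rho>" if "\<omega> \<in> space M" for \<omega>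
    using that by measurable
  \<comment> \<open>The energy inequality at a single frequency \<open>s\<close>; integrating it
    against the weight \<open>w\<close> gives the claim.\<close>
  have base: "(\<integral>\<^sup>+\<omega>. \<integral>\<^sup>+x. \<integral>\<^sup>+y. ennreal (1 - cos (s * (f (\<omega>, x) - f (\<omega>, y)))) \<partial>\<rho> \<partial>\<rho> \<partial>M)
      \<le> (\<integral>\<^sup>+x. \<integral>\<^sup>+y. ennreal (1 - cos (s * (x - y))) \<partial>\<rho> \<partial>\<rho>)" for s
  proof -
    \<comment> \<open>Jensen's inequality for the mean over \<open>x\<close> with \<omega> held
      fixed: by \<open>inv\<close>, averaging these means over \<omega> returns the mean under
      \<rho>. Taking cosine and sine for \<open>h\<close> covers the squared modulus.\<close>
    have main: "integrable M (\<lambda>\<omega>. (\<integral>x. h (s * f (\<omega>, x)) \<partial>\<rho>)\<^sup>2) \<and>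
        (\<integral>x. h (s * x) \<partial>\<rho>)\<^sup>2 \<le> (\<integral>\<omega>. (\<integral>x. h (s * f (\<omega>, x)) \<partial>\<rho>)\<^sup>2 \<partial>M)"
      if h[measurable]: "h \<in> borel_measurable borel" and hb: "\<And>x. \<bar>h x\<bar> \<le> 1" for h :: "real \<Rightarrow> real"
    proof -
      have ip: "integrable (M \<Otimes>\<^sub>M \<rho>) (\<lambda>z. h (s * f z))"
        by (rule M\<rho>.integrable_const_bound[where B=1]) (use hb in auto)
      have "(\<integral>x. h (s * x) \<partial>\<rho>) = (\<integral>x. h (s * x) \<partial>distr (M \<Otimes>\<^sub>M \<rho>) borel f)" unfolding inv ..
      also have "\<dots> = (\<integral>z. h (s * f z) \<partial>(M \<Otimes>\<^sub>M \<rho>))" by (rule integral_distr) auto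
      also have "\<dots> = (\<integral>\<omega>. \<integral>x. h (s * f (\<omega>, x)) \<partial>\<rho> \<partial>M)"
        by (rule M\<rho>.integral_fst'[symmetric]) (rule ip)
      finally have e: "(\<integral>x. h (s * x) \<partial>\<rho>) = (\<integral>\<omega>. \<integral>x. h (s * f (\<omega>, x)) \<partial>\<rho> \<partial>M)" .
      have bd: "\<bar>\<integral>x. h (s * f (\<omega>, x)) \<partial>\<rho>\<bar> \<le> 1" if "\<omega> \<in> space M" for \<omega>
      proof -
        have "norm (\<integral>x. h (s * f (\<omega>, x)) \<partial>\<rho>) \<le> (\<integral>x. 1 \<partial>\<rho>)"
          by (rule Bochner_Integration.integral_norm_bound_integral)
             (use hb fst_int[OF that] in \<open>auto intro!: \<rho>.integrable_const_bound[where B=1]\<close>)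
        thus ?thesis by (simp add: \<rho>.prob_space)
      qed
      have m[measurable]: "(\<lambda>\<omega>. \<integral>x. h (s * f (\<omega>, x)) \<partial>\<rho>) \<in> borel_measurable M"
        by measurable
      have i2: "integrable M (\<lambda>\<omega>. (\<integral>x. h (s * f (\<omega>, x)) \<partial>\<rho>)\<^sup>2)"
        by (rule M.integrable_const_bound[where B=1]) (use bd in \<open>auto simp: abs_square_le_1\<close>)
      have i1: "integrable M (\<lambda>\<omega>. (\<integral>x. h (s * f (\<omega>, x)) \<partial>\<rho>))"
        by (rule M.integrable_const_bound[where B=1]) (use bd in auto)
      show ?thesis using i2 M.square_integral_le[OF i1 i2] unfolding e by simp
    qed
    note mc = main[of cos] and ms = main[of sin]
    let ?c = "\<lambda>\<omega>. \<integral>x. cos (s * f (\<omega>, x)) \<partial>\<rho>" and ?s = "\<lambda>\<omega>. \<integral>x. sin (s * f (\<omega>, x)) \<partial>\<rho>"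
    have ic: "integrable M (\<lambda>\<omega>. (?c \<omega>)\<^sup>2)" and ims: "integrable M (\<lambda>\<omega>. (?s \<omega>)\<^sup>2)" using mc ms by auto
    have nn: "0 \<le> 1 - (?c \<omega>)\<^sup>2 - (?s \<omega>)\<^sup>2" if "\<omega> \<in> space M" for \<omega>
    proof -
      have fi[measurable]: "(\<lambda>x. f (\<omega>, x)) \<in> borel_measurable \<rho>" by (rule fst_int[OF that])
      have "(?c \<omega>)\<^sup>2 \<le> (\<integral>x. (cos (s * f (\<omega>, x)))\<^sup>2 \<partial>\<rho>)" "(?s \<omega>)\<^sup>2 \<le> (\<integral>x. (sin (s * f (\<omega>, x)))\<^sup>2 \<partial>\<rho>)"
        by (rule \<rho>.square_integral_le; rule \<rho>.integrable_const_bound[where B=1]; auto simp: abs_square_le_1)+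
      moreover have "(\<integral>x. (cos (s * f (\<omega>, x)))\<^sup>2 \<partial>\<rho>) + (\<integral>x. (sin (s * f (\<omega>, x)))\<^sup>2 \<partial>\<rho>)
          = (\<integral>x. (cos (s * f (\<omega>, x)))\<^sup>2 + (sin (s * f (\<omega>, x)))\<^sup>2 \<partial>\<rho>)"
        by (rule Bochner_Integration.integral_add[symmetric]; rule \<rho>.integrable_const_bound[where B=1]; auto simp: abs_square_le_1)
      ultimately show ?thesis by (simp add: \<rho>.prob_space)
    qed
    have "(\<integral>\<^sup>+\<omega>. \<integral>\<^sup>+x. \<integral>\<^sup>+y. ennreal (1 - cos (s * (f (\<omega>, x) - f (\<omega>, y)))) \<partial>\<rho> \<partial>\<rho> \<partial>M)
        = (\<integral>\<^sup>+\<omega>. ennreal (1 - (?c \<omega>)\<^sup>2 - (?s \<omega>)\<^sup>2) \<partial>M)"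
    proof (rule nn_integral_cong)
      fix \<omega> assume "\<omega> \<in> space M"
      hence [measurable]: "(\<lambda>x. f (\<omega>, x)) \<in> borel_measurable \<rho>" by (rule fst_int)
      show "(\<integral>\<^sup>+x. \<integral>\<^sup>+y. ennreal (1 - cos (s * (f (\<omega>, x) - f (\<omega>, y)))) \<partial>\<rho> \<partial>\<rho>) = ennreal (1 - (?c \<omega>)\<^sup>2 - (?s \<omega>)\<^sup>2)"
        using nn_integral_cos_diff[OF \<rho>, of "\<lambda>x. s * f (\<omega>, x)"] by (simp add: right_diff_distrib)
    qed
    also have "\<dots> = ennreal (\<integral>\<omega>. 1 - (?c \<omega>)\<^sup>2 - (?s \<omega>)\<^sup>2 \<partial>M)"
      by (rule nn_integral_eq_integral) (use ic ims nn in \<open>auto intro!: AE_I2\<close>)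
    also have "(\<integral>\<omega>. 1 - (?c \<omega>)\<^sup>2 - (?s \<omega>)\<^sup>2 \<partial>M) = 1 - (\<integral>\<omega>. (?c \<omega>)\<^sup>2 \<partial>M) - (\<integral>\<omega>. (?s \<omega>)\<^sup>2 \<partial>M)"
      using ic ims by (simp add: M.prob_space)
    also have "\<dots> \<le> 1 - (\<integral>x. cos (s * x) \<partial>\<rho>)\<^sup>2 - (\<integral>x. sin (s * x) \<partial>\<rho>)\<^sup>2"
      using mc ms by auto
    also have "ennreal \<dots> = (\<integral>\<^sup>+x. \<integral>\<^sup>+y. ennreal (1 - cos (s * (x - y))) \<partial>\<rho> \<partial>\<rho>)"
      using nn_integral_cos_diff[OF \<rho>, of "\<lambda>x. s * x"] by (simp add: right_diff_distrib)
    finally show ?thesis by (simp add: ennreal_leI)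
  qed
  interpret \<rho>\<rho>: pair_prob_space \<rho> \<rho> ..
  interpret N: pair_prob_space M "\<rho> \<Otimes>\<^sub>M \<rho>" ..
  interpret NL: pair_sigma_finite "M \<Otimes>\<^sub>M (\<rho> \<Otimes>\<^sub>M \<rho>)" L ..
  interpret \<rho>L: pair_sigma_finite "\<rho> \<Otimes>\<^sub>M \<rho>" L ..
  note triple = nn_integral_triple[OF \<rho>.sigma_finite_measure_axioms]
  have double: "(\<integral>\<^sup>+x. \<integral>\<^sup>+y. g x y \<partial>\<rho> \<partial>\<rho>) = (\<integral>\<^sup>+(x, y). g x y \<partial>(\<rho> \<Otimes>\<^sub>M \<rho>))"
    if "(\<lambda>(x, y). g x y) \<in> borel_measurable (\<rho> \<Otimes>\<^sub>M \<rho>)" for g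
    using that by (subst \<rho>.nn_integral_fst[symmetric]) auto
  \<comment> \<open>Everything is nonnegative, so the frequency integral may be moved outside even
    when the energies are infinite.\<close>
  have "(\<integral>\<^sup>+\<omega>. \<integral>\<^sup>+x. \<integral>\<^sup>+y. ennreal (ln ((f (\<omega>, x) - f (\<omega>, y))\<^sup>2 + \<delta>\<^sup>2) / 2 - ln \<delta>) \<partial>\<rho> \<partial>\<rho> \<partial>M)
      = (\<integral>\<^sup>+z. \<integral>\<^sup>+p. (case z of (\<omega>, x, y) \<Rightarrow> ennreal (1 - cos (snd p * (f (\<omega>, x) - f (\<omega>, y)))) * w p) \<partial>L \<partial>(M \<Otimes>\<^sub>M (\<rho> \<Otimes>\<^sub>M \<rho>)))"
    by (subst triple) (auto intro!: nn_integral_cong simp: J)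
  also have "\<dots> = (\<integral>\<^sup>+p. \<integral>\<^sup>+z. (case z of (\<omega>, x, y) \<Rightarrow> ennreal (1 - cos (snd p * (f (\<omega>, x) - f (\<omega>, y)))) * w p) \<partial>(M \<Otimes>\<^sub>M (\<rho> \<Otimes>\<^sub>M \<rho>)) \<partial>L)"
    by (rule NL.Fubini'[symmetric]) measurable
  also have "\<dots> = (\<integral>\<^sup>+p. (\<integral>\<^sup>+\<omega>. \<integral>\<^sup>+x. \<integral>\<^sup>+y. ennreal (1 - cos (snd p * (f (\<omega>, x) - f (\<omega>, y)))) \<partial>\<rho> \<partial>\<rho> \<partial>M) * w p \<partial>L)"
    by (subst triple) (auto intro!: nn_integral_cong simp: case_prod_unfold simp flip: nn_integral_multc)
  also have "\<dots> \<le> (\<integral>\<^sup>+p. (\<integral>\<^sup>+x. \<integral>\<^sup>+y. ennreal (1 - cos (snd p * (x - y))) \<partial>\<rho> \<partial>\<rho>) * w p \<partial>L)"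
    by (intro nn_integral_mono mult_right_mono base) simp
  also have "\<dots> = (\<integral>\<^sup>+p. \<integral>\<^sup>+z. (case z of (x, y) \<Rightarrow> ennreal (1 - cos (snd p * (x - y))) * w p) \<partial>(\<rho> \<Otimes>\<^sub>M \<rho>) \<partial>L)"
    by (subst double) (auto intro!: nn_integral_cong simp: case_prod_unfold simp flip: nn_integral_multc)
  also have "\<dots> = (\<integral>\<^sup>+z. \<integral>\<^sup>+p. (case z of (x, y) \<Rightarrow> ennreal (1 - cos (snd p * (x - y))) * w p) \<partial>L \<partial>(\<rho> \<Otimes>\<^sub>M \<rho>))"
    by (rule \<rho>L.Fubini') measurable
  also have "\<dots> = (\<integral>\<^sup>+x. \<integral>\<^sup>+y. ennreal (ln ((x - y)\<^sup>2 + \<delta>\<^sup>2) / 2 - ln \<delta>) \<partial>\<rho> \<partial>\<rho>)"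
    by (subst double) (auto intro!: nn_integral_cong simp: J)
  finally show ?thesis .
qed

section \<open>Atoms of an invariant law\<close>

text \<open>Since the total mass is 1, only finitely many points weigh at least as much as
  \<open>x0\<close>. The maximum over them exists and is a maximum over all points.\<close>

lemma maximal_atoms:
  fixes \<rho> :: "real measure"
  assumes \<rho>: "prob_space \<rho>" and sets\<rho>: "sets \<rho> = sets borel" and atom: "measure \<rho> {x0} > 0"
  obtains q where "q > 0" "\<And>y. measure \<rho> {y} \<le> q" "finite {x. measure \<rho> {x} = q}" "{x. measure \<rho> {x} = q} \<noteq> {}"
proof -
  interpret prob_space \<rho> by fact
  define m where "m = measure \<rho> {x0}"
  have m: "m > 0" using atom by (simp add: m_def)
  define A where "A = {x. m \<le> measure \<rho> {x}}"
  have fin: "finite A"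
  proof (rule ccontr)
    assume "infinite A"
    obtain n :: nat where n: "1 / m < real n" using reals_Archimedean2 by blast
    obtain F where F: "F \<subseteq> A" "finite F" "card F = n" using infinite_arbitrarily_large[OF \<open>infinite A\<close>] by blast
    have "real n * m \<le> (\<Sum>x\<in>F. measure \<rho> {x})"
      using sum_mono[of F "\<lambda>_. m" "\<lambda>x. measure \<rho> {x}"] F by (auto simp: A_def)
    also have "\<dots> = measure \<rho> F"
      by (rule finite_measure_eq_sum_singleton[symmetric]) (use F sets\<rho> in auto)
    also have "\<dots> \<le> 1" by simp
    finally show False using n m by (simp add: field_simps)
  qed
  have ne: "A \<noteq> {}" by (auto simp: A_def m_def)
  define q where "q = Max ((\<lambda>x. measure \<rho> {x}) ` A)"
  have "q \<in> (\<lambda>x. measure \<rho> {x}) ` A" unfolding q_def by (rule Max_in) (use fin ne in auto)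
  then obtain x1 where x1: "x1 \<in> A" "measure \<rho> {x1} = q" by auto
  have qm: "m \<le> q" using x1 by (auto simp: A_def)
  show thesis
  proof (rule that)
    show "q > 0" using qm m by simp
    show "measure \<rho> {y} \<le> q" for y
    proof (cases "y \<in> A")
      case True
      thus ?thesis unfolding q_def using fin by (intro Max_ge) auto
    qed (use qm in \<open>auto simp: A_def\<close>)
    show "finite {x. measure \<rho> {x} = q}"
      by (rule finite_subset[OF _ fin]) (use qm in \<open>auto simp: A_def\<close>)
    show "{x. measure \<rho> {x} = q} \<noteq> {}" using x1 by auto
  qed
qed

text \<open>
  A maximal atom \<open>x\<close> has mass \<open>q = E \<rho>(f\<^sub>\<omega>\<^sup>-\<^sup>1{x})\<close> with integrand at most \<open>q\<close>, so almost every
  \<open>f\<^sub>\<omega>\<close> permutes the finite set of maximal atoms; an increasing permutation fixes the largest one.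
\<close>

lemma largest_maximal_atom_fixed:
  fixes f :: "'a \<times> real \<Rightarrow> real"
  assumes M: "prob_space M" and \<rho>: "prob_space \<rho>" and sets\<rho>[measurable_cong]: "sets \<rho> = sets borel"
    and q: "q > 0" "\<And>y. measure \<rho> {y} \<le> q" "finite {x. measure \<rho> {x} = q}" "{x. measure \<rho> {x} = q} \<noteq> {}"
    and f[measurable]: "f \<in> borel_measurable (M \<Otimes>\<^sub>M \<rho>)"
    and inv: "distr (M \<Otimes>\<^sub>M \<rho>) borel f = \<rho>"
    and mono: "\<And>\<omega>. \<omega> \<in> space M \<Longrightarrow> strict_mono (\<lambda>x. f (\<omega>, x))"
  shows "AE \<omega> in M. f (\<omega>, Max {x. measure \<rho> {x} = q}) = Max {x. measure \<rho> {x} = q}"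
proof -
  interpret M: prob_space M by fact
  interpret \<rho>: prob_space \<rho> by fact
  interpret M\<rho>: pair_prob_space M \<rho> ..
  define A where "A = {x. measure \<rho> {x} = q}"
  have sp: "space \<rho> = UNIV" using sets_eq_imp_space_eq[OF sets\<rho>] by simp
  have pre: "AE \<omega> in M. \<exists>y\<in>A. f (\<omega>, y) = x" if x: "x \<in> A" for x
  proof -
    define g where "g \<omega> = measure \<rho> {y. f (\<omega>, y) = x}" for \<omega>
    have E[measurable]: "{z \<in> space (M \<Otimes>\<^sub>M \<rho>). f z = x} \<in> sets (M \<Otimes>\<^sub>M \<rho>)" by measurable
    have sec: "Pair \<omega> -` {z \<in> space (M \<Otimes>\<^sub>M \<rho>). f z = x} = {y. f (\<omega>, y) = x}" if "\<omega> \<in> space M" for \<omega>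
      using that sp by (auto simp: space_pair_measure)
    have gm[measurable]: "g \<in> borel_measurable M"
    proof -
      have "(\<lambda>\<omega>. measure \<rho> (Pair \<omega> -` {z \<in> space (M \<Otimes>\<^sub>M \<rho>). f z = x})) \<in> borel_measurable M"
        unfolding measure_def using \<rho>.measurable_emeasure_Pair[OF E] by measurable
      thus ?thesis using sec by (subst measurable_cong[OF _]) (auto simp: g_def)
    qed
    \<comment> \<open>Strict monotonicity makes the fibre over \<open>x\<close> a single point or
      empty. In the empty case \<open>g\<close> is 0, which is below \<open>q\<close> because
      \<open>q\<close> is positive, so equality with \<open>q\<close> forces a preimage that is
      itself a maximal atom.\<close>
    have sub: "g \<omega> \<le> q \<and> (g \<omega> = q \<longrightarrow> (\<exists>y\<in>A. f (\<omega>, y) = x))" if w: "\<omega> \<in> space M" for \<omega>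
    proof (cases "\<exists>y. f (\<omega>, y) = x")
      case True
      then obtain y where y: "f (\<omega>, y) = x" by auto
      have "{y. f (\<omega>, y) = x} = {y}"
        using strict_mono_eq[OF mono[OF w]] y by auto
      thus ?thesis using q(2)[of y] y by (auto simp: g_def A_def)
    next
      case False
      thus ?thesis using q(1) by (auto simp: g_def)
    qed
    have gi: "integrable M g"
      by (rule M.integrable_const_bound[where B=1]) (auto simp: g_def)
    have "ennreal q = emeasure \<rho> {x}" using x by (simp add: A_def \<rho>.emeasure_eq_measure)
    also have "\<dots> = emeasure (distr (M \<Otimes>\<^sub>M \<rho>) borel f) {x}" unfolding inv ..
    also have "\<dots> = emeasure (M \<Otimes>\<^sub>M \<rho>) {z \<in> space (M \<Otimes>\<^sub>M \<rho>). f z = x}"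
      by (subst emeasure_distr) (auto intro!: arg_cong[where f="emeasure _"])
    also have "\<dots> = (\<integral>\<^sup>+\<omega>. emeasure \<rho> (Pair \<omega> -` {z \<in> space (M \<Otimes>\<^sub>M \<rho>). f z = x}) \<partial>M)"
      by (rule \<rho>.emeasure_pair_measure_alt[OF E])
    also have "\<dots> = (\<integral>\<^sup>+\<omega>. ennreal (g \<omega>) \<partial>M)"
      by (rule nn_integral_cong) (simp add: space_pair_measure sp g_def \<rho>.emeasure_eq_measure)
    also have "\<dots> = ennreal (\<integral>\<omega>. g \<omega> \<partial>M)"
      by (rule nn_integral_eq_integral[OF gi]) (simp add: g_def)
    finally have eq: "ennreal q = ennreal (\<integral>\<omega>. g \<omega> \<partial>M)" .
    have "0 \<le> (\<integral>\<omega>. g \<omega> \<partial>M)" by (rule integral_nonneg_AE) (simp add: g_def)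
    hence "q = (\<integral>\<omega>. g \<omega> \<partial>M)" using eq q(1) by simp
    hence "(\<integral>\<omega>. q - g \<omega> \<partial>M) = 0" using gi by (simp add: M.prob_space)
    hence "AE \<omega> in M. q - g \<omega> = 0"
      by (subst (asm) integral_nonneg_eq_0_iff_AE) (use gi sub in \<open>auto intro!: AE_I2\<close>)
    thus ?thesis by (rule AE_mp) (use sub in \<open>auto intro!: AE_I2\<close>)
  qed
  have "AE \<omega> in M. \<forall>x\<in>A. \<exists>y\<in>A. f (\<omega>, y) = x"
    by (rule AE_finite_allI) (use q(3) pre in \<open>auto simp: A_def\<close>)
  thus ?thesis unfolding A_def[symmetric]
  proof (rule AE_mp, intro AE_I2 impI)
    fix \<omega> assume w: "\<omega> \<in> space M" and P: "\<forall>x\<in>A. \<exists>y\<in>A. f (\<omega>, y) = x"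
    have fin: "finite A" "A \<noteq> {}" using q by (auto simp: A_def)
    \<comment> \<open>Pigeonhole: the image of \<open>A\<close> covers \<open>A\<close> and cannot
      have more elements than \<open>A\<close>, so the two coincide.\<close>
    have "A \<subseteq> (\<lambda>y. f (\<omega>, y)) ` A" using P by force
    moreover have "finite ((\<lambda>y. f (\<omega>, y)) ` A)" "card ((\<lambda>y. f (\<omega>, y)) ` A) \<le> card A"
      using fin by (auto intro: card_image_le)
    ultimately have eq: "A = (\<lambda>y. f (\<omega>, y)) ` A" by (intro card_seteq) auto
    have "f (\<omega>, Max A) \<in> A" using eq Max_in[OF fin] by blast
    hence 1: "f (\<omega>, Max A) \<le> Max A" using fin by simp
    obtain y where y: "y \<in> A" "f (\<omega>, y) = Max A" using P Max_in[OF fin] by blast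
    have "y \<le> Max A" using y fin by simp
    hence "f (\<omega>, y) \<le> f (\<omega>, Max A)" using strict_mono_less_eq[OF mono[OF w]] by blast
    thus "f (\<omega>, Max A) = Max A" using 1 y by simp
  qed
qed

section \<open>Independence of past and future\<close>

text \<open>The path frozen outside [0, T]. It carries exactly the noise of that interval yet is
  again a path of the same space, so \<phi> can be applied to it and independence can be stated for
  path-valued variables.\<close>

definition stop :: "real \<Rightarrow> (real \<Rightarrow> real) \<Rightarrow> (real \<Rightarrow> real)" where
  "stop T \<omega> = (\<lambda>s. \<omega> (max 0 (min s T)))"

lemma stop_in_cadlag_paths:
  assumes \<omega>: "\<omega> \<in> cadlag_paths" and T: "0 \<le> T"
  shows "stop T \<omega> \<in> cadlag_paths"
proof -
  have r: "(\<omega> \<longlongrightarrow> \<omega> t) (at_right t)" and l: "\<exists>l. (\<omega> \<longlongrightarrow> l) (at_left t)" and 0: "\<omega> 0 = 0" for t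
    using \<omega> by (auto simp: cadlag_paths_def cadlag_def)
  have "(stop T \<omega> \<longlongrightarrow> stop T \<omega> t) (at_right t)" for t
  proof -
    consider "t < 0" | "0 \<le> t" "t < T" | "T \<le> t" using T by linarith
    thus ?thesis
    proof cases
      case 1
      have "eventually (\<lambda>s. \<omega> 0 = stop T \<omega> s) (at_right t)"
        by (rule eventually_at_rightI[of t 0]) (use 1 T in \<open>auto simp: stop_def\<close>)
      thus ?thesis using Lim_transform_eventually[OF tendsto_const] 1 T by (auto simp: stop_def)
    next
      case 2
      have "eventually (\<lambda>s. \<omega> s = stop T \<omega> s) (at_right t)"
        by (rule eventually_at_rightI[of t T]) (use 2 T in \<open>auto simp: stop_def\<close>)
      thus ?thesis using Lim_transform_eventually[OF r[of t]] 2 T by (auto simp: stop_def)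
    next
      case 3
      have "eventually (\<lambda>s. \<omega> T = stop T \<omega> s) (at_right t)"
        by (rule eventually_at_rightI[of t "t + 1"]) (use 3 T in \<open>auto simp: stop_def\<close>)
      thus ?thesis using Lim_transform_eventually[OF tendsto_const] 3 T by (auto simp: stop_def)
    qed
  qed
  moreover have "\<exists>l. (stop T \<omega> \<longlongrightarrow> l) (at_left t)" for t
  proof -
    consider "t \<le> 0" | "0 < t" "t \<le> T" | "T < t" using T by linarith
    thus ?thesis
    proof cases
      case 1
      have "eventually (\<lambda>s. \<omega> 0 = stop T \<omega> s) (at_left t)"
        by (rule eventually_at_leftI[of "t - 1"]) (use 1 T in \<open>auto simp: stop_def\<close>)
      thus ?thesis using Lim_transform_eventually[OF tendsto_const] by blast
    next
      case 2
      have "eventually (\<lambda>s. \<omega> s = stop T \<omega> s) (at_left t)"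
        by (rule eventually_at_leftI[of 0]) (use 2 T in \<open>auto simp: stop_def\<close>)
      thus ?thesis using Lim_transform_eventually l[of t] by blast
    next
      case 3
      have "eventually (\<lambda>s. \<omega> T = stop T \<omega> s) (at_left t)"
        by (rule eventually_at_leftI[of T]) (use 3 T in \<open>auto simp: stop_def\<close>)
      thus ?thesis using Lim_transform_eventually[OF tendsto_const] by blast
    qed
  qed
  ultimately show ?thesis using 0 T by (auto simp: cadlag_paths_def cadlag_def stop_def)
qed

section \<open>Measurability of path-valued maps, cylinder sets and time grids\<close>

lemma measurable_path_spaceI:
  assumes "\<And>x. x \<in> space N \<Longrightarrow> f x \<in> cadlag_paths" "\<And>t. (\<lambda>x. f x t) \<in> borel_measurable N"
  shows "f \<in> N \<rightarrow>\<^sub>M path_space"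
  unfolding path_space_def
proof (rule measurable_restrict_space2)
  show "f \<in> N \<rightarrow>\<^sub>M Pi\<^sub>M UNIV (\<lambda>_. borel)"
    using measurable_PiM_single'[of UNIV "\<lambda>t x. f x t" N "\<lambda>_. borel"] assms(2) by auto
qed (use assms(1) in auto)

lemma measurable_path_eval: "(\<lambda>\<omega>. \<omega> t) \<in> borel_measurable path_space"
  unfolding path_space_def by (rule measurable_restrict_space1) measurable

text \<open>A generator of the \<sigma>-algebra of the variables \<open>F j\<close> with
  \<open>j\<close> in \<open>I\<close> that is stable under intersections. Leaving \<open>F\<close>
  general allows both the coordinates and the increments after time \<open>T\<close>.\<close>

definition cylinders :: "'a set \<Rightarrow> ('t \<Rightarrow> 'a \<Rightarrow> real) \<Rightarrow> 't set \<Rightarrow> 'a set set" where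
  "cylinders \<Omega> F I = {{\<omega>\<in>\<Omega>. \<forall>j\<in>J. F j \<omega> \<in> B j} | J B. finite J \<and> J \<subseteq> I \<and> (\<forall>j. B j \<in> sets borel)}"

lemma Int_stable_cylinders: "Int_stable (cylinders \<Omega> F I)"
proof (rule Int_stableI)
  fix a b assume "a \<in> cylinders \<Omega> F I" "b \<in> cylinders \<Omega> F I"
  then obtain J B K C where a: "a = {\<omega>\<in>\<Omega>. \<forall>j\<in>J. F j \<omega> \<in> B j}" "finite J" "J \<subseteq> I" "\<And>j. B j \<in> sets borel"
    and b: "b = {\<omega>\<in>\<Omega>. \<forall>j\<in>K. F j \<omega> \<in> C j}" "finite K" "K \<subseteq> I" "\<And>j. C j \<in> sets borel"
    unfolding cylinders_def by blast
  have "a \<inter> b = {\<omega>\<in>\<Omega>. \<forall>j\<in>J \<union> K. F j \<omega> \<in> (if j \<in> J then B j else UNIV) \<inter> (if j \<in> K then C j else UNIV)}"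
    unfolding a(1) b(1) by auto
  thus "a \<inter> b \<in> cylinders \<Omega> F I"
    unfolding cylinders_def mem_Collect_eq
    by (intro exI[of _ "J \<union> K"] exI[of _ "\<lambda>j. (if j \<in> J then B j else UNIV) \<inter> (if j \<in> K then C j else UNIV)"])
       (use a b in auto)
qed

lemma coordinate_measurable_cylinders:
  assumes "j \<in> I" shows "F j \<in> borel_measurable (sigma \<Omega> (cylinders \<Omega> F I))"
proof (rule measurableI)
  fix B :: "real set" assume B: "B \<in> sets borel"
  have sub: "cylinders \<Omega> F I \<subseteq> Pow \<Omega>" by (auto simp: cylinders_def)
  have "F j -` B \<inter> \<Omega> \<in> cylinders \<Omega> F I"
    unfolding cylinders_def mem_Collect_eq
    by (intro exI[of _ "{j}"] exI[of _ "\<lambda>_. B"]) (use assms B in auto)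
  thus "F j -` B \<inter> space (sigma \<Omega> (cylinders \<Omega> F I)) \<in> sets (sigma \<Omega> (cylinders \<Omega> F I))"
    using sub by (simp add: space_measure_of sets_measure_of)
qed simp

text \<open>Independence of increments is available along one monotone sequence of times. This grid
  passes through all times of a past and of a future cylinder, with \<open>T\<close> at index
  \<open>p\<close> as the point of separation and 0 as the start.\<close>

lemma refine_times:
  fixes J K :: "real set"
  assumes J: "finite J" "J \<subseteq> {0..T}" and K: "finite K" "K \<subseteq> {T..}" and T: "0 \<le> T"
  obtains \<tau> :: "nat \<Rightarrow> real" and p n where "mono \<tau>" "p \<le> n" "\<tau> 0 = 0" "\<tau> p = T"
    "\<And>j. j \<in> J \<Longrightarrow> \<exists>i\<le>p. \<tau> i = j" "\<And>k. k \<in> K \<Longrightarrow> \<exists>i. p \<le> i \<and> i \<le> n \<and> \<tau> i = k"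
proof -
  define S where "S = insert 0 (insert T (J \<union> K))"
  have fS: "finite S" using J K by (simp add: S_def)
  define l where "l = sorted_list_of_set S"
  have sl: "set l = S" "sorted l" using fS by (auto simp: l_def)
  have ne: "length l > 0" using sl(1) by (auto simp: S_def)
  define n where "n = length l - 1"
  \<comment> \<open>The minimum keeps the sequence constant after the last grid point, so that it is
    monotone on all natural numbers.\<close>
  define \<tau> where "\<tau> i = l ! min i n" for i
  have mono: "mono \<tau>"
    unfolding \<tau>_def mono_def using ne by (auto intro!: sorted_nth_mono[OF sl(2)] min.strict_coboundedI2 simp: n_def)
  have ex: "\<exists>i\<le>n. \<tau> i = s" if s: "s \<in> S" for s
  proof -
    obtain i where "i < length l" "l ! i = s" using s sl(1) by (metis in_set_conv_nth)
    thus ?thesis by (intro exI[of _ i]) (auto simp: \<tau>_def n_def)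
  qed
  obtain p where p: "p \<le> n" "\<tau> p = T" using ex[of T] by (auto simp: S_def)
  have "\<tau> 0 \<in> S" using sl(1) ne by (auto simp: \<tau>_def)
  hence "\<tau> 0 \<ge> 0" using J K T by (auto simp: S_def)
  moreover obtain i where "\<tau> i = 0" using ex[of 0] by (auto simp: S_def)
  hence "\<tau> 0 \<le> 0" using monoD[OF mono, of 0 i] by simp
  ultimately have 0: "\<tau> 0 = 0" by simp
  show thesis
  proof (rule that[OF mono p(1) 0 p(2)])
    fix j assume j: "j \<in> J"
    obtain i where i: "i \<le> n" "\<tau> i = j" using ex[of j] j by (auto simp: S_def)
    show "\<exists>i\<le>p. \<tau> i = j"
    proof (cases "i \<le> p")
      case False
      hence "\<tau> p \<le> \<tau> i" by (intro monoD[OF mono]) auto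
      hence "j = T" using i p j J(2) by force
      thus ?thesis using p by auto
    qed (use i in auto)
  next
    fix k assume k: "k \<in> K"
    obtain i where i: "i \<le> n" "\<tau> i = k" using ex[of k] k by (auto simp: S_def)
    show "\<exists>i. p \<le> i \<and> i \<le> n \<and> \<tau> i = k"
    proof (cases "p \<le> i")
      case False
      hence "\<tau> i \<le> \<tau> p" by (intro monoD[OF mono]) auto
      hence "k = T" using i p k K(2) by force
      thus ?thesis using p by auto
    qed (use i in auto)
  qed
qed

section \<open>Path space with independent increments\<close>

locale levy_path_space =
  fixes P :: "(real \<Rightarrow> real) measure"
  assumes space_P: "space P = cadlag_paths" and sets_P: "sets P = sets path_space"
    and levy: "two_sided_levy_process P (\<lambda>t \<omega>. \<omega> t)"
begin

sublocale prob_space P using levy by (simp add: two_sided_levy_process_def)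

lemma eval_meas: "(\<lambda>\<omega>. \<omega> t) \<in> borel_measurable P"
  using measurable_path_eval measurable_cong_sets[OF sets_P refl] by blast

lemma measurable_into_P:
  assumes "\<And>x. x \<in> space N \<Longrightarrow> f x \<in> cadlag_paths" "\<And>t. (\<lambda>x. f x t) \<in> borel_measurable N"
  shows "f \<in> N \<rightarrow>\<^sub>M P"
  using measurable_path_spaceI[OF assms] measurable_cong_sets[OF refl sets_P] by blast

lemma indep_increments:
  assumes "mono (\<tau> :: nat \<Rightarrow> real)"
  shows "indep_vars (\<lambda>_. borel) (\<lambda>i \<omega>. \<omega> (\<tau> (Suc i)) - \<omega> (\<tau> i)) {..<n}"
  using levy assms by (simp add: two_sided_levy_process_def)

text \<open>Along the common grid, values up to \<open>T\<close> are sums of increments with index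
  below \<open>p\<close>, since paths start at 0, and increments after \<open>T\<close> are sums of
  those from \<open>p\<close> on. Disjoint blocks of independent variables are independent.\<close>

lemma prob_past_future:
  assumes T: "0 \<le> T"
    and a: "a \<in> cylinders (space P) (\<lambda>s \<omega>. \<omega> s) {0..T}"
    and b: "b \<in> cylinders (space P) (\<lambda>s \<omega>. \<omega> (T + s) - \<omega> T) {0..t}"
  shows "prob (a \<inter> b) = prob a * prob b"
proof -
  obtain J B where J: "a = {\<omega>\<in>space P. \<forall>j\<in>J. \<omega> j \<in> B j}" "finite J" "J \<subseteq> {0..T}" and B[measurable]: "\<And>j. B j \<in> sets borel"
    using a unfolding cylinders_def by blast
  obtain K C where K: "b = {\<omega>\<in>space P. \<forall>k\<in>K. \<omega> (T + k) - \<omega> T \<in> C k}" "finite K" "K \<subseteq> {0..t}" and C[measurable]: "\<And>k. C k \<in> sets borel"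
    using b unfolding cylinders_def by blast
  obtain \<tau> :: "nat \<Rightarrow> real" and p n where \<tau>: "mono \<tau>" "p \<le> n" "\<tau> 0 = 0" "\<tau> p = T"
    "\<And>j. j \<in> J \<Longrightarrow> \<exists>i\<le>p. \<tau> i = j" "\<And>k. k \<in> (\<lambda>k. T + k) ` K \<Longrightarrow> \<exists>i. p \<le> i \<and> i \<le> n \<and> \<tau> i = k"
  proof (rule refine_times[of J T "(\<lambda>k. T + k) ` K"])
    show "(\<lambda>k. T + k) ` K \<subseteq> {T..}" using K by auto
  qed (use J K T in auto)
  obtain r where r: "\<And>j. j \<in> J \<Longrightarrow> r j \<le> p \<and> \<tau> (r j) = j" using \<tau>(5) by metis
  have "\<forall>k\<in>K. \<exists>i. p \<le> i \<and> i \<le> n \<and> \<tau> i = T + k" using \<tau>(6) by auto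
  then obtain u where u: "\<And>k. k \<in> K \<Longrightarrow> p \<le> u k \<and> u k \<le> n \<and> \<tau> (u k) = T + k" by metis
  define X where "X i \<omega> = \<omega> (\<tau> (Suc i)) - \<omega> (\<tau> i)" for i and \<omega> :: "real \<Rightarrow> real"
  have ind: "indep_vars (\<lambda>_. borel) X {..<n}" unfolding X_def by (rule indep_increments[OF \<tau>(1)])
  have iv: "indep_var (Pi\<^sub>M {..<p} (\<lambda>_. borel)) (\<lambda>\<omega>. restrict (\<lambda>i. X i \<omega>) {..<p})
      (Pi\<^sub>M {p..<n} (\<lambda>_. borel)) (\<lambda>\<omega>. restrict (\<lambda>i. X i \<omega>) {p..<n})"
    by (rule indep_var_restrict[OF ind]) (use \<tau>(2) in auto)
  define A1 where "A1 = {v\<in>space (Pi\<^sub>M {..<p} (\<lambda>_. borel :: real measure)). \<forall>j\<in>J. (\<Sum>m<r j. v m) \<in> B j}"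
  define A2 where "A2 = {v\<in>space (Pi\<^sub>M {p..<n} (\<lambda>_. borel :: real measure)). \<forall>k\<in>K. (\<Sum>m=p..<u k. v m) \<in> C k}"
  have A1: "A1 \<in> sets (Pi\<^sub>M {..<p} (\<lambda>_. borel))" unfolding A1_def
  proof (rule sets.sets_Collect_finite_All)
    fix j assume "j \<in> J"
    hence [measurable]: "(\<lambda>v. \<Sum>m<r j. v m) \<in> borel_measurable (Pi\<^sub>M {..<p} (\<lambda>_. borel :: real measure))"
      using r[of j] by (intro borel_measurable_sum measurable_component_singleton) auto
    show "{v \<in> space (Pi\<^sub>M {..<p} (\<lambda>_. borel)). (\<Sum>m<r j. v m) \<in> B j} \<in> sets (Pi\<^sub>M {..<p} (\<lambda>_. borel))"
      by measurable
  qed (fact J)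
  have A2: "A2 \<in> sets (Pi\<^sub>M {p..<n} (\<lambda>_. borel))" unfolding A2_def
  proof (rule sets.sets_Collect_finite_All)
    fix k assume "k \<in> K"
    hence [measurable]: "(\<lambda>v. \<Sum>m=p..<u k. v m) \<in> borel_measurable (Pi\<^sub>M {p..<n} (\<lambda>_. borel :: real measure))"
      using u[of k] by (intro borel_measurable_sum measurable_component_singleton) auto
    show "{v \<in> space (Pi\<^sub>M {p..<n} (\<lambda>_. borel)). (\<Sum>m=p..<u k. v m) \<in> C k} \<in> sets (Pi\<^sub>M {p..<n} (\<lambda>_. borel))"
      by measurable
  qed (fact K)
  have a_eq: "a = (\<lambda>\<omega>. restrict (\<lambda>i. X i \<omega>) {..<p}) -` A1 \<inter> space P"
  proof -
    have "(\<Sum>m<r j. restrict (\<lambda>i. X i \<omega>) {..<p} m) = \<omega> j" if "\<omega> \<in> space P" "j \<in> J" for \<omega> j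
    proof -
      have "(\<Sum>m<r j. restrict (\<lambda>i. X i \<omega>) {..<p} m) = (\<Sum>m<r j. \<omega> (\<tau> (Suc m)) - \<omega> (\<tau> m))"
        using r[OF that(2)] by (intro sum.cong) (auto simp: X_def)
      also have "\<dots> = \<omega> j - \<omega> 0"
        using sum_lessThan_telescope[of "\<lambda>m. \<omega> (\<tau> m)" "r j"] r[OF that(2)] \<tau>(3) by simp
      finally show ?thesis using that(1) space_P by (simp add: cadlag_paths_def)
    qed
    thus ?thesis unfolding J(1) A1_def by (auto simp: space_PiM)
  qed
  have b_eq: "b = (\<lambda>\<omega>. restrict (\<lambda>i. X i \<omega>) {p..<n}) -` A2 \<inter> space P"
  proof -
    have "(\<Sum>m=p..<u k. restrict (\<lambda>i. X i \<omega>) {p..<n} m) = \<omega> (T + k) - \<omega> T" if "k \<in> K" for \<omega> k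
    proof -
      have "(\<Sum>m=p..<u k. restrict (\<lambda>i. X i \<omega>) {p..<n} m) = (\<Sum>m=p..<u k. \<omega> (\<tau> (Suc m)) - \<omega> (\<tau> m))"
        using u[OF that] by (intro sum.cong) (auto simp: X_def)
      also have "\<dots> = \<omega> (T + k) - \<omega> T"
        using sum_Suc_diff'[of p "u k" "\<lambda>m. \<omega> (\<tau> m)"] u[OF that] \<tau>(4) by simp
      finally show ?thesis .
    qed
    thus ?thesis unfolding K(1) A2_def by (auto simp: space_PiM)
  qed
  have "(\<lambda>\<omega>. (restrict (\<lambda>i. X i \<omega>) {..<p}, restrict (\<lambda>i. X i \<omega>) {p..<n})) -` (A1 \<times> A2) \<inter> space P = a \<inter> b"
    unfolding a_eq b_eq by auto
  thus ?thesis using indep_varD[OF iv A1 A2] unfolding a_eq[symmetric] b_eq[symmetric] by simp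
qed

lemma wiener_shift_in:
  assumes "wiener_shift T \<in> P \<rightarrow>\<^sub>M P" "\<omega> \<in> cadlag_paths"
  shows "wiener_shift T \<omega> \<in> cadlag_paths"
  using measurable_space[OF assms(1)] assms(2) space_P by auto

text \<open>Independence passes from the intersection-stable cylinders to the \<sigma>-algebras they
  generate, and each of the two path-valued maps is measurable for its own one. The hypothesis
  \<open>sh\<close> ensures that shifted paths are again cadlag and start at 0.\<close>

theorem past_indep_future:
  assumes T: "0 \<le> T" and t: "0 \<le> t" and sh: "wiener_shift T \<in> P \<rightarrow>\<^sub>M P"
  shows "indep_var P (stop T) P (\<lambda>\<omega>. stop t (wiener_shift T \<omega>))"
proof -
  define G1 where "G1 = cylinders (space P) (\<lambda>s \<omega>. \<omega> s) {0..T}"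
  define G2 where "G2 = cylinders (space P) (\<lambda>s \<omega>. \<omega> (T + s) - \<omega> T) {0..t}"
  have sub: "G1 \<subseteq> Pow (space P)" "G2 \<subseteq> Pow (space P)" by (auto simp: G1_def G2_def cylinders_def)
  have ev: "cylinders (space P) F I \<subseteq> events" if [measurable]: "\<And>s. F s \<in> borel_measurable P" for F :: "real \<Rightarrow> (real \<Rightarrow> real) \<Rightarrow> real" and I
  proof
    fix a assume "a \<in> cylinders (space P) F I"
    then obtain J B where J: "a = {\<omega>\<in>space P. \<forall>j\<in>J. F j \<omega> \<in> B j}" "finite J" and [measurable]: "\<And>j. B j \<in> sets borel"
      unfolding cylinders_def by blast
    show "a \<in> events" unfolding J(1)
      by (rule sets.sets_Collect_finite_All[OF _ J(2)]) measurable
  qed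
  have ev1: "G1 \<subseteq> events" unfolding G1_def by (rule ev) (rule eval_meas)
  have ev2: "G2 \<subseteq> events" unfolding G2_def by (rule ev) (intro borel_measurable_diff eval_meas)
  have "indep_set G1 G2"
    by (rule indep_setI[OF ev1 ev2]) (auto simp: G1_def G2_def intro: prob_past_future[OF T])
  hence ind: "indep_set (sigma_sets (space P) G1) (sigma_sets (space P) G2)"
    by (rule indep_set_sigma_sets) (simp_all add: G1_def G2_def Int_stable_cylinders)
  have X1: "stop T \<in> sigma (space P) G1 \<rightarrow>\<^sub>M P"
  proof (rule measurable_into_P)
    show "stop T x \<in> cadlag_paths" if "x \<in> space (sigma (space P) G1)" for x
      using that sub space_P stop_in_cadlag_paths[OF _ T] by (simp add: space_measure_of)
    show "(\<lambda>x. stop T x s) \<in> borel_measurable (sigma (space P) G1)" for s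
      unfolding stop_def G1_def
      by (rule coordinate_measurable_cylinders[where F="\<lambda>s \<omega>. \<omega> s" and j="max 0 (min s T)"]) (use T in auto)
  qed
  have X2: "(\<lambda>\<omega>. stop t (wiener_shift T \<omega>)) \<in> sigma (space P) G2 \<rightarrow>\<^sub>M P"
  proof (rule measurable_into_P)
    show "stop t (wiener_shift T x) \<in> cadlag_paths" if "x \<in> space (sigma (space P) G2)" for x
      using that sub space_P stop_in_cadlag_paths[OF wiener_shift_in[OF sh] t] by (simp add: space_measure_of)
    show "(\<lambda>x. stop t (wiener_shift T x) s) \<in> borel_measurable (sigma (space P) G2)" for s
      unfolding stop_def G2_def wiener_shift_def
      by (rule coordinate_measurable_cylinders[where F="\<lambda>s \<omega>. \<omega> (T + s) - \<omega> T" and j="max 0 (min s t)"]) (use t in auto)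
  qed
  have incl: "sigma_sets (space P) {X -` A \<inter> space P | A. A \<in> sets P} \<subseteq> sigma_sets (space P) G"
    if X: "X \<in> sigma (space P) G \<rightarrow>\<^sub>M P" and G: "G \<subseteq> Pow (space P)" for X G
  proof (rule sigma_sets_mono)
    show "{X -` A \<inter> space P | A. A \<in> sets P} \<subseteq> sigma_sets (space P) G"
      using measurable_sets[OF X] G by (auto simp: space_measure_of sets_measure_of)
  qed
  have rv: "X \<in> P \<rightarrow>\<^sub>M P" if X: "X \<in> sigma (space P) G \<rightarrow>\<^sub>M P" and G: "G \<subseteq> events" for X G
  proof -
    have "G \<subseteq> Pow (space P)" using G sets.space_closed by blast
    hence "sets (sigma (space P) G) \<subseteq> sets P" "space (sigma (space P) G) = space P"
      using G by (auto simp: space_measure_of sets_measure_of intro: sets.sigma_sets_subset[THEN subsetD])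
    thus ?thesis using X by (auto simp: measurable_def)
  qed
  show ?thesis unfolding indep_var_eq
  proof (intro conjI)
    show "indep_set (sigma_sets (space P) {stop T -` A \<inter> space P |A. A \<in> sets P})
      (sigma_sets (space P) {(\<lambda>\<omega>. stop t (wiener_shift T \<omega>)) -` A \<inter> space P |A. A \<in> sets P})"
      using ind unfolding indep_set_def
      by (rule indep_sets_mono_sets) (use incl[OF X1 sub(1)] incl[OF X2 sub(2)] in \<open>auto split: bool.split\<close>)
  qed (use rv[OF X1 ev1] rv[OF X2 ev2] in auto)
qed

end

section \<open>The flow of the equation\<close>

locale sde_rds = levy_path_space P for P +
  fixes \<beta> \<sigma> :: real and \<phi> :: "(real \<Rightarrow> real) cocycle"
  assumes generated: "rds_generated_by_sde P \<beta> \<sigma> \<phi>"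
begin

abbreviation \<theta> :: "real \<Rightarrow> (real \<Rightarrow> real) \<Rightarrow> (real \<Rightarrow> real)" where "\<theta> \<equiv> wiener_shift"

lemma
  shows rds: "random_dynamical_system P \<theta> \<phi>"
    and sol: "\<And>\<omega> x. \<omega> \<in> space P \<Longrightarrow> solves_sde \<beta> \<sigma> \<omega> x (\<lambda>t. \<phi> t \<omega> x)"
  using generated by (auto simp: rds_generated_by_sde_def)

lemma
  shows shift_meas[measurable]: "\<theta> t \<in> P \<rightarrow>\<^sub>M P"
    and shift_distr: "distr P P (\<theta> t) = P"
    and phi_0: "\<omega> \<in> space P \<Longrightarrow> \<phi> 0 \<omega> x = x"
    and cocycle: "s \<ge> 0 \<Longrightarrow> t \<ge> 0 \<Longrightarrow> \<omega> \<in> space P \<Longrightarrow> \<phi> (t + s) \<omega> x = \<phi> t (\<theta> s \<omega>) (\<phi> s \<omega> x)"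
proof -
  have m: "(\<lambda>(t, \<omega>). \<theta> t \<omega>) \<in> borel \<Otimes>\<^sub>M P \<rightarrow>\<^sub>M P"
    using rds by (simp add: random_dynamical_system_def metric_dynamical_system_def)
  show "\<theta> t \<in> P \<rightarrow>\<^sub>M P" using measurable_Pair2[OF m, of t] by simp
  show "distr P P (\<theta> t) = P" "\<omega> \<in> space P \<Longrightarrow> \<phi> 0 \<omega> x = x"
    "s \<ge> 0 \<Longrightarrow> t \<ge> 0 \<Longrightarrow> \<omega> \<in> space P \<Longrightarrow> \<phi> (t + s) \<omega> x = \<phi> t (\<theta> s \<omega>) (\<phi> s \<omega> x)"
    using rds by (simp_all add: random_dynamical_system_def metric_dynamical_system_def)
qed

text \<open>\<open>\<phi>\<close> is arbitrary, possibly not measurable, at negative times; clipping makes it jointly measurable.\<close>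

definition \<psi> :: "real \<Rightarrow> (real \<Rightarrow> real) \<Rightarrow> real \<Rightarrow> real" where "\<psi> t = \<phi> (max 0 t)"

lemma psi_eq: "t \<ge> 0 \<Longrightarrow> \<psi> t = \<phi> t" by (simp add: \<psi>_def max_def)

lemma psi_joint_meas: "(\<lambda>(t, \<omega>, x). \<psi> t \<omega> x) \<in> borel_measurable (borel \<Otimes>\<^sub>M P \<Otimes>\<^sub>M borel)"
proof -
  have 1: "(\<lambda>(t, \<omega>, x). \<phi> t \<omega> x) \<in> borel_measurable (restrict_space borel {0..} \<Otimes>\<^sub>M P \<Otimes>\<^sub>M borel)"
    using rds by (simp add: random_dynamical_system_def)
  have "(\<lambda>t. max 0 t) \<in> borel \<rightarrow>\<^sub>M restrict_space borel {0::real..}"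
    by (rule measurable_restrict_space2) auto
  hence "(\<lambda>z. (max 0 (fst z), snd z)) \<in> borel \<Otimes>\<^sub>M P \<Otimes>\<^sub>M borel \<rightarrow>\<^sub>M restrict_space borel {0::real..} \<Otimes>\<^sub>M P \<Otimes>\<^sub>M borel"
    by (intro measurable_Pair measurable_compose[OF measurable_fst] measurable_snd)
  from measurable_compose[OF this 1] show ?thesis by (simp add: case_prod_unfold \<psi>_def)
qed

lemma psi_meas:
  assumes "f \<in> borel_measurable N" "g \<in> N \<rightarrow>\<^sub>M P" "h \<in> borel_measurable N"
  shows "(\<lambda>z. \<psi> (f z) (g z) (h z)) \<in> borel_measurable N"
  using measurable_compose[OF measurable_Pair[OF assms(1) measurable_Pair[OF assms(2,3)]] psi_joint_meas] by simp

lemma phi_meas[measurable]: "t \<ge> 0 \<Longrightarrow> (\<lambda>\<omega>. \<phi> t \<omega> x) \<in> borel_measurable P"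
  unfolding psi_eq[symmetric] by (intro psi_meas) measurable

lemma
  assumes w: "\<omega> \<in> space P"
  shows psi_meas_time: "(\<lambda>t. \<psi> t \<omega> x) \<in> borel_measurable borel"
    and psi_0: "\<psi> 0 \<omega> x = x"
    and psi_int: "t \<ge> 0 \<Longrightarrow> set_integrable lborel {0..t} (\<lambda>s. \<beta> * \<psi> s \<omega> x - \<psi> s \<omega> x ^ 3)"
    and psi_sol: "t \<ge> 0 \<Longrightarrow> \<psi> t \<omega> x = x + (LBINT s:{0..t}. \<beta> * \<psi> s \<omega> x - \<psi> s \<omega> x ^ 3) + \<sigma> * \<omega> t"
proof -
  show "(\<lambda>t. \<psi> t \<omega> x) \<in> borel_measurable borel" using w by (intro psi_meas) auto
  show "\<psi> 0 \<omega> x = x" using phi_0[OF w] by (simp add: psi_eq)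
  assume t: "t \<ge> 0"
  have *: "set_integrable lborel {0..t} (\<lambda>s. \<beta> * \<phi> s \<omega> x - \<phi> s \<omega> x ^ 3)"
    "\<phi> t \<omega> x = x + (LBINT s:{0..t}. \<beta> * \<phi> s \<omega> x - \<phi> s \<omega> x ^ 3) + \<sigma> * \<omega> t"
    using sol[OF w, of x] t by (auto simp: solves_sde_def)
  show "set_integrable lborel {0..t} (\<lambda>s. \<beta> * \<psi> s \<omega> x - \<psi> s \<omega> x ^ 3)"
    using *(1) by (subst set_integrable_cong[OF refl refl]) (auto simp: psi_eq)
  have "(LBINT s:{0..t}. \<beta> * \<psi> s \<omega> x - \<psi> s \<omega> x ^ 3) = (LBINT s:{0..t}. \<beta> * \<phi> s \<omega> x - \<phi> s \<omega> x ^ 3)"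
    by (rule set_lebesgue_integral_cong) (auto simp: psi_eq)
  thus "\<psi> t \<omega> x = x + (LBINT s:{0..t}. \<beta> * \<psi> s \<omega> x - \<psi> s \<omega> x ^ 3) + \<sigma> * \<omega> t"
    using *(2) t by (simp add: psi_eq)
qed

text \<open>Used in two ways: with one path and two starting points it compares trajectories of the
  flow; with one starting point and two paths that agree on [0, t] it shows that the flow at time
  \<open>t\<close> sees nothing of the noise beyond that interval.\<close>

lemma cubic_pair_psi:
  assumes w: "\<omega> \<in> space P" "\<omega>' \<in> space P" and t: "0 \<le> t" and eq: "\<And>s. s \<in> {0..t} \<Longrightarrow> \<omega> s = \<omega>' s"
  shows "cubic_pair t \<beta> (\<lambda>s. \<psi> s \<omega> x) (\<lambda>s. \<psi> s \<omega>' y)"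
proof (unfold_locales, goal_cases)
  \<comment> \<open>The sixth goal is the difference equation; \<open>eq\<close> cancels the two
    noise terms.\<close>
  case (6 s)
  have s: "set_integrable lborel {0..s} (\<lambda>s. \<beta> * \<psi> s \<omega> x - \<psi> s \<omega> x ^ 3)"
    "set_integrable lborel {0..s} (\<lambda>s. \<beta> * \<psi> s \<omega>' y - \<psi> s \<omega>' y ^ 3)"
    using psi_int[OF w(1)] psi_int[OF w(2)] 6 by auto
  show ?case unfolding set_integral_diff(2)[OF s]
    using psi_sol[OF w(1), of s x] psi_sol[OF w(2), of s y] eq[OF 6] 6 psi_0[OF w(1)] psi_0[OF w(2)] by simp
qed (use t w psi_meas_time psi_int in auto)

lemma phi_cong:
  assumes w: "\<omega> \<in> space P" "\<omega>' \<in> space P" and t: "0 \<le> t" and eq: "\<And>s. s \<in> {0..t} \<Longrightarrow> \<omega> s = \<omega>' s"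
  shows "\<phi> t \<omega> x = \<phi> t \<omega>' x"
proof -
  interpret cubic_pair t \<beta> "\<lambda>s. \<psi> s \<omega> x" "\<lambda>s. \<psi> s \<omega>' x" by (rule cubic_pair_psi) (use assms in auto)
  have "D 0 = 0" using psi_0[OF w(1)] psi_0[OF w(2)] by (simp add: D_def)
  hence "D t = 0" by (rule D_zero)
  thus ?thesis using t by (simp add: D_def psi_eq)
qed

lemma stop_in_space: "\<omega> \<in> space P \<Longrightarrow> 0 \<le> t \<Longrightarrow> stop t \<omega> \<in> space P"
  using stop_in_cadlag_paths by (simp add: space_P)

lemma phi_stop:
  assumes "\<omega> \<in> space P" "0 \<le> t"
  shows "\<phi> t (stop t \<omega>) x = \<phi> t \<omega> x"
  by (rule phi_cong) (use assms stop_in_space in \<open>auto simp: stop_def\<close>)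

lemma psi_diff:
  assumes w: "\<omega> \<in> space P" and t: "0 \<le> t"
  shows "\<psi> t \<omega> x - \<psi> t \<omega> y
    = (x - y) * exp (LBINT s:{0..t}. \<beta> - ((\<psi> s \<omega> x)\<^sup>2 + \<psi> s \<omega> x * \<psi> s \<omega> y + (\<psi> s \<omega> y)\<^sup>2))"
proof -
  interpret cubic_pair t \<beta> "\<lambda>s. \<psi> s \<omega> x" "\<lambda>s. \<psi> s \<omega> y" by (rule cubic_pair_psi) (use assms in auto)
  show ?thesis using exp_formula psi_0[OF w] unfolding D_def q_def by simp
qed

lemma psi_strict_mono:
  assumes w: "\<omega> \<in> space P"
  shows "strict_mono (\<psi> t \<omega>)"
proof -
  have "strict_mono (\<psi> t \<omega>)" if t: "0 \<le> t" for t
  proof (rule strict_monoI)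
    fix x y :: real assume xy: "x < y"
    have "\<psi> t \<omega> y - \<psi> t \<omega> x > 0" unfolding psi_diff[OF w t, of y x] using xy by simp
    thus "\<psi> t \<omega> x < \<psi> t \<omega> y" by simp
  qed
  from this[of "max 0 t"] show ?thesis by (simp add: \<psi>_def)
qed

lemma psi_lipschitz:
  assumes w: "\<omega> \<in> space P" and t: "0 \<le> t"
  shows "\<bar>\<psi> t \<omega> x - \<psi> t \<omega> y\<bar> \<le> \<bar>x - y\<bar> * exp (\<bar>\<beta>\<bar> * t)"
proof -
  interpret cubic_pair t \<beta> "\<lambda>s. \<psi> s \<omega> x" "\<lambda>s. \<psi> s \<omega> y" by (rule cubic_pair_psi) (use assms in auto)
  have "(LBINT s:{0..t}. q s) \<le> (LBINT s:{0..t}. \<bar>\<beta>\<bar>)"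
    by (rule set_integral_mono[OF q_int set_integrable_const_Icc]) (use q_le in \<open>auto intro: order_trans[OF q_le abs_ge_self]\<close>)
  also have "\<dots> = \<bar>\<beta>\<bar> * t" using t by (simp add: set_lebesgue_integral_def)
  finally have "exp (LBINT s:{0..t}. q s) \<le> exp (\<bar>\<beta>\<bar> * t)" by simp
  thus ?thesis using exp_formula psi_0[OF w] unfolding D_def by (simp add: abs_mult mult_left_mono)
qed

lemma psi_cont:
  assumes w: "\<omega> \<in> space P"
  shows "isCont (\<psi> t \<omega>) x"
proof -
  have "(exp (\<bar>\<beta>\<bar> * max 0 t))-lipschitz_on UNIV (\<psi> (max 0 t) \<omega>)"
    using psi_lipschitz[OF w, of "max 0 t"] by (auto simp: lipschitz_on_def dist_real_def mult.commute)
  from lipschitz_on_continuous_on[OF this] show ?thesis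
    by (simp add: continuous_on_eq_continuous_at \<psi>_def)
qed

text \<open>By \<open>psi_diff\<close> the difference quotient equals \<open>exp (I y)\<close>
  exactly, so differentiability reduces to continuity of \<open>I\<close> at
  \<open>x\<close>.\<close>

lemma psi_deriv:
  assumes w: "\<omega> \<in> space P" and t: "0 \<le> t"
  shows "(\<psi> t \<omega> has_real_derivative exp (LBINT s:{0..t}. \<beta> - 3 * (\<psi> s \<omega> x)\<^sup>2)) (at x)"
proof -
  define I where "I y = (LBINT s:{0..t}. \<beta> - ((\<psi> s \<omega> y)\<^sup>2 + \<psi> s \<omega> y * \<psi> s \<omega> x + (\<psi> s \<omega> x)\<^sup>2))" for y
  define L where "L = exp (\<bar>\<beta>\<bar> * t)"
  have m[measurable]: "(\<lambda>s. \<psi> s \<omega> y) \<in> borel_measurable borel" for y by (rule psi_meas_time[OF w])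
  have sq: "set_integrable lborel {0..t} (\<lambda>s. (\<psi> s \<omega> y)\<^sup>2)" for y
    by (rule set_integrable_square_of_cubic[OF m psi_int[OF w t]])
  have ab: "set_integrable lborel {0..t} (\<lambda>s. 3 * \<bar>\<psi> s \<omega> x\<bar>)"
  proof (rule set_integrable_bound)
    show "set_integrable lborel {0..t} (\<lambda>s. 3 * ((\<psi> s \<omega> x)\<^sup>2 + 1))"
      by (intro set_integrable_mult_right set_integral_add(1) sq set_integrable_const_Icc)
    show "set_borel_measurable lborel {0..t} (\<lambda>s. 3 * \<bar>\<psi> s \<omega> x\<bar>)"
      unfolding set_borel_measurable_def by measurable
    show "AE s in lborel. s \<in> {0..t} \<longrightarrow> norm (3 * \<bar>\<psi> s \<omega> x\<bar>) \<le> norm (3 * ((\<psi> s \<omega> x)\<^sup>2 + 1))"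
    proof (intro AE_I2 impI)
      fix s
      show "norm (3 * \<bar>\<psi> s \<omega> x\<bar>) \<le> norm (3 * ((\<psi> s \<omega> x)\<^sup>2 + 1))"
        using abs_mult_le_half_squares[of "\<psi> s \<omega> x" 1] zero_le_power2[of "\<psi> s \<omega> x"] by simp
    qed
  qed
  have qi: "set_integrable lborel {0..t} (\<lambda>s. \<beta> - ((\<psi> s \<omega> y)\<^sup>2 + \<psi> s \<omega> y * \<psi> s \<omega> x + (\<psi> s \<omega> x)\<^sup>2))" for y
  proof -
    interpret cubic_pair t \<beta> "\<lambda>s. \<psi> s \<omega> y" "\<lambda>s. \<psi> s \<omega> x" by (rule cubic_pair_psi) (use assms in auto)
    show ?thesis using q_int unfolding q_def .
  qed
  have Ibound: "\<bar>I y - I x\<bar> \<le> (\<bar>y - x\<bar> * L) * ((LBINT s:{0..t}. 3 * \<bar>\<psi> s \<omega> x\<bar>) + t * (\<bar>y - x\<bar> * L))" for y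
  proof -
    define \<eta> where "\<eta> = \<bar>y - x\<bar> * L"
    have \<eta>0: "0 \<le> \<eta>" by (simp add: \<eta>_def L_def)
    have d: "\<bar>\<psi> s \<omega> y - \<psi> s \<omega> x\<bar> \<le> \<eta>" if "s \<in> {0..t}" for s
    proof -
      have "\<bar>\<psi> s \<omega> y - \<psi> s \<omega> x\<bar> \<le> \<bar>y - x\<bar> * exp (\<bar>\<beta>\<bar> * s)" using psi_lipschitz[OF w] that by simp
      also have "\<dots> \<le> \<eta>" unfolding \<eta>_def L_def using that by (intro mult_left_mono) (auto intro: mult_left_mono)
      finally show ?thesis .
    qed
    \<comment> \<open>With u the displacement of the solution and v the reference solution, the
      change of the rate is - u (u + 3 v). It is small with \<eta> because v is integrable in
      time.\<close>
    have e: "(\<beta> - ((\<psi> s \<omega> y)\<^sup>2 + \<psi> s \<omega> y * \<psi> s \<omega> x + (\<psi> s \<omega> x)\<^sup>2))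
        - (\<beta> - ((\<psi> s \<omega> x)\<^sup>2 + \<psi> s \<omega> x * \<psi> s \<omega> x + (\<psi> s \<omega> x)\<^sup>2))
        = - ((\<psi> s \<omega> y - \<psi> s \<omega> x) * (\<psi> s \<omega> y - \<psi> s \<omega> x + 3 * \<psi> s \<omega> x))" for s
      by (simp add: power2_eq_square algebra_simps)
    define u v where "u s = \<psi> s \<omega> y - \<psi> s \<omega> x" and "v s = \<psi> s \<omega> x" for s
    have du: "\<bar>u s\<bar> \<le> \<eta>" if "s \<in> {0..t}" for s using d[OF that] by (simp add: u_def)
    have "I y - I x = (LBINT s:{0..t}. (\<beta> - ((\<psi> s \<omega> y)\<^sup>2 + \<psi> s \<omega> y * \<psi> s \<omega> x + (\<psi> s \<omega> x)\<^sup>2))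
        - (\<beta> - ((\<psi> s \<omega> x)\<^sup>2 + \<psi> s \<omega> x * \<psi> s \<omega> x + (\<psi> s \<omega> x)\<^sup>2)))"
      unfolding I_def by (rule set_integral_diff(2)[OF qi qi, symmetric])
    hence eqI: "I y - I x = (LBINT s:{0..t}. - (u s * (u s + 3 * v s)))" by (simp only: e u_def v_def)
    have "set_integrable lborel {0..t} (\<lambda>s. (\<beta> - ((\<psi> s \<omega> y)\<^sup>2 + \<psi> s \<omega> y * \<psi> s \<omega> x + (\<psi> s \<omega> x)\<^sup>2))
        - (\<beta> - ((\<psi> s \<omega> x)\<^sup>2 + \<psi> s \<omega> x * \<psi> s \<omega> x + (\<psi> s \<omega> x)\<^sup>2)))"
      by (rule set_integral_diff(1)[OF qi qi])
    hence ui: "set_integrable lborel {0..t} (\<lambda>s. - (u s * (u s + 3 * v s)))" by (simp only: e u_def v_def)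
    have abv: "set_integrable lborel {0..t} (\<lambda>s. 3 * \<bar>v s\<bar>)" using ab by (simp only: v_def)
    have "\<bar>I y - I x\<bar> \<le> (LBINT s:{0..t}. \<bar>- (u s * (u s + 3 * v s))\<bar>)"
      unfolding eqI using set_integral_norm_bound[OF ui] unfolding real_norm_def .
    also have "\<dots> \<le> (LBINT s:{0..t}. \<eta> * (3 * \<bar>v s\<bar> + \<eta>))"
    proof (rule set_integral_mono[OF set_integrable_abs[OF ui]])
      show "set_integrable lborel {0..t} (\<lambda>s. \<eta> * (3 * \<bar>v s\<bar> + \<eta>))"
        by (intro set_integrable_mult_right set_integral_add(1) abv set_integrable_const_Icc)
      fix s assume s: "s \<in> {0..t}"
      have "\<bar>u s + 3 * v s\<bar> \<le> 3 * \<bar>v s\<bar> + \<eta>"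
        using abs_triangle_ineq[of "u s" "3 * v s"] du[OF s] unfolding abs_mult by simp
      hence "\<bar>u s\<bar> * \<bar>u s + 3 * v s\<bar> \<le> \<eta> * (3 * \<bar>v s\<bar> + \<eta>)"
        by (rule mult_mono[OF du[OF s] _ \<eta>0 abs_ge_zero])
      thus "\<bar>- (u s * (u s + 3 * v s))\<bar> \<le> \<eta> * (3 * \<bar>v s\<bar> + \<eta>)" by (simp only: abs_minus_cancel abs_mult)
    qed
    also have "\<dots> = \<eta> * (LBINT s:{0..t}. 3 * \<bar>v s\<bar> + \<eta>)" by (rule set_integral_mult_right)
    also have "(LBINT s:{0..t}. 3 * \<bar>v s\<bar> + \<eta>) = (LBINT s:{0..t}. 3 * \<bar>v s\<bar>) + (LBINT s:{0..t}. \<eta>)"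
      by (rule set_integral_add(2)[OF abv set_integrable_const_Icc])
    also have "(LBINT s:{0..t}. \<eta>) = t * \<eta>" using t by (simp add: set_lebesgue_integral_def)
    finally show ?thesis unfolding \<eta>_def v_def .
  qed
  have "(I \<longlongrightarrow> I x) (at x)"
  proof (rule LIM_zero_cancel, rule Lim_null_comparison)
    show "\<forall>\<^sub>F y in at x. norm (I y - I x) \<le> (\<bar>y - x\<bar> * L) * ((LBINT s:{0..t}. 3 * \<bar>\<psi> s \<omega> x\<bar>) + t * (\<bar>y - x\<bar> * L))"
      using Ibound by simp
    have "((\<lambda>y. (\<bar>y - x\<bar> * L) * ((LBINT s:{0..t}. 3 * \<bar>\<psi> s \<omega> x\<bar>) + t * (\<bar>y - x\<bar> * L)))
      \<longlongrightarrow> (\<bar>x - x\<bar> * L) * ((LBINT s:{0..t}. 3 * \<bar>\<psi> s \<omega> x\<bar>) + t * (\<bar>x - x\<bar> * L))) (at x)"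
      by (intro tendsto_intros)
    thus "((\<lambda>y. (\<bar>y - x\<bar> * L) * ((LBINT s:{0..t}. 3 * \<bar>\<psi> s \<omega> x\<bar>) + t * (\<bar>y - x\<bar> * L))) \<longlongrightarrow> 0) (at x)" by simp
  qed
  hence "((\<lambda>y. exp (I y)) \<longlongrightarrow> exp (I x)) (at x)" by (rule tendsto_exp)
  moreover have "\<forall>\<^sub>F y in at x. exp (I y) = (\<psi> t \<omega> y - \<psi> t \<omega> x) / (y - x)"
    unfolding psi_diff[OF w t] I_def by (auto simp: eventually_at_filter)
  ultimately have "((\<lambda>y. (\<psi> t \<omega> y - \<psi> t \<omega> x) / (y - x)) \<longlongrightarrow> exp (I x)) (at x)"
    by (rule Lim_transform_eventually)
  moreover have "I x = (LBINT s:{0..t}. \<beta> - 3 * (\<psi> s \<omega> x)\<^sup>2)"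
    unfolding I_def by (simp add: power2_eq_square algebra_simps)
  ultimately show ?thesis by (simp add: has_field_derivative_iff)
qed

end

section \<open>Invariance of the law of the attractor\<close>

lemma bounded_complex_integrable:
  fixes f :: "'a \<Rightarrow> complex"
  assumes "finite_measure M" "f \<in> borel_measurable M" "\<And>x. norm (f x) \<le> 1"
  shows "integrable M f"
  using finite_measure.integrable_const_bound[OF assms(1) _ assms(2), of 1] assms(3) by simp

locale attracted_sde_rds = sde_rds P \<beta> \<sigma> \<phi> for P \<beta> \<sigma> \<phi> +
  fixes a :: "(real \<Rightarrow> real) \<Rightarrow> real"
  assumes attractor: "random_attractor P wiener_shift \<phi> (\<lambda>\<omega>. {a \<omega>})"
begin

lemma a_meas[measurable]: "a \<in> borel_measurable P"
proof -
  have *: "(\<lambda>\<omega>. dist x (a \<omega>)) \<in> borel_measurable P" for x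
    using attractor by (simp add: random_attractor_def)
  \<comment> \<open>Distances to the two points 0 and 1 determine a real number: a^2 - (1 - a)^2 + 1
    = 2 a.\<close>
  have "a = (\<lambda>\<omega>. ((dist 0 (a \<omega>))\<^sup>2 - (dist 1 (a \<omega>))\<^sup>2 + 1) / 2)"
    by (auto simp: dist_real_def power2_eq_square algebra_simps)
  also have "\<dots> \<in> borel_measurable P" using *[of 0] *[of 1] by measurable
  finally show ?thesis .
qed

lemma a_invariant: "t \<ge> 0 \<Longrightarrow> AE \<omega> in P. \<phi> t \<omega> (a \<omega>) = a (\<theta> t \<omega>)"
  using attractor by (simp add: random_attractor_def)

lemma pullback: "AE \<omega> in P. ((\<lambda>T. \<phi> T (\<theta> (- T) \<omega>) 0) \<longlongrightarrow> a \<omega>) at_top"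
proof -
  have "AE \<omega> in P. uniform_limit {0} (\<lambda>t x. infdist (\<phi> t (\<theta> (- t) \<omega>) x) {a \<omega>}) (\<lambda>_. 0) at_top"
    using attractor finite_imp_bounded[of "{0::real}"] unfolding random_attractor_def by blast
  thus ?thesis
  proof (rule AE_mp, intro AE_I2 impI)
    fix \<omega> assume u: "uniform_limit {0} (\<lambda>t x. infdist (\<phi> t (\<theta> (- t) \<omega>) x) {a \<omega>}) (\<lambda>_. 0) at_top"
    hence "((\<lambda>t. dist (\<phi> t (\<theta> (- t) \<omega>) 0) (a \<omega>)) \<longlongrightarrow> 0) at_top"
      using tendsto_uniform_limitI[OF u, of 0] by simp
    thus "((\<lambda>T. \<phi> T (\<theta> (- T) \<omega>) 0) \<longlongrightarrow> a \<omega>) at_top" by (rule tendsto_dist_iff[THEN iffD2])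
  qed
qed

text \<open>Attraction is given in the pullback sense. As the shift preserves \<open>P\<close>, the
  forward solution has at each time the same law as its pullback version, so almost sure pullback
  convergence becomes forward convergence in law. The offset \<open>t\<close> lets the lemma serve
  both sides of the Markov identity.\<close>

lemma forward_limit:
  fixes g :: "real \<Rightarrow> complex"
  assumes g: "\<And>x. isCont g x" and b: "\<And>x. norm (g x) \<le> 1" and t: "t \<ge> 0"
  shows "(\<lambda>n. \<integral>\<omega>. g (\<phi> (t + real n) \<omega> 0) \<partial>P) \<longlonglongrightarrow> (\<integral>\<omega>. g (a \<omega>) \<partial>P)"
proof -
  have gm[measurable]: "g \<in> borel_measurable borel"
    using g by (intro borel_measurable_continuous_onI) (simp add: continuous_at_imp_continuous_on)
  have pm[measurable]: "(\<lambda>\<omega>. \<phi> (t + real n) \<omega> 0) \<in> borel_measurable P" for n using t by (intro phi_meas) simp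
  have eq: "(\<integral>\<omega>. g (\<phi> (t + real n) \<omega> 0) \<partial>P) = (\<integral>\<omega>. g (\<phi> (t + real n) (\<theta> (- (t + real n)) \<omega>) 0) \<partial>P)" for n
  proof -
    have "(\<integral>\<omega>. g (\<phi> (t + real n) \<omega> 0) \<partial>P) = (\<integral>\<omega>. g (\<phi> (t + real n) \<omega> 0) \<partial>distr P P (\<theta> (- (t + real n))))"
      by (simp only: shift_distr)
    also have "\<dots> = (\<integral>\<omega>. g (\<phi> (t + real n) (\<theta> (- (t + real n)) \<omega>) 0) \<partial>P)"
      by (rule integral_distr) measurable
    finally show ?thesis .
  qed
  have lim: "filterlim (\<lambda>n. t + real n) at_top sequentially"
    by (intro filterlim_tendsto_add_at_top[OF tendsto_const] filterlim_real_sequentially)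
  show ?thesis unfolding eq
  proof (rule integral_dominated_convergence[where w="\<lambda>_. 1"])
    show "AE \<omega> in P. (\<lambda>n. g (\<phi> (t + real n) (\<theta> (- (t + real n)) \<omega>) 0)) \<longlonglongrightarrow> g (a \<omega>)"
      using pullback
    proof (rule AE_mp, intro AE_I2 impI)
      fix \<omega> assume "((\<lambda>T. \<phi> T (\<theta> (- T) \<omega>) 0) \<longlongrightarrow> a \<omega>) at_top"
      from isCont_tendsto_compose[OF g filterlim_compose[OF this lim]]
      show "(\<lambda>n. g (\<phi> (t + real n) (\<theta> (- (t + real n)) \<omega>) 0)) \<longlonglongrightarrow> g (a \<omega>)" .
    qed
    show "(\<lambda>\<omega>. g (\<phi> (t + real n) (\<theta> (- (t + real n)) \<omega>) 0)) \<in> borel_measurable P" for n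
      by (rule measurable_compose[OF shift_meas, of "\<lambda>\<omega>. g (\<phi> (t + real n) \<omega> 0)"]) measurable
  qed (use b in auto)
qed

lemma phi_joint_meas: "t \<ge> 0 \<Longrightarrow> (\<lambda>(\<omega>, x). \<phi> t \<omega> x) \<in> borel_measurable (P \<Otimes>\<^sub>M borel)"
  unfolding psi_eq[symmetric] case_prod_unfold by (intro psi_meas) auto

text \<open>Chapman-Kolmogorov. The cocycle property splits the evolution at \<open>T\<close>, and
  the two factors depend only on the noise before \<open>T\<close> and on the increments after it,
  which are independent.\<close>

lemma markov:
  fixes g :: "real \<Rightarrow> complex"
  assumes gm[measurable]: "g \<in> borel_measurable borel" and b: "\<And>x. norm (g x) \<le> 1" and t: "t \<ge> 0" and T: "T \<ge> 0"
  shows "(\<integral>\<omega>. g (\<phi> (t + T) \<omega> x) \<partial>P) = (\<integral>\<omega>. (\<integral>\<omega>'. g (\<phi> t \<omega>' (\<phi> T \<omega> x)) \<partial>P) \<partial>P)"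
proof -
  \<comment> \<open>Stopping replaces the full path by independent pieces without changing the flow,
    by \<open>phi_stop\<close>.\<close>
  define X where "X \<omega> = stop T \<omega>" for \<omega>
  define Y where "Y \<omega> = stop t (\<theta> T \<omega>)" for \<omega>
  have X_eq: "\<phi> T (X \<omega>) x = \<phi> T \<omega> x" if "\<omega> \<in> space P" for \<omega>
    unfolding X_def by (rule phi_stop[OF that T])
  have iv: "indep_var P X P Y"
    unfolding X_def[abs_def] Y_def[abs_def] using past_indep_future[OF T t shift_meas] .
  have Xm[measurable]: "X \<in> P \<rightarrow>\<^sub>M P" using indep_var_rv1[OF iv] .
  have Ym[measurable]: "Y \<in> P \<rightarrow>\<^sub>M P" using indep_var_rv2[OF iv] .
  have prod: "distr P P X \<Otimes>\<^sub>M distr P P Y = distr P (P \<Otimes>\<^sub>M P) (\<lambda>\<omega>. (X \<omega>, Y \<omega>))"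
    using iv by (simp add: indep_var_distribution_eq)
  interpret DX: prob_space "distr P P X" by (rule prob_space_distr) measurable
  interpret DY: prob_space "distr P P Y" by (rule prob_space_distr) measurable
  interpret XY: pair_prob_space "distr P P X" "distr P P Y" ..
  have gm2: "(\<lambda>(u, y). g (\<phi> t y u)) \<in> borel_measurable (borel \<Otimes>\<^sub>M P)"
    using measurable_compose[OF measurable_compose[OF measurable_pair_swap' phi_joint_meas[OF t]] gm] by (simp add: case_prod_unfold)
  have gm3: "(\<lambda>(\<omega>, y). g (\<phi> t y (\<phi> T \<omega> x))) \<in> borel_measurable (P \<Otimes>\<^sub>M P)"
    using measurable_compose[OF measurable_Pair[OF measurable_compose[OF measurable_fst phi_meas[OF T]] measurable_snd] gm2]
    by (simp add: case_prod_unfold)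
  have pmx: "(\<lambda>\<omega>. \<phi> t \<omega> u) \<in> borel_measurable P" for u by (rule phi_meas[OF t])
  define k where "k u = (\<integral>\<omega>'. g (\<phi> t \<omega>' u) \<partial>P)" for u
  have km: "k \<in> borel_measurable borel"
    unfolding k_def by (rule borel_measurable_lebesgue_integral[OF gm2])
  have "(\<integral>\<omega>. g (\<phi> (t + T) \<omega> x) \<partial>P) = (\<integral>\<omega>. g (\<phi> t (Y \<omega>) (\<phi> T (X \<omega>) x)) \<partial>P)"
  proof (rule Bochner_Integration.integral_cong[OF refl])
    fix \<omega> assume w: "\<omega> \<in> space P"
    have "\<phi> t (Y \<omega>) u = \<phi> t (\<theta> T \<omega>) u" for u
      unfolding Y_def by (rule phi_stop[OF measurable_space[OF shift_meas w] t])
    thus "g (\<phi> (t + T) \<omega> x) = g (\<phi> t (Y \<omega>) (\<phi> T (X \<omega>) x))" by (simp add: X_eq[OF w] cocycle[OF T t w])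
  qed
  also have "\<dots> = (\<integral>z. (case z of (\<omega>, y) \<Rightarrow> g (\<phi> t y (\<phi> T \<omega> x))) \<partial>distr P (P \<Otimes>\<^sub>M P) (\<lambda>\<omega>. (X \<omega>, Y \<omega>)))"
    by (subst integral_distr[OF _ gm3]) auto
  also have "\<dots> = (\<integral>z. (case z of (\<omega>, y) \<Rightarrow> g (\<phi> t y (\<phi> T \<omega> x))) \<partial>(distr P P X \<Otimes>\<^sub>M distr P P Y))"
    unfolding prod ..
  also have "\<dots> = (\<integral>\<omega>. \<integral>y. g (\<phi> t y (\<phi> T \<omega> x)) \<partial>distr P P Y \<partial>distr P P X)"
  proof (subst XY.integral_fst'[symmetric])
    show "integrable (distr P P X \<Otimes>\<^sub>M distr P P Y) (\<lambda>z. case z of (\<omega>, y) \<Rightarrow> g (\<phi> t y (\<phi> T \<omega> x)))"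
    proof (rule bounded_complex_integrable)
      show "(\<lambda>z. case z of (\<omega>, y) \<Rightarrow> g (\<phi> t y (\<phi> T \<omega> x))) \<in> borel_measurable (distr P P X \<Otimes>\<^sub>M distr P P Y)"
        using gm3 by (subst measurable_cong_sets[OF sets_pair_measure_cong[OF sets_distr sets_distr] refl])
    qed (use b XY.finite_measure_axioms in \<open>auto simp: case_prod_unfold\<close>)
  qed simp
  also have "\<dots> = (\<integral>\<omega>. k (\<phi> T \<omega> x) \<partial>distr P P X)"
  proof (rule Bochner_Integration.integral_cong[OF refl])
    fix \<omega>
    define u where "u = \<phi> T \<omega> x"
    have "(\<integral>y. g (\<phi> t y u) \<partial>distr P P Y) = (\<integral>\<omega>. g (\<phi> t (Y \<omega>) u) \<partial>P)"
      by (rule integral_distr[OF Ym measurable_compose[OF pmx gm]])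
    also have "\<dots> = (\<integral>\<omega>. g (\<phi> t (\<theta> T \<omega>) u) \<partial>P)"
      by (rule Bochner_Integration.integral_cong[OF refl])
         (simp add: Y_def phi_stop[OF measurable_space[OF shift_meas] t])
    also have "\<dots> = (\<integral>\<omega>. g (\<phi> t \<omega> u) \<partial>distr P P (\<theta> T))"
      by (rule integral_distr[symmetric, OF shift_meas measurable_compose[OF pmx gm]])
    finally show "(\<integral>y. g (\<phi> t y (\<phi> T \<omega> x)) \<partial>distr P P Y) = k (\<phi> T \<omega> x)"
      unfolding shift_distr k_def u_def .
  qed
  also have "\<dots> = (\<integral>\<omega>. k (\<phi> T (X \<omega>) x) \<partial>P)"
    by (rule integral_distr[OF Xm measurable_compose[OF phi_meas[OF T] km]])
  also have "\<dots> = (\<integral>\<omega>. k (\<phi> T \<omega> x) \<partial>P)"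
    by (rule Bochner_Integration.integral_cong[OF refl]) (simp add: X_eq)
  finally show ?thesis unfolding k_def .
qed

definition \<rho> :: "real measure" where "\<rho> = distr P borel a"

lemma sets_rho[measurable_cong]: "sets \<rho> = sets borel" by (simp add: \<rho>_def)
lemma space_rho: "space \<rho> = UNIV" by (simp add: \<rho>_def)
lemma prob_rho: "prob_space \<rho>" unfolding \<rho>_def by (rule prob_space_distr) measurable

text \<open>The Markov identity is applied to solutions started at 0, with elapsed time
  \<open>n\<close> tending to infinity. Both sides converge by \<open>forward_limit\<close>, once
  with \<open>g\<close> and once with its image under the semigroup.\<close>

lemma invariance_expectation:
  fixes g :: "real \<Rightarrow> complex"
  assumes g: "\<And>x. isCont g x" and b: "\<And>x. norm (g x) \<le> 1" and t: "t \<ge> 0"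
  shows "(\<integral>\<omega>. g (a \<omega>) \<partial>P) = (\<integral>\<omega>. (\<integral>\<omega>'. g (\<phi> t \<omega>' (a \<omega>)) \<partial>P) \<partial>P)"
proof -
  have gm[measurable]: "g \<in> borel_measurable borel"
    using g by (intro borel_measurable_continuous_onI) (simp add: continuous_at_imp_continuous_on)
  define h where "h y = (\<integral>\<omega>'. g (\<phi> t \<omega>' y) \<partial>P)" for y
  have gi: "integrable P (\<lambda>\<omega>'. g (\<phi> t \<omega>' y))" for y
    by (rule bounded_complex_integrable[OF finite_measure_axioms measurable_compose[OF phi_meas[OF t] gm] b])
  have hb: "norm (h y) \<le> 1" for y
  proof -
    have "norm (h y) \<le> (\<integral>\<omega>'. norm (g (\<phi> t \<omega>' y)) \<partial>P)" unfolding h_def by (rule integral_norm_bound)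
    also have "\<dots> \<le> (\<integral>\<omega>'. 1 \<partial>P)" by (rule integral_mono) (use gi b in auto)
    finally show ?thesis by (simp add: prob_space)
  qed
  \<comment> \<open>The Feller property: the flow is continuous in its starting point, so the
    semigroup maps bounded continuous functions to continuous ones. Without it the limit could not
    be taken in \<open>h\<close>.\<close>
  have hc: "isCont h y" for y
    unfolding continuous_at_sequentially
  proof (intro allI impI)
    fix u :: "nat \<Rightarrow> real" assume u: "u \<longlonglongrightarrow> y"
    show "(h \<circ> u) \<longlonglongrightarrow> h y" unfolding h_def comp_def
    proof (rule integral_dominated_convergence[where w="\<lambda>_. 1"])
      show "AE \<omega> in P. (\<lambda>n. g (\<phi> t \<omega> (u n))) \<longlonglongrightarrow> g (\<phi> t \<omega> y)"
      proof (intro AE_I2)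
        fix \<omega> assume "\<omega> \<in> space P"
        from isCont_tendsto_compose[OF psi_cont[OF this, of _ t] u] t
        have "(\<lambda>n. \<phi> t \<omega> (u n)) \<longlonglongrightarrow> \<phi> t \<omega> y" by (simp add: psi_eq)
        thus "(\<lambda>n. g (\<phi> t \<omega> (u n))) \<longlonglongrightarrow> g (\<phi> t \<omega> y)" by (rule isCont_tendsto_compose[OF g])
      qed
    qed (use gi b in auto)
  qed
  have "(\<lambda>n. \<integral>\<omega>. h (\<phi> (0 + real n) \<omega> 0) \<partial>P) \<longlonglongrightarrow> (\<integral>\<omega>. h (a \<omega>) \<partial>P)"
    by (rule forward_limit[OF hc hb]) simp
  moreover have "(\<integral>\<omega>. h (\<phi> (0 + real n) \<omega> 0) \<partial>P) = (\<integral>\<omega>. g (\<phi> (t + real n) \<omega> 0) \<partial>P)" for n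
    using markov[OF gm b t, of "real n" 0] by (simp add: h_def)
  ultimately have "(\<integral>\<omega>. h (a \<omega>) \<partial>P) = (\<integral>\<omega>. g (a \<omega>) \<partial>P)"
    using forward_limit[OF g b t] LIMSEQ_unique by simp
  thus ?thesis by (simp add: h_def)
qed

text \<open>\<open>invariance_expectation\<close> with g x = exp (i s x) says that the two
  characteristic functions agree, and these determine the law.\<close>

theorem rho_invariant:
  assumes t: "t \<ge> 0"
  shows "distr (P \<Otimes>\<^sub>M \<rho>) borel (\<lambda>(\<omega>, x). \<phi> t \<omega> x) = \<rho>"
proof (rule Levy_uniqueness)
  interpret R: prob_space \<rho> by (rule prob_rho)
  interpret PR: pair_prob_space P \<rho> ..
  have pm[measurable]: "(\<lambda>(\<omega>, x). \<phi> t \<omega> x) \<in> borel_measurable (P \<Otimes>\<^sub>M \<rho>)"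
    using phi_joint_meas[OF t] by (subst measurable_cong_sets[OF sets_pair_measure_cong[OF refl sets_rho] refl])
  show "real_distribution \<rho>"
    using prob_rho by (simp add: real_distribution_def real_distribution_axioms_def sets_rho)
  show "real_distribution (distr (P \<Otimes>\<^sub>M \<rho>) borel (\<lambda>(\<omega>, x). \<phi> t \<omega> x))"
    by (simp add: real_distribution_def real_distribution_axioms_def PR.prob_space_distr)
  show "char (distr (P \<Otimes>\<^sub>M \<rho>) borel (\<lambda>(\<omega>, x). \<phi> t \<omega> x)) = char \<rho>"
  proof
    fix s
    define g where "g x = iexp (s * x)" for x
    have g: "isCont g x" and b: "norm (g x) \<le> 1" for x
      unfolding g_def by (auto intro!: continuous_intros)
    have gm[measurable]: "g \<in> borel_measurable borel" unfolding g_def by measurable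
    have gi: "integrable (P \<Otimes>\<^sub>M \<rho>) (\<lambda>(\<omega>, x). g (\<phi> t \<omega> x))"
    proof (rule bounded_complex_integrable)
      show "(\<lambda>(\<omega>, x). g (\<phi> t \<omega> x)) \<in> borel_measurable (P \<Otimes>\<^sub>M \<rho>)"
        using measurable_compose[OF pm gm] by (simp add: case_prod_unfold)
    qed (use b PR.finite_measure_axioms in \<open>auto simp: case_prod_unfold\<close>)
    have "char (distr (P \<Otimes>\<^sub>M \<rho>) borel (\<lambda>(\<omega>, x). \<phi> t \<omega> x)) s = (\<integral>z. g (case z of (\<omega>, x) \<Rightarrow> \<phi> t \<omega> x) \<partial>(P \<Otimes>\<^sub>M \<rho>))"
      unfolding char_def g_def[symmetric] by (rule integral_distr) measurable
    also have "\<dots> = (\<integral>(\<omega>, x). g (\<phi> t \<omega> x) \<partial>(P \<Otimes>\<^sub>M \<rho>))" by (simp add: case_prod_unfold)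
    also have "\<dots> = (\<integral>x. \<integral>\<omega>. g (\<phi> t \<omega> x) \<partial>P \<partial>\<rho>)"
      by (rule PR.integral_snd[symmetric]) (rule gi)
    also have "\<dots> = (\<integral>\<omega>. (\<integral>\<omega>'. g (\<phi> t \<omega>' (a \<omega>)) \<partial>P) \<partial>P)"
      unfolding \<rho>_def
    proof (rule integral_distr[OF a_meas])
      have "(\<lambda>(x, \<omega>). g (\<phi> t \<omega> x)) \<in> borel_measurable (borel \<Otimes>\<^sub>M P)"
        using measurable_compose[OF measurable_compose[OF measurable_pair_swap' phi_joint_meas[OF t]] gm]
        by (simp add: case_prod_unfold)
      thus "(\<lambda>x. \<integral>\<omega>. g (\<phi> t \<omega> x) \<partial>P) \<in> borel_measurable borel" by (rule borel_measurable_lebesgue_integral)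
    qed
    also have "\<dots> = (\<integral>\<omega>. g (a \<omega>) \<partial>P)" by (rule invariance_expectation[OF g b t, symmetric])
    also have "\<dots> = (\<integral>x. g x \<partial>\<rho>)" unfolding \<rho>_def by (rule integral_distr[symmetric]) measurable
    finally show "char (distr (P \<Otimes>\<^sub>M \<rho>) borel (\<lambda>(\<omega>, x). \<phi> t \<omega> x)) s = char \<rho> s" unfolding char_def g_def .
  qed
qed

end

section \<open>Second moment of the attractor\<close>

context attracted_sde_rds
begin

sublocale R: prob_space \<rho> by (rule prob_rho)

lemma psi_a_meas: "(\<lambda>(s, \<omega>). \<psi> s \<omega> (a \<omega>)) \<in> borel_measurable (borel \<Otimes>\<^sub>M P)"
  unfolding case_prod_unfold by (intro psi_meas measurable_compose[OF measurable_snd a_meas]) auto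

text \<open>Here the starting point is correlated with the noise, unlike in
  \<open>rho_invariant\<close>, and the law is kept for another reason: the flow carries
  \<open>a \<omega>\<close> to \<open>a (\<theta> s \<omega>)\<close> and the shift preserves
  \<open>P\<close>.\<close>

lemma nn_integral_along_attractor:
  assumes [measurable]: "F \<in> borel_measurable borel" and s: "s \<ge> 0"
  shows "(\<integral>\<^sup>+\<omega>. F (\<psi> s \<omega> (a \<omega>)) \<partial>P) = (\<integral>\<^sup>+x. F x \<partial>\<rho>)"
proof -
  have "(\<integral>\<^sup>+\<omega>. F (\<psi> s \<omega> (a \<omega>)) \<partial>P) = (\<integral>\<^sup>+\<omega>. F (a (\<theta> s \<omega>)) \<partial>P)"
    by (rule nn_integral_cong_AE) (use a_invariant[OF s] in \<open>auto simp: psi_eq[OF s]\<close>)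
  also have "\<dots> = (\<integral>\<^sup>+\<omega>. F (a \<omega>) \<partial>distr P P (\<theta> s))"
    by (rule nn_integral_distr[symmetric]) measurable
  also have "\<dots> = (\<integral>\<^sup>+x. F x \<partial>\<rho>)"
    unfolding shift_distr \<rho>_def by (rule nn_integral_distr[symmetric]) measurable
  finally show ?thesis .
qed

lemma ln_linearization:
  assumes w: "\<omega> \<in> space P" and t: "t \<ge> 0"
  shows "ln \<bar>linearization \<phi> a t \<omega>\<bar> = \<beta> * t - 3 * (LBINT s:{0..t}. (\<psi> s \<omega> (a \<omega>))\<^sup>2)"
proof -
  have "linearization \<phi> a t \<omega> = exp (LBINT s:{0..t}. \<beta> - 3 * (\<psi> s \<omega> (a \<omega>))\<^sup>2)"
    unfolding linearization_def using DERIV_imp_deriv[OF psi_deriv[OF w t]] by (simp add: psi_eq[OF t])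
  moreover have "set_integrable lborel {0..t} (\<lambda>s. 3 * (\<psi> s \<omega> (a \<omega>))\<^sup>2)"
    by (intro set_integrable_mult_right set_integrable_square_of_cubic[OF psi_meas_time[OF w] psi_int[OF w t]])
  hence "(LBINT s:{0..t}. \<beta> - 3 * (\<psi> s \<omega> (a \<omega>))\<^sup>2)
      = (LBINT s:{0..t}. \<beta>) - (LBINT s:{0..t}. 3 * (\<psi> s \<omega> (a \<omega>))\<^sup>2)"
    by (rule set_integral_diff(2)[OF set_integrable_const_Icc])
  moreover have "(LBINT s:{0..t}. \<beta>) = \<beta> * t" using t by (simp add: set_lebesgue_integral_def)
  ultimately show ?thesis by simp
qed

text \<open>The exponent prescribes the almost sure limit of the time averages of a^2, and a
  Fatou-type argument bounds the mean by that limit. The bound is finite, which is how \<rho>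
  acquires a second moment.\<close>

lemma second_moment_le:
  assumes lyap: "is_lyapunov_exponent P \<phi> a \<Lambda>"
  shows "(\<integral>\<^sup>+x. ennreal (x\<^sup>2) \<partial>\<rho>) \<le> ennreal ((\<beta> - \<Lambda>) / 3)" and "\<Lambda> \<le> \<beta>"
proof -
  define c where "c = (\<beta> - \<Lambda>) / 3"
  define V where "V n \<omega> = (LBINT s:{0..real n}. (\<psi> s \<omega> (a \<omega>))\<^sup>2) / real n" for n \<omega>
  have Vm[measurable]: "V n \<in> borel_measurable P" for n
  proof -
    have "(\<lambda>(\<omega>, s). \<psi> s \<omega> (a \<omega>)) \<in> borel_measurable (P \<Otimes>\<^sub>M lborel)"
      unfolding case_prod_unfold by (intro psi_meas measurable_compose[OF measurable_fst a_meas]) auto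
    hence "(\<lambda>(\<omega>, s). indicator {0..real n} s *\<^sub>R (\<psi> s \<omega> (a \<omega>))\<^sup>2) \<in> borel_measurable (P \<Otimes>\<^sub>M lborel)"
      unfolding case_prod_unfold by measurable
    from lborel.borel_measurable_lebesgue_integral[OF this] show ?thesis
      unfolding V_def set_lebesgue_integral_def by measurable
  qed
  have V0: "0 \<le> V n \<omega>" for n \<omega>
    unfolding V_def set_lebesgue_integral_def by (intro divide_nonneg_nonneg integral_nonneg_AE) auto
  have Vlim: "AE \<omega> in P. (\<lambda>n. V n \<omega>) \<longlonglongrightarrow> c"
    using lyap unfolding is_lyapunov_exponent_def
  proof (rule AE_mp, intro AE_I2 impI)
    fix \<omega> assume w: "\<omega> \<in> space P" and l: "((\<lambda>T. 1 / T * ln \<bar>linearization \<phi> a T \<omega>\<bar>) \<longlongrightarrow> \<Lambda>) at_top"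
    have "(\<lambda>n. (\<beta> - 1 / real n * ln \<bar>linearization \<phi> a (real n) \<omega>\<bar>) / 3) \<longlonglongrightarrow> c"
      unfolding c_def by (intro tendsto_intros filterlim_compose[OF l filterlim_real_sequentially]) simp
    moreover have "\<forall>\<^sub>F n in sequentially. (\<beta> - 1 / real n * ln \<bar>linearization \<phi> a (real n) \<omega>\<bar>) / 3 = V n \<omega>"
    proof (rule eventually_sequentiallyI[of 1])
      fix n :: nat assume "1 \<le> n"
      thus "(\<beta> - 1 / real n * ln \<bar>linearization \<phi> a (real n) \<omega>\<bar>) / 3 = V n \<omega>"
        unfolding V_def ln_linearization[OF w of_nat_0_le_iff] by (simp add: field_simps)
    qed
    ultimately show "(\<lambda>n. V n \<omega>) \<longlonglongrightarrow> c" by (rule Lim_transform_eventually)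
  qed
  have "AE \<omega> in P. 0 \<le> c"
    using Vlim by eventually_elim (rule LIMSEQ_le_const, use V0 in auto)
  thus "\<Lambda> \<le> \<beta>" by (simp add: c_def)
  \<comment> \<open>Capping at \<open>K\<close> permits dominated convergence. The time average of
    the capped square is at most the capped time average, so the bound survives for every
    \<open>K\<close>, and monotone convergence removes the cap.\<close>
  have trunc: "(\<integral>\<^sup>+x. ennreal (min (x\<^sup>2) K) \<partial>\<rho>) \<le> ennreal c" if K: "K \<ge> 0" for K :: real
  proof -
    define M where "M = (\<integral>\<^sup>+x. ennreal (min (x\<^sup>2) K) \<partial>\<rho>)"
    interpret LP: pair_sigma_finite lborel P ..
    have bound: "M \<le> ennreal (\<integral>\<omega>. min (V n \<omega>) K \<partial>P)" if n: "n \<ge> 1" for n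
    proof -
      have "M * ennreal (real n) = (\<integral>\<^sup>+s. M * indicator {0..real n} s \<partial>lborel)"
        by (simp add: nn_integral_cmult_indicator)
      also have "\<dots> = (\<integral>\<^sup>+s. (\<integral>\<^sup>+\<omega>. ennreal (min ((\<psi> s \<omega> (a \<omega>))\<^sup>2) K) * indicator {0..real n} s \<partial>P) \<partial>lborel)"
      proof (rule nn_integral_cong)
        fix s
        show "M * indicator {0..real n} s = (\<integral>\<^sup>+\<omega>. ennreal (min ((\<psi> s \<omega> (a \<omega>))\<^sup>2) K) * indicator {0..real n} s \<partial>P)"
          using nn_integral_along_attractor[of "\<lambda>x. ennreal (min (x\<^sup>2) K)" s]
          by (cases "s \<in> {0..real n}") (simp_all add: M_def)
      qed
      also have "\<dots> = (\<integral>\<^sup>+\<omega>. (\<integral>\<^sup>+s. ennreal (min ((\<psi> s \<omega> (a \<omega>))\<^sup>2) K) * indicator {0..real n} s \<partial>lborel) \<partial>P)"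
      proof (rule LP.Fubini'[symmetric])
        have "(\<lambda>(s, \<omega>). \<psi> s \<omega> (a \<omega>)) \<in> borel_measurable (lborel \<Otimes>\<^sub>M P)"
          using psi_a_meas by (subst measurable_cong_sets[OF sets_pair_measure_cong[OF sets_lborel refl] refl])
        thus "(\<lambda>(s, \<omega>). ennreal (min ((\<psi> s \<omega> (a \<omega>))\<^sup>2) K) * indicator {0..real n} s) \<in> borel_measurable (lborel \<Otimes>\<^sub>M P)"
          unfolding case_prod_unfold by measurable
      qed
      also have "\<dots> \<le> (\<integral>\<^sup>+\<omega>. ennreal (min (V n \<omega>) K) * ennreal (real n) \<partial>P)"
      proof (rule nn_integral_mono)
        fix \<omega> assume w: "\<omega> \<in> space P"
        have i: "set_integrable lborel {0..real n} (\<lambda>s. (\<psi> s \<omega> (a \<omega>))\<^sup>2)"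
          by (rule set_integrable_square_of_cubic[OF psi_meas_time[OF w] psi_int[OF w]]) simp
        have "(\<integral>\<^sup>+s. ennreal (min ((\<psi> s \<omega> (a \<omega>))\<^sup>2) K) * indicator {0..real n} s \<partial>lborel)
            \<le> (\<integral>\<^sup>+s. ennreal (indicator {0..real n} s *\<^sub>R (\<psi> s \<omega> (a \<omega>))\<^sup>2) \<partial>lborel)"
          by (rule nn_integral_mono) (auto simp: indicator_def intro: ennreal_leI)
        also have "\<dots> = ennreal (V n \<omega> * real n)"
          using i n unfolding V_def set_lebesgue_integral_def set_integrable_def
          by (subst nn_integral_eq_integral) auto
        finally have 1: "(\<integral>\<^sup>+s. ennreal (min ((\<psi> s \<omega> (a \<omega>))\<^sup>2) K) * indicator {0..real n} s \<partial>lborel) \<le> ennreal (V n \<omega> * real n)" .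
        have "(\<integral>\<^sup>+s. ennreal (min ((\<psi> s \<omega> (a \<omega>))\<^sup>2) K) * indicator {0..real n} s \<partial>lborel)
            \<le> (\<integral>\<^sup>+s. ennreal K * indicator {0..real n} s \<partial>lborel)"
          by (rule nn_integral_mono) (auto simp: indicator_def intro: ennreal_leI)
        also have "\<dots> = ennreal (K * real n)"
          using K by (simp add: nn_integral_cmult_indicator ennreal_mult)
        finally have 2: "(\<integral>\<^sup>+s. ennreal (min ((\<psi> s \<omega> (a \<omega>))\<^sup>2) K) * indicator {0..real n} s \<partial>lborel) \<le> ennreal (K * real n)" .
        have "ennreal (min (V n \<omega>) K) * ennreal (real n) = ennreal (min (V n \<omega>) K * real n)"
          using V0[of n \<omega>] K by (simp add: ennreal_mult)
        thus "(\<integral>\<^sup>+s. ennreal (min ((\<psi> s \<omega> (a \<omega>))\<^sup>2) K) * indicator {0..real n} s \<partial>lborel) \<le> ennreal (min (V n \<omega>) K) * ennreal (real n)"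
          using 1 2 by (cases "V n \<omega> \<le> K") (simp_all add: min_def)
      qed
      also have "\<dots> = (\<integral>\<^sup>+\<omega>. ennreal (min (V n \<omega>) K) \<partial>P) * ennreal (real n)"
        by (rule nn_integral_multc) measurable
      also have "(\<integral>\<^sup>+\<omega>. ennreal (min (V n \<omega>) K) \<partial>P) = ennreal (\<integral>\<omega>. min (V n \<omega>) K \<partial>P)"
        by (rule nn_integral_eq_integral, rule integrable_const_bound[where B=K]) (use V0 K in \<open>auto simp: min_def\<close>)
      finally have "M * ennreal (real n) \<le> ennreal (\<integral>\<omega>. min (V n \<omega>) K \<partial>P) * ennreal (real n)" .
      hence "ennreal (real n) * M \<le> ennreal (real n) * ennreal (\<integral>\<omega>. min (V n \<omega>) K \<partial>P)" by (simp only: mult.commute)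
      thus ?thesis using n by (subst (asm) ennreal_mult_le_mult_iff) auto
    qed
    have "(\<lambda>n. \<integral>\<omega>. min (V n \<omega>) K \<partial>P) \<longlonglongrightarrow> (\<integral>\<omega>. min c K \<partial>P)"
    proof (rule integral_dominated_convergence[where w="\<lambda>_. K"])
      show "AE \<omega> in P. (\<lambda>n. min (V n \<omega>) K) \<longlonglongrightarrow> min c K"
        using Vlim by (rule AE_mp) (auto intro!: tendsto_intros)
      show "AE \<omega> in P. norm (min (V n \<omega>) K) \<le> K" for n using V0[of n] K by (auto simp: min_def)
    qed auto
    hence "(\<lambda>n. ennreal (\<integral>\<omega>. min (V n \<omega>) K \<partial>P)) \<longlonglongrightarrow> ennreal (min c K)"
      by (intro tendsto_ennrealI) (simp add: prob_space)
    hence "M \<le> ennreal (min c K)"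
      by (rule LIMSEQ_le_const) (use bound in \<open>auto intro!: exI[of _ 1]\<close>)
    also have "\<dots> \<le> ennreal c" by (rule ennreal_leI) simp
    finally show ?thesis by (simp add: M_def)
  qed
  have "(\<lambda>k. \<integral>\<^sup>+x. ennreal (min (x\<^sup>2) (real k)) \<partial>\<rho>) \<longlonglongrightarrow> (\<integral>\<^sup>+x. ennreal (x\<^sup>2) \<partial>\<rho>)"
  proof (rule nn_integral_LIMSEQ)
    show "incseq (\<lambda>k x. ennreal (min (x\<^sup>2) (real k)))"
      by (auto simp: incseq_def le_fun_def intro!: ennreal_leI)
    show "(\<lambda>k. ennreal (min (x\<^sup>2) (real k))) \<longlonglongrightarrow> ennreal (x\<^sup>2)" for x
    proof (rule Lim_transform_eventually[OF tendsto_const])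
      obtain k0 where k0: "x\<^sup>2 \<le> real k0" using real_arch_simple by blast
      show "\<forall>\<^sub>F k in sequentially. ennreal (x\<^sup>2) = ennreal (min (x\<^sup>2) (real k))"
        by (rule eventually_sequentiallyI[of k0]) (use k0 in \<open>auto simp: min_def\<close>)
    qed
  qed measurable
  thus "(\<integral>\<^sup>+x. ennreal (x\<^sup>2) \<partial>\<rho>) \<le> ennreal ((\<beta> - \<Lambda>) / 3)" unfolding c_def[symmetric]
    by (rule LIMSEQ_le_const2) (use trunc in auto)
qed

section \<open>The flow started from an independent point of law \<rho>\<close>

lemma nn_integral_flow:
  assumes [measurable]: "F \<in> borel_measurable borel" and s: "s \<ge> 0"
  shows "(\<integral>\<^sup>+\<omega>. \<integral>\<^sup>+x. F (\<psi> s \<omega> x) \<partial>\<rho> \<partial>P) = (\<integral>\<^sup>+x. F x \<partial>\<rho>)"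
proof -
  have pm[measurable]: "(\<lambda>(\<omega>, x). \<phi> s \<omega> x) \<in> borel_measurable (P \<Otimes>\<^sub>M \<rho>)"
    using phi_joint_meas[OF s] by (subst measurable_cong_sets[OF sets_pair_measure_cong[OF refl sets_rho] refl])
  have "(\<integral>\<^sup>+x. F x \<partial>\<rho>) = (\<integral>\<^sup>+z. F (case z of (\<omega>, x) \<Rightarrow> \<phi> s \<omega> x) \<partial>(P \<Otimes>\<^sub>M \<rho>))"
    by (subst rho_invariant[OF s, symmetric]) (rule nn_integral_distr; measurable)
  also have "\<dots> = (\<integral>\<^sup>+\<omega>. \<integral>\<^sup>+x. F (\<psi> s \<omega> x) \<partial>\<rho> \<partial>P)"
    by (subst R.nn_integral_fst[symmetric]) (simp_all add: psi_eq[OF s])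
  finally show ?thesis ..
qed

lemma no_atoms:
  assumes nondeg: "\<not> (\<exists>x. \<forall>t\<ge>0. AE \<omega> in P. \<phi> t \<omega> x = x)"
  shows "emeasure \<rho> {x} = 0"
proof (rule ccontr)
  assume "emeasure \<rho> {x} \<noteq> 0"
  hence "measure \<rho> {x} > 0" by (simp add: R.emeasure_eq_measure zero_less_measure_iff)
  from maximal_atoms[OF prob_rho sets_rho this] obtain q where q: "q > 0" "\<And>y. measure \<rho> {y} \<le> q"
    "finite {x. measure \<rho> {x} = q}" "{x. measure \<rho> {x} = q} \<noteq> {}" by blast
  \<comment> \<open>The largest maximal atom is determined by \<rho> alone, so one and the same
    point is fixed at every time \<open>t\<close>, although the exceptional set may vary with
    \<open>t\<close>.\<close>
  have "AE \<omega> in P. \<phi> t \<omega> (Max {x. measure \<rho> {x} = q}) = Max {x. measure \<rho> {x} = q}" if t: "t \<ge> 0" for t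
  proof -
    have "AE \<omega> in P. (case (\<omega>, Max {x. measure \<rho> {x} = q}) of (\<omega>, x) \<Rightarrow> \<phi> t \<omega> x) = Max {x. measure \<rho> {x} = q}"
    proof (rule largest_maximal_atom_fixed[OF prob_space_axioms prob_rho sets_rho q _ rho_invariant[OF t]])
      show "(\<lambda>(\<omega>, x). \<phi> t \<omega> x) \<in> borel_measurable (P \<Otimes>\<^sub>M \<rho>)"
        using phi_joint_meas[OF t] by (subst measurable_cong_sets[OF sets_pair_measure_cong[OF refl sets_rho] refl])
      show "strict_mono (\<lambda>x. case (\<omega>, x) of (\<omega>, x) \<Rightarrow> \<phi> t \<omega> x)" if "\<omega> \<in> space P" for \<omega>
        using psi_strict_mono[OF that, of t] by (simp add: psi_eq[OF t])
    qed
    thus ?thesis by simp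
  qed
  thus False using nondeg by blast
qed

end

section \<open>Strict lower bound for the second moment by the logarithmic energy\<close>

context attracted_sde_rds
begin

lemma integrable_square_rho:
  assumes "(\<integral>\<^sup>+x. ennreal (x\<^sup>2) \<partial>\<rho>) < \<infinity>"
  shows "integrable \<rho> (\<lambda>x. x\<^sup>2)"
  by (rule integrableI_nonneg) (use assms in auto)

text \<open>On the product of the noise with two independent points of law \<rho>, the mean
  logarithmic growth over unit time equals \<beta> - 3 m plus half the mean of \<open>E\<close>. The
  energy inequality makes it at most 0, and a positive mean of \<open>E\<close> makes the conclusion
  strict.\<close>

lemma second_moment_gt:
  assumes fin: "(\<integral>\<^sup>+x. ennreal (x\<^sup>2) \<partial>\<rho>) < \<infinity>"
    and atomless: "\<And>x. emeasure \<rho> {x} = 0"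
  shows "\<beta> < 3 * (\<integral>x. x\<^sup>2 \<partial>\<rho>)"
proof -
  define m where "m = (\<integral>x. x\<^sup>2 \<partial>\<rho>)"
  have m: "(\<integral>\<^sup>+x. ennreal (x\<^sup>2) \<partial>\<rho>) = ennreal m"
    unfolding m_def by (rule nn_integral_eq_integral[OF integrable_square_rho[OF fin]]) simp
  have m0: "0 \<le> m" unfolding m_def by (rule integral_nonneg_AE) simp
  define N where "N = P \<Otimes>\<^sub>M (\<rho> \<Otimes>\<^sub>M \<rho>)"
  interpret RR: pair_prob_space \<rho> \<rho> ..
  interpret PRR: pair_prob_space P "\<rho> \<Otimes>\<^sub>M \<rho>" ..
  interpret N: prob_space N unfolding N_def by (rule PRR.prob_space_axioms)
  interpret LN: pair_sigma_finite lborel N ..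
  note triple = nn_integral_triple[OF R.sigma_finite_measure_axioms, of _ P]
  have space_N: "z \<in> space N \<Longrightarrow> fst z \<in> space P" for z by (auto simp: N_def space_pair_measure)
  have [measurable]: "fst \<in> N \<rightarrow>\<^sub>M P" "(\<lambda>z. fst (snd z)) \<in> borel_measurable N" "(\<lambda>z. snd (snd z)) \<in> borel_measurable N"
    unfolding N_def by measurable
  define X where "X s z = \<psi> s (fst z) (fst (snd z))" for s and z :: "(real \<Rightarrow> real) \<times> real \<times> real"
  define Y where "Y s z = \<psi> s (fst z) (snd (snd z))" for s and z :: "(real \<Rightarrow> real) \<times> real \<times> real"
  have XYm: "X s \<in> borel_measurable N" "Y s \<in> borel_measurable N" for s
    unfolding X_def Y_def by (intro psi_meas; measurable)+
  have XYj: "(\<lambda>p. X (fst p) (snd p)) \<in> borel_measurable (lborel \<Otimes>\<^sub>M N)" "(\<lambda>p. Y (fst p) (snd p)) \<in> borel_measurable (lborel \<Otimes>\<^sub>M N)"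
    unfolding X_def Y_def by (intro psi_meas; measurable)+
  note [measurable] = XYm XYj
  have XYt: "(\<lambda>s. X s z) \<in> borel_measurable borel" "(\<lambda>s. Y s z) \<in> borel_measurable borel" if "z \<in> space N" for z
    unfolding X_def Y_def using psi_meas_time[OF space_N[OF that]] by auto
  have sX: "(\<integral>\<^sup>+z. ennreal ((X s z)\<^sup>2) \<partial>N) = ennreal m" if s: "s \<ge> 0" for s
  proof -
    have mX: "(\<lambda>z. ennreal ((X s z)\<^sup>2)) \<in> borel_measurable N" by measurable
    have "(\<integral>\<^sup>+z. ennreal ((X s z)\<^sup>2) \<partial>N) = (\<integral>\<^sup>+(\<omega>, x, y). ennreal ((\<psi> s \<omega> x)\<^sup>2) \<partial>(P \<Otimes>\<^sub>M (\<rho> \<Otimes>\<^sub>M \<rho>)))"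
      unfolding N_def X_def by (simp add: case_prod_unfold)
    also have "\<dots> = (\<integral>\<^sup>+\<omega>. \<integral>\<^sup>+x. \<integral>\<^sup>+y. ennreal ((\<psi> s \<omega> x)\<^sup>2) \<partial>\<rho> \<partial>\<rho> \<partial>P)"
      by (rule triple[symmetric]) (use mX in \<open>simp add: case_prod_unfold N_def X_def\<close>)
    also have "\<dots> = ennreal m"
      using nn_integral_flow[of "\<lambda>x. ennreal (x\<^sup>2)", OF _ s] by (simp add: R.emeasure_space_1 m)
    finally show ?thesis .
  qed
  have sY: "(\<integral>\<^sup>+z. ennreal ((Y s z)\<^sup>2) \<partial>N) = ennreal m" if s: "s \<ge> 0" for s
  proof -
    have mY: "(\<lambda>z. ennreal ((Y s z)\<^sup>2)) \<in> borel_measurable N" by measurable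
    have "(\<integral>\<^sup>+z. ennreal ((Y s z)\<^sup>2) \<partial>N) = (\<integral>\<^sup>+(\<omega>, x, y). ennreal ((\<psi> s \<omega> y)\<^sup>2) \<partial>(P \<Otimes>\<^sub>M (\<rho> \<Otimes>\<^sub>M \<rho>)))"
      unfolding N_def Y_def by (simp add: case_prod_unfold)
    also have "\<dots> = (\<integral>\<^sup>+\<omega>. \<integral>\<^sup>+x. \<integral>\<^sup>+y. ennreal ((\<psi> s \<omega> y)\<^sup>2) \<partial>\<rho> \<partial>\<rho> \<partial>P)"
      by (rule triple[symmetric]) (use mY in \<open>simp add: case_prod_unfold N_def Y_def\<close>)
    also have "\<dots> = ennreal m"
      using nn_integral_flow[of "\<lambda>x. ennreal (x\<^sup>2)", OF _ s] by (simp add: R.emeasure_space_1 m)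
    finally show ?thesis .
  qed
  have XI: "set_integrable lborel {0..1} (\<lambda>s. (X s z)\<^sup>2)" and YI: "set_integrable lborel {0..1} (\<lambda>s. (Y s z)\<^sup>2)" if "z \<in> space N" for z
    unfolding X_def Y_def
    by (rule set_integrable_square_of_cubic[OF psi_meas_time[OF space_N[OF that]] psi_int[OF space_N[OF that]]]; simp)+
  \<comment> \<open>Tonelli: each time slice contributes \<open>m\<close>, because each coordinate
    separately keeps the law \<rho>. The joint law of the pair is not preserved.\<close>
  have time_avg: "has_bochner_integral N (\<lambda>z. LBINT s:{0..1}. (W s z)\<^sup>2) m"
    if Wj[measurable]: "(\<lambda>p. W (fst p) (snd p)) \<in> borel_measurable (lborel \<Otimes>\<^sub>M N)"
      and WI: "\<And>z. z \<in> space N \<Longrightarrow> set_integrable lborel {0..1} (\<lambda>s. (W s z)\<^sup>2)"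
      and sW: "\<And>s. s \<ge> 0 \<Longrightarrow> (\<integral>\<^sup>+z. ennreal ((W s z)\<^sup>2) \<partial>N) = ennreal m" for W :: "real \<Rightarrow> _ \<Rightarrow> real"
  proof (rule has_bochner_integral_nn_integral)
    have Wj': "(\<lambda>p. W (snd p) (fst p)) \<in> borel_measurable (N \<Otimes>\<^sub>M lborel)"
      using measurable_compose[OF measurable_pair_swap' Wj] by (simp add: case_prod_unfold)
    show "(\<lambda>z. LBINT s:{0..1}. (W s z)\<^sup>2) \<in> borel_measurable N"
      unfolding set_lebesgue_integral_def
      by (rule lborel.borel_measurable_lebesgue_integral) (use Wj' in \<open>simp add: case_prod_unfold\<close>)
    show "AE z in N. 0 \<le> (LBINT s:{0..1}. (W s z)\<^sup>2)"
      unfolding set_lebesgue_integral_def by (intro AE_I2 integral_nonneg_AE) auto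
    have "(\<integral>\<^sup>+z. ennreal (LBINT s:{0..1}. (W s z)\<^sup>2) \<partial>N) = (\<integral>\<^sup>+z. \<integral>\<^sup>+s. ennreal ((W s z)\<^sup>2) * indicator {0..1} s \<partial>lborel \<partial>N)"
    proof (rule nn_integral_cong)
      fix z assume z: "z \<in> space N"
      have "ennreal (LBINT s:{0..1}. (W s z)\<^sup>2) = (\<integral>\<^sup>+s. ennreal (indicator {0..1} s *\<^sub>R (W s z)\<^sup>2) \<partial>lborel)"
        using WI[OF z] unfolding set_lebesgue_integral_def set_integrable_def
        by (intro nn_integral_eq_integral[symmetric]) auto
      also have "\<dots> = (\<integral>\<^sup>+s. ennreal ((W s z)\<^sup>2) * indicator {0..1} s \<partial>lborel)"
        by (rule nn_integral_cong) (simp add: indicator_def)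
      finally show "ennreal (LBINT s:{0..1}. (W s z)\<^sup>2) = \<dots>" .
    qed
    also have "\<dots> = (\<integral>\<^sup>+s. \<integral>\<^sup>+z. ennreal ((W s z)\<^sup>2) * indicator {0..1} s \<partial>N \<partial>lborel)"
      by (rule LN.Fubini') (unfold case_prod_unfold, measurable)
    also have "\<dots> = (\<integral>\<^sup>+s. ennreal m * indicator {0..1::real} s \<partial>lborel)"
    proof (rule nn_integral_cong)
      fix s :: real
      show "(\<integral>\<^sup>+z. ennreal ((W s z)\<^sup>2) * indicator {0..1} s \<partial>N) = ennreal m * indicator {0..1} s"
        using sW[of s] by (cases "s \<in> {0..1}") simp_all
    qed
    also have "\<dots> = ennreal m" by (simp add: nn_integral_cmult_indicator)
    finally show "(\<integral>\<^sup>+z. ennreal (LBINT s:{0..1}. (W s z)\<^sup>2) \<partial>N) = ennreal m" .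
  qed (rule m0)
  define AX where "AX z = (LBINT s:{0..1}. (X s z)\<^sup>2)" for z
  define AY where "AY z = (LBINT s:{0..1}. (Y s z)\<^sup>2)" for z
  \<comment> \<open>The squared distance integrated over unit time, the source of
    strictness.\<close>
  define E where "E z = (LBINT s:{0..1}. (X s z - Y s z)\<^sup>2)" for z
  define Q where "Q z = (LBINT s:{0..1}. \<beta> - ((X s z)\<^sup>2 + X s z * Y s z + (Y s z)\<^sup>2))" for z
  have AX: "has_bochner_integral N AX m" unfolding AX_def[abs_def] by (rule time_avg[OF XYj(1) XI sX])
  have AY: "has_bochner_integral N AY m" unfolding AY_def[abs_def] by (rule time_avg[OF XYj(2) YI sY])
  have EI: "set_integrable lborel {0..1} (\<lambda>s. (X s z - Y s z)\<^sup>2)"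
    and E_le: "E z \<le> 2 * (AX z + AY z)"
    and Q_eq: "Q z = \<beta> - 3 / 2 * (AX z + AY z) + E z / 2"
    and q_abs: "(LBINT s:{0..1}. \<bar>\<beta> - ((X s z)\<^sup>2 + X s z * Y s z + (Y s z)\<^sup>2)\<bar>) \<le> \<bar>\<beta>\<bar> + 3 / 2 * (AX z + AY z)"
    if z: "z \<in> space N" for z
  proof -
    interpret C: cubic_pair 1 \<beta> "\<lambda>s. X s z" "\<lambda>s. Y s z"
      unfolding X_def Y_def by (rule cubic_pair_psi) (use space_N[OF z] in auto)
    have i2: "set_integrable lborel {0..1} (\<lambda>s. 2 * ((X s z)\<^sup>2 + (Y s z)\<^sup>2))"
      by (intro set_integrable_mult_right set_integral_add(1) XI YI z)
    have le: "(x - y)\<^sup>2 \<le> 2 * (x\<^sup>2 + y\<^sup>2)" for x y :: real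
      using zero_le_power2[of "x + y"] by (simp add: power2_sum power2_diff)
    show i: "set_integrable lborel {0..1} (\<lambda>s. (X s z - Y s z)\<^sup>2)"
    proof (rule set_integrable_bound[OF i2])
      show "set_borel_measurable lborel {0..1} (\<lambda>s. (X s z - Y s z)\<^sup>2)"
        unfolding set_borel_measurable_def using XYt[OF z] by measurable
      show "AE s in lborel. s \<in> {0..1} \<longrightarrow> norm ((X s z - Y s z)\<^sup>2) \<le> norm (2 * ((X s z)\<^sup>2 + (Y s z)\<^sup>2))"
        using le by (intro AE_I2 impI) (simp add: order_trans[OF le])
    qed
    have add: "(LBINT s:{0..1}. (X s z)\<^sup>2 + (Y s z)\<^sup>2) = AX z + AY z"
      unfolding AX_def AY_def by (rule set_integral_add(2)[OF XI[OF z] YI[OF z]])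
    have addI: "set_integrable lborel {0..1} (\<lambda>s. (X s z)\<^sup>2 + (Y s z)\<^sup>2)"
      by (rule set_integral_add(1)[OF XI[OF z] YI[OF z]])
    have "E z \<le> (LBINT s:{0..1}. 2 * ((X s z)\<^sup>2 + (Y s z)\<^sup>2))"
      unfolding E_def by (rule set_integral_mono[OF i i2]) (rule le)
    also have "\<dots> = 2 * (AX z + AY z)" unfolding add[symmetric] by (rule set_integral_mult_right)
    finally show "E z \<le> 2 * (AX z + AY z)" .
    have one: "(LBINT s:{0..1::real}. c) = c" for c :: real by (simp add: set_lebesgue_integral_def)
    have e: "\<beta> - ((X s z)\<^sup>2 + X s z * Y s z + (Y s z)\<^sup>2)
        = (\<beta> - 3 / 2 * ((X s z)\<^sup>2 + (Y s z)\<^sup>2)) + 1 / 2 * (X s z - Y s z)\<^sup>2" for s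
      by (simp add: power2_diff field_simps)
    have J1: "set_integrable lborel {0..1} (\<lambda>s. 3 / 2 * ((X s z)\<^sup>2 + (Y s z)\<^sup>2))"
      by (rule set_integrable_mult_right) (rule addI)
    have J2: "set_integrable lborel {0..1} (\<lambda>s. 1 / 2 * (X s z - Y s z)\<^sup>2)"
      by (rule set_integrable_mult_right) (rule i)
    have J3: "set_integrable lborel {0..1} (\<lambda>s. \<beta> - 3 / 2 * ((X s z)\<^sup>2 + (Y s z)\<^sup>2))"
      by (rule set_integral_diff(1)[OF set_integrable_const_Icc J1])
    have "Q z = (LBINT s:{0..1}. \<beta> - 3 / 2 * ((X s z)\<^sup>2 + (Y s z)\<^sup>2)) + (LBINT s:{0..1}. 1 / 2 * (X s z - Y s z)\<^sup>2)"
      unfolding Q_def e by (rule set_integral_add(2)[OF J3 J2])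
    also have "(LBINT s:{0..1}. \<beta> - 3 / 2 * ((X s z)\<^sup>2 + (Y s z)\<^sup>2)) = \<beta> - 3 / 2 * (AX z + AY z)"
      unfolding set_integral_diff(2)[OF set_integrable_const_Icc J1] set_integral_mult_right add one ..
    also have "(LBINT s:{0..1}. 1 / 2 * (X s z - Y s z)\<^sup>2) = 1 / 2 * E z"
      unfolding E_def by (rule set_integral_mult_right)
    finally show "Q z = \<beta> - 3 / 2 * (AX z + AY z) + E z / 2" by simp
    have "(LBINT s:{0..1}. \<bar>C.q s\<bar>) \<le> (LBINT s:{0..1}. \<bar>\<beta>\<bar> + 3 / 2 * ((X s z)\<^sup>2 + (Y s z)\<^sup>2))"
      by (rule set_integral_mono[OF set_integrable_abs[OF C.q_int] set_integral_add(1)[OF set_integrable_const_Icc J1]])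
         (rule C.q_bound)
    also have "\<dots> = \<bar>\<beta>\<bar> + 3 / 2 * (AX z + AY z)"
      unfolding set_integral_add(2)[OF set_integrable_const_Icc J1] set_integral_mult_right add one ..
    finally show "(LBINT s:{0..1}. \<bar>\<beta> - ((X s z)\<^sup>2 + X s z * Y s z + (Y s z)\<^sup>2)\<bar>) \<le> \<bar>\<beta>\<bar> + 3 / 2 * (AX z + AY z)"
      unfolding C.q_def .
  qed
  have iA: "integrable N AX" "integrable N AY" "integral\<^sup>L N AX = m" "integral\<^sup>L N AY = m"
    using AX AY by (auto simp: has_bochner_integral_iff)
  have E0: "0 \<le> E z" for z
    unfolding E_def set_lebesgue_integral_def by (intro integral_nonneg_AE) auto
  have XYj': "(\<lambda>p. X (snd p) (fst p)) \<in> borel_measurable (N \<Otimes>\<^sub>M lborel)" "(\<lambda>p. Y (snd p) (fst p)) \<in> borel_measurable (N \<Otimes>\<^sub>M lborel)"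
    using measurable_compose[OF measurable_pair_swap' XYj(1)] measurable_compose[OF measurable_pair_swap' XYj(2)]
    by (simp_all add: case_prod_unfold)
  have iE: "integrable N E"
  proof (rule Bochner_Integration.integrable_bound)
    show "integrable N (\<lambda>z. 2 * (AX z + AY z))" using iA by simp
    show "E \<in> borel_measurable N"
      unfolding E_def[abs_def] set_lebesgue_integral_def
      by (rule lborel.borel_measurable_lebesgue_integral) (use XYj' in \<open>simp add: case_prod_unfold\<close>)
    show "AE z in N. norm (E z) \<le> norm (2 * (AX z + AY z))"
    proof (intro AE_I2)
      fix z assume "z \<in> space N"
      from E_le[OF this] E0[of z] show "norm (E z) \<le> norm (2 * (AX z + AY z))" by simp
    qed
  qed
  have distinct: "AE z in N. fst (snd z) \<noteq> snd (snd z)"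
  proof -
    have d: "AE p in \<rho> \<Otimes>\<^sub>M \<rho>. fst p \<noteq> snd p"
    proof (rule RR.AE_pair_measure)
      show "{p \<in> space (\<rho> \<Otimes>\<^sub>M \<rho>). fst p \<noteq> snd p} \<in> sets (\<rho> \<Otimes>\<^sub>M \<rho>)" by measurable
      have "AE y in \<rho>. fst (x, y) \<noteq> snd (x, y)" for x
        by (rule AE_I[of _ _ "{x}"]) (use atomless in \<open>auto simp: space_rho sets_rho\<close>)
      thus "AE x in \<rho>. AE y in \<rho>. fst (x, y) \<noteq> snd (x, y)" by simp
    qed
    show ?thesis unfolding N_def
    proof (rule PRR.AE_pair_measure)
      show "{z \<in> space (P \<Otimes>\<^sub>M (\<rho> \<Otimes>\<^sub>M \<rho>)). fst (snd z) \<noteq> snd (snd z)} \<in> sets (P \<Otimes>\<^sub>M (\<rho> \<Otimes>\<^sub>M \<rho>))" by measurable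
      show "AE \<omega> in P. AE p in \<rho> \<Otimes>\<^sub>M \<rho>. fst (snd (\<omega>, p)) \<noteq> snd (snd (\<omega>, p))" using d by simp
    qed
  qed
  \<comment> \<open>Solutions that start apart never meet, so a vanishing integral would make the
    unit interval a null set.\<close>
  have Epos: "E z > 0" if z: "z \<in> space N" and d: "fst (snd z) \<noteq> snd (snd z)" for z
  proof (rule ccontr)
    interpret C: cubic_pair 1 \<beta> "\<lambda>s. X s z" "\<lambda>s. Y s z"
      unfolding X_def Y_def by (rule cubic_pair_psi) (use space_N[OF z] in auto)
    assume "\<not> E z > 0"
    hence "E z = 0" using E0[of z] by simp
    hence "(\<integral>s. indicator {0..1} s *\<^sub>R (X s z - Y s z)\<^sup>2 \<partial>lborel) = 0"
      unfolding E_def set_lebesgue_integral_def .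
    hence ae: "AE s in lborel. indicator {0..1} s *\<^sub>R (X s z - Y s z)\<^sup>2 = 0"
      using EI[OF z] unfolding set_integrable_def by (subst (asm) integral_nonneg_eq_0_iff_AE) auto
    have "X 0 z - Y 0 z \<noteq> 0" using d psi_0[OF space_N[OF z]] by (simp add: X_def Y_def)
    hence "C.D 0 \<noteq> 0" unfolding C.D_def .
    hence nz: "X s z - Y s z \<noteq> 0" if "s \<in> {0..1}" for s using C.D_nonzero[of s] that by (simp add: C.D_def)
    from ae have "AE s in lborel. s \<notin> {0..1::real}"
      by eventually_elim (use nz in \<open>auto simp: indicator_def split: if_splits\<close>)
    hence "{0..1::real} \<in> null_sets lborel" by (subst AE_iff_null_sets) auto
    thus False by (simp add: null_sets_def)
  qed
  have Epos': "integral\<^sup>L N E > 0"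
  proof (rule ccontr)
    assume "\<not> integral\<^sup>L N E > 0"
    moreover have "0 \<le> integral\<^sup>L N E" by (rule integral_nonneg_AE) (use E0 in auto)
    ultimately have "integral\<^sup>L N E = 0" by simp
    hence "AE z in N. E z = 0" using iE E0 by (subst (asm) integral_nonneg_eq_0_iff_AE) auto
    hence "AE z in N. False" using distinct AE_space
    proof eventually_elim
      case (elim z)
      thus ?case using Epos[of z] by simp
    qed
    thus False by simp
  qed
  have iQ: "integrable N Q" "integral\<^sup>L N Q = \<beta> - 3 * m + integral\<^sup>L N E / 2"
  proof -
    have "has_bochner_integral N (\<lambda>z. \<beta> - 3 / 2 * (AX z + AY z) + E z / 2) (\<beta> - 3 / 2 * (m + m) + integral\<^sup>L N E / 2)"
      using iA iE by (simp add: has_bochner_integral_iff N.prob_space)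
    hence "has_bochner_integral N Q (\<beta> - 3 / 2 * (m + m) + integral\<^sup>L N E / 2)"
      by (subst has_bochner_integral_cong[OF refl Q_eq refl])
    thus "integrable N Q" "integral\<^sup>L N Q = \<beta> - 3 * m + integral\<^sup>L N E / 2"
      by (auto simp: has_bochner_integral_iff)
  qed
  \<comment> \<open>The smoothed logarithm of \<open>log_energy_random_map\<close>. The term ln e
    cancels between times 0 and 1, leaving the left-hand side of \<open>log_formula\<close> with
    \<epsilon> = e^2.\<close>
  define J where "J e d = ln (d\<^sup>2 + e\<^sup>2) / 2 - ln e" for e d :: real
  have Jm[measurable]: "J e \<in> borel_measurable borel" for e unfolding J_def[abs_def] by measurable
  have J0: "0 \<le> J e d" if "e > 0" for e d
  proof -
    have "ln (e\<^sup>2) \<le> ln (d\<^sup>2 + e\<^sup>2)"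
      by (subst ln_le_cancel_iff) (use that in \<open>auto simp: add_nonneg_pos\<close>)
    thus ?thesis using that by (simp add: J_def ln_realpow)
  qed
  have half: "r / 2 \<le> r" if "0 \<le> r" for r :: real using that by simp
  \<comment> \<open>From ln (1 + x) \<le> x. This crude quadratic bound is what lets the second
    moment control the initial energy.\<close>
  have Jle: "J e d \<le> d\<^sup>2 / e\<^sup>2" if "e > 0" for e d
  proof -
    have "ln (d\<^sup>2 + e\<^sup>2) - ln (e\<^sup>2) = ln ((d\<^sup>2 + e\<^sup>2) / e\<^sup>2)" using that by (intro ln_divide_pos[symmetric]) (auto simp: add_nonneg_pos)
    also have "(d\<^sup>2 + e\<^sup>2) / e\<^sup>2 = 1 + d\<^sup>2 / e\<^sup>2" using that by (simp add: field_simps)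
    also have "ln \<dots> \<le> d\<^sup>2 / e\<^sup>2" by (rule ln_add_one_self_le_self) simp
    finally have "J e d \<le> d\<^sup>2 / e\<^sup>2 / 2" using that by (simp add: J_def ln_realpow)
    also have "\<dots> \<le> d\<^sup>2 / e\<^sup>2" by (rule half) simp
    finally show ?thesis .
  qed
  define \<Delta> where "\<Delta> s z = X s z - Y s z" for s z
  have \<Delta>m[measurable]: "\<Delta> s \<in> borel_measurable N" for s unfolding \<Delta>_def[abs_def] by measurable
  \<comment> \<open>To subtract, both energies must be finite: the initial one by \<open>Jle\<close>
    and the second moment, the later one by the energy inequality itself.\<close>
  have energy: "(\<integral>z. J e (\<Delta> 1 z) - J e (\<Delta> 0 z) \<partial>N) \<le> 0" if e: "e > 0" for e
  proof -
    have pm[measurable]: "(\<lambda>(\<omega>, x). \<phi> 1 \<omega> x) \<in> borel_measurable (P \<Otimes>\<^sub>M \<rho>)"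
      using phi_joint_meas[of 1] by (subst measurable_cong_sets[OF sets_pair_measure_cong[OF refl sets_rho] refl]) simp
    have D0: "(\<integral>\<^sup>+z. ennreal (J e (\<Delta> 0 z)) \<partial>N) = (\<integral>\<^sup>+x. \<integral>\<^sup>+y. ennreal (J e (x - y)) \<partial>\<rho> \<partial>\<rho>)"
    proof -
      have "(\<integral>\<^sup>+z. ennreal (J e (\<Delta> 0 z)) \<partial>N) = (\<integral>\<^sup>+(\<omega>, x, y). ennreal (J e (x - y)) \<partial>(P \<Otimes>\<^sub>M (\<rho> \<Otimes>\<^sub>M \<rho>)))"
        unfolding N_def
        by (rule nn_integral_cong) (auto simp: \<Delta>_def X_def Y_def psi_0 space_pair_measure)
      also have "\<dots> = (\<integral>\<^sup>+\<omega>. \<integral>\<^sup>+x. \<integral>\<^sup>+y. ennreal (J e (x - y)) \<partial>\<rho> \<partial>\<rho> \<partial>P)" by (rule triple[symmetric]) measurable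
      finally show ?thesis by (simp add: emeasure_space_1)
    qed
    have D1: "(\<integral>\<^sup>+z. ennreal (J e (\<Delta> 1 z)) \<partial>N) = (\<integral>\<^sup>+\<omega>. \<integral>\<^sup>+x. \<integral>\<^sup>+y. ennreal (J e (\<phi> 1 \<omega> x - \<phi> 1 \<omega> y)) \<partial>\<rho> \<partial>\<rho> \<partial>P)"
    proof -
      have "(\<integral>\<^sup>+z. ennreal (J e (\<Delta> 1 z)) \<partial>N) = (\<integral>\<^sup>+(\<omega>, x, y). ennreal (J e (\<phi> 1 \<omega> x - \<phi> 1 \<omega> y)) \<partial>(P \<Otimes>\<^sub>M (\<rho> \<Otimes>\<^sub>M \<rho>)))"
        unfolding N_def by (rule nn_integral_cong) (auto simp: \<Delta>_def X_def Y_def psi_eq)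
      also have "\<dots> = (\<integral>\<^sup>+\<omega>. \<integral>\<^sup>+x. \<integral>\<^sup>+y. ennreal (J e (\<phi> 1 \<omega> x - \<phi> 1 \<omega> y)) \<partial>\<rho> \<partial>\<rho> \<partial>P)"
      proof (rule triple[symmetric])
        have "(\<lambda>z. ennreal (J e (\<Delta> 1 z))) \<in> borel_measurable N" by measurable
        thus "(\<lambda>(\<omega>, x, y). ennreal (J e (\<phi> 1 \<omega> x - \<phi> 1 \<omega> y))) \<in> borel_measurable (P \<Otimes>\<^sub>M (\<rho> \<Otimes>\<^sub>M \<rho>))"
          by (simp add: case_prod_unfold N_def \<Delta>_def X_def Y_def psi_eq)
      qed
      finally show ?thesis .
    qed
    have le: "(\<integral>\<^sup>+z. ennreal (J e (\<Delta> 1 z)) \<partial>N) \<le> (\<integral>\<^sup>+z. ennreal (J e (\<Delta> 0 z)) \<partial>N)"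
      unfolding D0 D1
      using log_energy_random_map[OF prob_space_axioms prob_rho sets_rho pm rho_invariant e] by (simp add: J_def)
    have "(\<integral>\<^sup>+z. ennreal (J e (\<Delta> 0 z)) \<partial>N) \<le> (\<integral>\<^sup>+z. ennreal ((2 / e\<^sup>2) * ((X 0 z)\<^sup>2 + (Y 0 z)\<^sup>2)) \<partial>N)"
    proof (intro nn_integral_mono ennreal_leI)
      fix z
      have "(\<Delta> 0 z)\<^sup>2 \<le> 2 * ((X 0 z)\<^sup>2 + (Y 0 z)\<^sup>2)"
        using zero_le_power2[of "X 0 z + Y 0 z"] by (simp add: \<Delta>_def power2_sum power2_diff)
      hence "(\<Delta> 0 z)\<^sup>2 / e\<^sup>2 \<le> 2 * ((X 0 z)\<^sup>2 + (Y 0 z)\<^sup>2) / e\<^sup>2" by (rule divide_right_mono) simp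
      thus "J e (\<Delta> 0 z) \<le> (2 / e\<^sup>2) * ((X 0 z)\<^sup>2 + (Y 0 z)\<^sup>2)" using Jle[OF e, of "\<Delta> 0 z"] by simp
    qed
    also have "\<dots> = (\<integral>\<^sup>+z. ennreal (2 / e\<^sup>2) * (ennreal ((X 0 z)\<^sup>2) + ennreal ((Y 0 z)\<^sup>2)) \<partial>N)"
      by (rule nn_integral_cong, subst ennreal_mult, simp, simp, subst ennreal_plus, simp, simp, rule refl)
    also have "\<dots> = ennreal (2 / e\<^sup>2) * (ennreal m + ennreal m)"
      by (simp add: nn_integral_cmult nn_integral_add sX sY)
    also have "\<dots> < \<infinity>" by (simp add: ennreal_mult_less_top)
    finally have fin0: "(\<integral>\<^sup>+z. ennreal (J e (\<Delta> 0 z)) \<partial>N) < \<infinity>" .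
    have I0: "integrable N (\<lambda>z. J e (\<Delta> 0 z))" by (rule integrableI_nonneg) (use J0[OF e] fin0 in auto)
    have I1: "integrable N (\<lambda>z. J e (\<Delta> 1 z))" by (rule integrableI_nonneg) (use J0[OF e] le fin0 in auto)
    have "ennreal (\<integral>z. J e (\<Delta> 1 z) \<partial>N) \<le> ennreal (\<integral>z. J e (\<Delta> 0 z) \<partial>N)"
      using le by (subst (asm) (1 2) nn_integral_eq_integral) (use I0 I1 J0[OF e] in auto)
    hence "(\<integral>z. J e (\<Delta> 1 z) \<partial>N) \<le> (\<integral>z. J e (\<Delta> 0 z) \<partial>N)"
      by (subst (asm) ennreal_le_iff) (auto intro!: integral_nonneg_AE J0[OF e])
    thus ?thesis using I0 I1 by simp
  qed
  \<comment> \<open>The smoothing parameter 1 / (n + 1) tends to 0. Increments of \<open>J\<close>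
    converge to the logarithmic growth \<open>Q\<close> off the diagonal, and
    \<open>log_bound\<close> dominates them uniformly in \<open>n\<close>, so the energies
    themselves need no limit.\<close>
  have "(\<lambda>n. \<integral>z. J (1 / real (Suc n)) (\<Delta> 1 z) - J (1 / real (Suc n)) (\<Delta> 0 z) \<partial>N) \<longlonglongrightarrow> (\<integral>z. Q z \<partial>N)"
  proof (rule integral_dominated_convergence[where w="\<lambda>z. \<bar>\<beta>\<bar> + 3 / 2 * (AX z + AY z)"])
    show "integrable N (\<lambda>z. \<bar>\<beta>\<bar> + 3 / 2 * (AX z + AY z))" using iA by simp
    show "Q \<in> borel_measurable N" using iQ(1) by simp
    show "AE z in N. norm (J (1 / real (Suc n)) (\<Delta> 1 z) - J (1 / real (Suc n)) (\<Delta> 0 z)) \<le> \<bar>\<beta>\<bar> + 3 / 2 * (AX z + AY z)" for n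
    proof (intro AE_I2)
      fix z assume z: "z \<in> space N"
      interpret C: cubic_pair 1 \<beta> "\<lambda>s. X s z" "\<lambda>s. Y s z"
        unfolding X_def Y_def by (rule cubic_pair_psi) (use space_N[OF z] in auto)
      have "norm (J (1 / real (Suc n)) (\<Delta> 1 z) - J (1 / real (Suc n)) (\<Delta> 0 z)) \<le> (LBINT s:{0..1}. \<bar>C.q s\<bar>)"
        using C.log_bound[of "(1 / real (Suc n))\<^sup>2"] by (simp add: J_def \<Delta>_def C.D_def)
      thus "norm (J (1 / real (Suc n)) (\<Delta> 1 z) - J (1 / real (Suc n)) (\<Delta> 0 z)) \<le> \<bar>\<beta>\<bar> + 3 / 2 * (AX z + AY z)"
        using q_abs[OF z] unfolding C.q_def by linarith
    qed
    show "AE z in N. (\<lambda>n. J (1 / real (Suc n)) (\<Delta> 1 z) - J (1 / real (Suc n)) (\<Delta> 0 z)) \<longlonglongrightarrow> Q z"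
      using distinct
    proof (rule AE_mp, intro AE_I2 impI)
      fix z assume z: "z \<in> space N" and d: "fst (snd z) \<noteq> snd (snd z)"
      interpret C: cubic_pair 1 \<beta> "\<lambda>s. X s z" "\<lambda>s. Y s z"
        unfolding X_def Y_def by (rule cubic_pair_psi) (use space_N[OF z] in auto)
      have ef: "\<Delta> 1 z = \<Delta> 0 z * exp (Q z)" using C.exp_formula unfolding C.D_def \<Delta>_def C.q_def Q_def .
      have nz: "\<Delta> 0 z \<noteq> 0" using d psi_0[OF space_N[OF z]] by (simp add: \<Delta>_def X_def Y_def)
      have "ln ((\<Delta> 1 z)\<^sup>2) = ln ((\<Delta> 0 z)\<^sup>2) + ln ((exp (Q z))\<^sup>2)"
        unfolding ef power_mult_distrib using nz by (simp add: ln_mult)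
      hence lnQ: "ln ((\<Delta> 1 z)\<^sup>2) / 2 - ln ((\<Delta> 0 z)\<^sup>2) / 2 = Q z" by (simp add: ln_realpow add_divide_distrib)
      have nz1: "\<Delta> 1 z \<noteq> 0" using nz ef by simp
      have e0: "(\<lambda>n. (1 / real (Suc n))\<^sup>2) \<longlonglongrightarrow> 0"
        using tendsto_power[OF LIMSEQ_Suc[OF lim_const_over_n[of 1]], of 2] unfolding power_zero_numeral .
      have "(\<lambda>n. ln ((\<Delta> 1 z)\<^sup>2 + (1 / real (Suc n))\<^sup>2) / 2 - ln ((\<Delta> 0 z)\<^sup>2 + (1 / real (Suc n))\<^sup>2) / 2)
          \<longlonglongrightarrow> ln ((\<Delta> 1 z)\<^sup>2 + 0) / 2 - ln ((\<Delta> 0 z)\<^sup>2 + 0) / 2"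
        by (intro tendsto_intros e0) (use nz nz1 in auto)
      thus "(\<lambda>n. J (1 / real (Suc n)) (\<Delta> 1 z) - J (1 / real (Suc n)) (\<Delta> 0 z)) \<longlonglongrightarrow> Q z"
        using lnQ by (simp add: J_def)
    qed
  qed measurable
  hence "(\<integral>z. Q z \<partial>N) \<le> 0"
    by (rule LIMSEQ_le_const2) (auto intro!: energy)
  hence "\<beta> - 3 * m + integral\<^sup>L N E / 2 \<le> 0" using iQ(2) by simp
  hence "\<beta> < 3 * m" using Epos' by linarith
  thus ?thesis by (simp add: m_def)
qed

end

section \<open>Nondegeneracy of the noise\<close>

lemma stable_constant_pos:
  assumes "0 < \<alpha>" "\<alpha> < 2"
  shows "stable_constant \<alpha> > 0"
  using assms unfolding stable_constant_def
  by (intro mult_pos_pos divide_pos_pos Gamma_real_pos) auto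

lemma emeasure_truncated_stable_levy_measure_nonzero:
  assumes "0 < \<alpha>" "\<alpha> < 2"
  shows "emeasure (truncated_stable_levy_measure \<alpha>) UNIV \<noteq> 0"
proof
  define g where "g z = ennreal (stable_constant \<alpha> * \<bar>z\<bar> powr (- 1 - \<alpha>)) * indicator (- {0}) z" for z :: real
  have [measurable]: "g \<in> borel_measurable borel" unfolding g_def by measurable
  have [measurable]: "{z::real. \<bar>z\<bar> < 1} \<in> sets borel" by measurable
  assume "emeasure (truncated_stable_levy_measure \<alpha>) UNIV = 0"
  moreover have "emeasure (truncated_stable_levy_measure \<alpha>) UNIV = (\<integral>\<^sup>+z. g z * indicator {z. \<bar>z\<bar> < 1} z \<partial>lborel)"
    unfolding truncated_stable_levy_measure_def stable_levy_measure_def g_def[symmetric]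
    by (simp add: density_density_eq emeasure_density)
  ultimately have "(\<integral>\<^sup>+z. g z * indicator {z. \<bar>z\<bar> < 1} z \<partial>lborel) = 0" by simp
  hence "AE z in lborel. g z * indicator {z. \<bar>z\<bar> < 1} z = 0"
    by (subst (asm) nn_integral_0_iff_AE) simp_all
  hence "AE z in lborel. z \<notin> {0<..<1::real}"
  proof eventually_elim
    case (elim z)
    show ?case
    proof
      assume "z \<in> {0<..<1}"
      thus False using elim stable_constant_pos[OF assms] by (auto simp: g_def indicator_def mult_le_0_iff split: if_splits)
    qed
  qed
  hence "{0<..<1::real} \<in> null_sets lborel" by (subst AE_iff_null_sets) auto
  thus False by (simp add: null_sets_def)
qed

text \<open>An almost sure identity at each time yields a common exceptional set for countably many
  times only; right continuity recovers the remaining ones.\<close>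

lemma right_continuous_zero_on_rationals:
  fixes g :: "real \<Rightarrow> real"
  assumes "(g \<longlongrightarrow> g t) (at_right t)" and "\<And>r. r \<in> \<rat> \<Longrightarrow> t < r \<Longrightarrow> g r = 0"
  shows "g t = 0"
proof (rule ccontr)
  assume "g t \<noteq> 0"
  hence "eventually (\<lambda>s. g s \<noteq> 0) (at_right t)" by (rule tendsto_imp_eventually_ne[OF assms(1)])
  then obtain b where b: "b > t" "\<And>s. t < s \<Longrightarrow> s < b \<Longrightarrow> g s \<noteq> 0"
    by (auto simp: eventually_at_right_field)
  obtain r where "r \<in> \<rat>" "t < r" "r < b" using Rats_dense_in_real[OF b(1)] by blast
  thus False using b(2) assms(2) by blast
qed

context sde_rds
begin

text \<open>For a constant solution the equation expresses \<sigma> times the path as minus an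
  indefinite integral, which is continuous in time; dividing by \<sigma> transfers the continuity to
  the path.\<close>

lemma no_jump_if_constant:
  assumes \<sigma>: "\<sigma> \<noteq> 0" and w: "\<omega> \<in> space P" and fix_x: "\<And>r. r \<in> \<rat> \<Longrightarrow> 0 \<le> r \<Longrightarrow> \<phi> r \<omega> x = x"
    and t: "0 < t" "t \<le> 1"
  shows "jump \<omega> t = 0"
proof -
  define h where "h s = (LBINT r:{0..s}. \<beta> * \<psi> r \<omega> x - \<psi> r \<omega> x ^ 3)" for s
  \<comment> \<open>The longer interval keeps \<open>t\<close> = 1 in the interior, where the
    two-sided limit of \<open>h\<close> and the right limit of the path are both at hand.\<close>
  have hc: "continuous_on {0..2} h" unfolding h_def
    by (rule continuous_on_set_integral_Icc) (rule psi_int[OF w], simp)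
  have hlim: "(h \<longlongrightarrow> h s) (at s)" if "0 < s" "s < 2" for s
    using hc that by (intro continuous_on_interior[unfolded isCont_def, of "{0..2}"]) auto
  have zero: "h s + \<sigma> * \<omega> s = 0" if s: "0 < s" "s < 2" for s
  proof (rule right_continuous_zero_on_rationals[where g="\<lambda>s. h s + \<sigma> * \<omega> s"])
    have "(\<omega> \<longlongrightarrow> \<omega> s) (at_right s)" using w by (simp add: space_P cadlag_paths_def cadlag_def)
    thus "((\<lambda>s. h s + \<sigma> * \<omega> s) \<longlongrightarrow> h s + \<sigma> * \<omega> s) (at_right s)"
      by (intro tendsto_intros tendsto_within_subset[OF hlim[OF s]]) auto
    fix r :: real assume "r \<in> \<rat>" "s < r"
    thus "h r + \<sigma> * \<omega> r = 0"
      using psi_sol[OF w, of r x] fix_x[of r] s by (simp add: h_def psi_eq)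
  qed
  hence eq: "\<omega> s = - h s / \<sigma>" if "0 < s" "s < 2" for s
    using zero[OF that] \<sigma> by (simp add: field_simps)
  have "((\<lambda>s. - h s / \<sigma>) \<longlongrightarrow> - h t / \<sigma>) (at_left t)"
    by (intro tendsto_intros tendsto_within_subset[OF hlim]) (use t \<sigma> in auto)
  moreover have "\<forall>\<^sub>F s in at_left t. - h s / \<sigma> = \<omega> s"
    by (rule eventually_at_leftI[of 0]) (use eq t in auto)
  ultimately have "(\<omega> \<longlongrightarrow> - h t / \<sigma>) (at_left t)" by (rule Lim_transform_eventually)
  hence "(\<omega> \<longlongrightarrow> \<omega> t) (at_left t)" using eq[of t] t by simp
  hence "Lim (at_left t) \<omega> = \<omega> t" by (intro tendsto_Lim) simp_all
  thus ?thesis by (simp add: jump_def)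
qed

text \<open>A constant solution would almost surely forbid jumps during unit time. A Poisson count
  of finite intensity is 0 with probability exp (- intensity), which is below 1 when the intensity
  is positive, and a count of infinite intensity is almost surely infinite. Covering both cases
  leaves only positivity of the mass of \<nu> to be checked.\<close>

lemma nondegenerate:
  assumes \<sigma>: "\<sigma> \<noteq> 0"
    and prm: "poisson_random_measure P (\<lambda>\<omega>. jump_measure (\<lambda>t. \<omega> t)) (lborel \<Otimes>\<^sub>M \<nu>)"
    and \<nu>: "sets \<nu> = sets borel" "sigma_finite_measure \<nu>" "emeasure \<nu> UNIV \<noteq> 0"
  shows "\<not> (\<exists>x. \<forall>t\<ge>0. AE \<omega> in P. \<phi> t \<omega> x = x)"
proof
  assume "\<exists>x. \<forall>t\<ge>0. AE \<omega> in P. \<phi> t \<omega> x = x"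
  then obtain x where x: "\<And>t. t \<ge> 0 \<Longrightarrow> AE \<omega> in P. \<phi> t \<omega> x = x" by blast
  have "AE \<omega> in P. \<forall>r\<in>\<rat> \<inter> {0..}. \<phi> r \<omega> x = x"
    by (subst AE_ball_countable) (auto intro: x countable_Int1 countable_rat)
  \<comment> \<open>A time window of length 1, so that the intensity of \<open>A\<close> is the
    total mass of \<nu>.\<close>
  define A where "A = {0<..1::real} \<times> (UNIV :: real set)"
  have A: "A \<in> sets (lborel \<Otimes>\<^sub>M \<nu>)"
    unfolding A_def by (rule pair_measureI) (use \<nu>(1) in auto)
  have mA: "emeasure (lborel \<Otimes>\<^sub>M \<nu>) A = emeasure \<nu> UNIV"
    unfolding A_def using \<nu> by (subst sigma_finite_measure.emeasure_pair_measure_Times) auto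
  have N0: "AE \<omega> in P. emeasure (jump_measure \<omega>) A = 0"
    using \<open>AE \<omega> in P. \<forall>r\<in>\<rat> \<inter> {0..}. \<phi> r \<omega> x = x\<close>
  proof (rule AE_mp, intro AE_I2 impI)
    fix \<omega> assume w: "\<omega> \<in> space P" and f: "\<forall>r\<in>\<rat> \<inter> {0..}. \<phi> r \<omega> x = x"
    have nj: "jump \<omega> t = 0" if "0 < t" "t \<le> 1" for t
      by (rule no_jump_if_constant[OF \<sigma> w _ that, of x]) (use f in auto)
    have "A \<in> sets (borel \<Otimes>\<^sub>M borel)" unfolding A_def by (rule pair_measureI) auto
    hence "emeasure (jump_measure \<omega>) A
        = emeasure (count_space {t. jump \<omega> t \<noteq> 0}) ((\<lambda>t. (t, jump \<omega> t)) -` A \<inter> {t. jump \<omega> t \<noteq> 0})"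
      unfolding jump_measure_def by (subst emeasure_distr) (auto simp: space_pair_measure)
    also have "(\<lambda>t. (t, jump \<omega> t)) -` A \<inter> {t. jump \<omega> t \<noteq> 0} = {}"
      using nj by (auto simp: A_def)
    finally show "emeasure (jump_measure \<omega>) A = 0" by simp
  qed
  show False
  proof (cases "emeasure \<nu> UNIV = \<infinity>")
    case True
    hence "AE \<omega> in P. emeasure (jump_measure \<omega>) A = \<infinity>"
      using prm A mA unfolding poisson_random_measure_def by simp
    with N0 have "AE \<omega> in P. False" by eventually_elim simp
    thus False by simp
  next
    case False
    hence fin: "emeasure (lborel \<Otimes>\<^sub>M \<nu>) A < \<infinity>" using mA by (simp add: less_top)
    have Nm[measurable]: "(\<lambda>\<omega>. emeasure (jump_measure \<omega>) A) \<in> borel_measurable P"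
      using prm A unfolding poisson_random_measure_def by simp
    have "\<forall>k::nat. measure P {\<omega>\<in>space P. emeasure (jump_measure \<omega>) A = of_nat k}
        = exp (- measure (lborel \<Otimes>\<^sub>M \<nu>) A) * measure (lborel \<Otimes>\<^sub>M \<nu>) A ^ k / fact k"
      using prm A fin unfolding poisson_random_measure_def by simp
    from spec[OF this, of 0]
    have "prob {\<omega>\<in>space P. emeasure (jump_measure \<omega>) A = 0} = exp (- measure (lborel \<Otimes>\<^sub>M \<nu>) A)" by simp
    moreover have "prob {\<omega>\<in>space P. emeasure (jump_measure \<omega>) A = 0} = 1"
      using N0 by (subst prob_Collect_eq_1) measurable
    ultimately have "measure (lborel \<Otimes>\<^sub>M \<nu>) A = 0" by simp
    thus False using fin mA \<nu>(3) by (simp add: measure_def enn2real_eq_0_iff)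
  qed
qed

end

section \<open>Comparison of the two bounds on the second moment\<close>

theorem theorem3p2:
  fixes \<alpha> \<beta> \<sigma> \<Lambda> :: real
    and P :: "(real \<Rightarrow> real) measure"
    and \<phi> :: "(real \<Rightarrow> real) cocycle"
    and a :: "(real \<Rightarrow> real) \<Rightarrow> real"
    and \<mu> :: "((real \<Rightarrow> real) \<times> real) measure"
  assumes "1 < \<alpha>" and "\<alpha> < 2" and "\<sigma> \<noteq> 0"
    and "truncated_stable_law \<alpha> P"
    and "rds_generated_by_sde P \<beta> \<sigma> \<phi>"
    and "random_attractor P wiener_shift \<phi> (\<lambda>\<omega>. {a \<omega>})"
    and "invariant_measure P wiener_shift \<phi> \<mu>"
    and "disintegration P \<mu> (\<lambda>\<omega>. return borel (a \<omega>))"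
    and "is_lyapunov_exponent P \<phi> a \<Lambda>"
  shows "\<Lambda> < 0"
proof -
  let ?\<nu> = "truncated_stable_levy_measure \<alpha>"
  interpret attracted_sde_rds P \<beta> \<sigma> \<phi> a
    by unfold_locales (use assms in \<open>auto simp: truncated_stable_law_def truncated_stable_process_def\<close>)
  have fin_moment: "(\<integral>\<^sup>+x. ennreal (x\<^sup>2) \<partial>\<rho>) \<le> ennreal ((\<beta> - \<Lambda>) / 3)"
    using assms(9) by (rule second_moment_le(1))
  hence fin: "(\<integral>\<^sup>+x. ennreal (x\<^sup>2) \<partial>\<rho>) < \<infinity>" using le_less_trans[OF _ ennreal_less_top] by simp
  have sf: "sigma_finite_measure ?\<nu>"
  proof -
    have [measurable]: "{z::real. \<bar>z\<bar> < 1} \<in> sets borel" by measurable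
    have "?\<nu> = density lborel (\<lambda>z. ennreal (stable_constant \<alpha> * \<bar>z\<bar> powr (- 1 - \<alpha>)) * indicator (- {0}) z * indicator {z. \<bar>z\<bar> < 1} z)"
      unfolding truncated_stable_levy_measure_def stable_levy_measure_def
      by (subst density_density_eq) auto
    moreover have "sigma_finite_measure \<dots>"
      by (subst sigma_finite_measure.sigma_finite_iff_density_finite[OF lborel.sigma_finite_measure_axioms]) (auto simp: indicator_def)
    ultimately show ?thesis by simp
  qed
  have "\<not> (\<exists>x. \<forall>t\<ge>0. AE \<omega> in P. \<phi> t \<omega> x = x)"
  proof (rule nondegenerate)
    show "poisson_random_measure P (\<lambda>\<omega>. jump_measure (\<lambda>t. \<omega> t)) (lborel \<Otimes>\<^sub>M ?\<nu>)"
      using assms(4) by (simp add: truncated_stable_law_def truncated_stable_process_def)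
    show "sets ?\<nu> = sets borel" by (simp add: truncated_stable_levy_measure_def stable_levy_measure_def)
    show "emeasure ?\<nu> UNIV \<noteq> 0"
      by (rule emeasure_truncated_stable_levy_measure_nonzero) (use assms in auto)
  qed (use assms sf in auto)
  hence "\<beta> < 3 * (\<integral>x. x\<^sup>2 \<partial>\<rho>)" by (intro second_moment_gt[OF fin] no_atoms)
  moreover have "ennreal (\<integral>x. x\<^sup>2 \<partial>\<rho>) \<le> ennreal ((\<beta> - \<Lambda>) / 3)"
    using fin_moment by (subst (asm) nn_integral_eq_integral[OF integrable_square_rho[OF fin]]) auto
  \<comment> \<open>\<open>ennreal\<close> sends negative numbers to 0, so the inequality transfers
    to the reals only once the right-hand side is known to be nonnegative, that is \<Lambda> \<le>
    \<beta>.\<close>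
  hence "(\<integral>x. x\<^sup>2 \<partial>\<rho>) \<le> (\<beta> - \<Lambda>) / 3"
    using second_moment_le(2)[OF assms(9)] by (subst (asm) ennreal_le_iff) auto
  ultimately show ?thesis by simp
qed

end
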